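(* Let $\mathcal{H}$ be a Hilbert space and let $\alpha$ be an automorphism of $\mathcal{C}(\mathcal{H})$, the C$^*$-algebra of all compact operators on $\mathcal{H}$. Then the Möbius function $\mu$ is linearly disjoint from $(\mathcal{C}(\mathcal{H})+\mathbb{C}I,\alpha)$.
   Context: $\mu$ is the Möbius function: $\mu(1)=1$, $\mu(n)=0$ if $n$ is not square-free, and $\mu(n)=(-1)^t$ if $n$ is a product of $t$ distinct primes. Automorphisms are $*$-automorphisms. $I$ is the identity operator on $\mathcal{H}$, and $\alpha$ is regarded as an automorphism of $\mathcal{C}(\mathcal{H})+\mathbb{C}I$ by setting $\alpha(I)=I$. For a C$^*$-algebra $\mathfrak{A}$ and an automorphism $\alpha$ of $\mathfrak{A}$, $\mu$ is linearly disjoint from $(\mathfrak{A},\alpha)$ if $\frac1N\sum_{n=1}^N\mu(n)\rho(\alpha^n(A))\to0$ as $N\to\infty$ for every state $\rho$ on $\mathfrak{A}$ and every $A\in\mathfrak{A}$. *)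

theory Defs
  imports "HOL-Analysis.Analysis" "HOL-Computational_Algebra.Squarefree"
begin

section \<open>Complex normed spaces and Hilbert spaces\<close>

class complex_vector = real_vector +
  fixes scaleC :: "complex \<Rightarrow> 'a \<Rightarrow> 'a" (infixr \<open>*\<^sub>C\<close> 75)
  assumes scaleC_add_right: "c *\<^sub>C (x + y) = c *\<^sub>C x + c *\<^sub>C y"
    and scaleC_add_left: "(c + d) *\<^sub>C x = c *\<^sub>C x + d *\<^sub>C x"
    and scaleC_scaleC [simp]: "c *\<^sub>C d *\<^sub>C x = (c * d) *\<^sub>C x"
    and scaleC_one [simp]: "1 *\<^sub>C x = x"
    and scaleR_scaleC: "r *\<^sub>R x = complex_of_real r *\<^sub>C x"
begin

lemma scaleC_zero_left [simp]: "0 *\<^sub>C x = 0"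
  using scaleC_add_left[of 0 0 x] by simp

lemma scaleC_zero_right [simp]: "c *\<^sub>C 0 = 0"
  using scaleC_add_right[of c 0 0] by simp

lemma scaleC_minus_left: "(- c) *\<^sub>C x = - (c *\<^sub>C x)"
  using scaleC_add_left[of c "- c" x] by (simp add: eq_neg_iff_add_eq_0 add.commute)

lemma scaleC_minus_right: "c *\<^sub>C (- x) = - (c *\<^sub>C x)"
  using scaleC_add_right[of c x "- x"] by (simp add: eq_neg_iff_add_eq_0 add.commute)

lemma scaleC_diff_left: "(c - d) *\<^sub>C x = c *\<^sub>C x - d *\<^sub>C x"
  using scaleC_add_left[of c "- d" x] by (simp add: scaleC_minus_left)

lemma scaleC_diff_right: "c *\<^sub>C (x - y) = c *\<^sub>C x - c *\<^sub>C y"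
  using scaleC_add_right[of c x "- y"] by (simp add: scaleC_minus_right)

end

class complex_normed_vector = complex_vector + real_normed_vector +
  assumes norm_scaleC [simp]: "norm (c *\<^sub>C x) = cmod c * norm x"

lemma bounded_linear_scaleC_right: "bounded_linear (\<lambda>x::'a::complex_normed_vector. c *\<^sub>C x)"
  by (rule bounded_linear_intro[where K = "cmod c"])
     (simp_all add: scaleC_add_right scaleR_scaleC mult.commute)

text \<open>Complex Hilbert spaces of arbitrary dimension (zero, finite, or infinite and possibly
  nonseparable); the inner product is linear in its first argument.\<close>

class chilbert_space = complex_normed_vector + banach +
  fixes cinner :: "'a \<Rightarrow> 'a \<Rightarrow> complex"
  assumes cinner_commute: "cinner x y = cnj (cinner y x)"
    and cinner_add_left: "cinner (x + y) z = cinner x z + cinner y z"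
    and cinner_scaleC_left [simp]: "cinner (c *\<^sub>C x) y = c * cinner x y"
    and cinner_self: "cinner x x = complex_of_real ((norm x)\<^sup>2)"
begin

lemma cinner_add_right: "cinner x (y + z) = cinner x y + cinner x z"
  by (metis cinner_add_left cinner_commute complex_cnj_add)

lemma cinner_scaleC_right [simp]: "cinner x (c *\<^sub>C y) = cnj c * cinner x y"
  by (metis cinner_scaleC_left cinner_commute complex_cnj_mult)

lemma cinner_zero_left [simp]: "cinner 0 y = 0"
  using cinner_add_left[of 0 0 y] by simp

lemma cinner_zero_right [simp]: "cinner x 0 = 0"
  using cinner_add_right[of x 0 0] by simp

lemma cinner_minus_left: "cinner (- x) y = - cinner x y"
  using cinner_scaleC_left[of "-1" x y] by (simp add: scaleC_minus_left del: cinner_scaleC_left)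

lemma cinner_minus_right: "cinner x (- y) = - cinner x y"
  using cinner_scaleC_right[of x "-1" y] by (simp add: scaleC_minus_left del: cinner_scaleC_right)

lemma cinner_diff_left: "cinner (x - y) z = cinner x z - cinner y z"
  using cinner_add_left[of x "- y" z] by (simp add: cinner_minus_left)

lemma cinner_diff_right: "cinner x (y - z) = cinner x y - cinner x z"
  using cinner_add_right[of x y "- z"] by (simp add: cinner_minus_right)

lemma norm_sq_add: "(norm (x + y))\<^sup>2 = (norm x)\<^sup>2 + (norm y)\<^sup>2 + 2 * Re (cinner x y)"
proof -
  have "complex_of_real ((norm (x + y))\<^sup>2)
      = cinner x x + cinner y y + (cinner x y + cnj (cinner x y))"
    unfolding cinner_self[symmetric]
    by (simp add: cinner_add_left cinner_add_right cinner_commute[of y x])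
  then have "Re (complex_of_real ((norm (x + y))\<^sup>2))
      = Re (cinner x x + cinner y y + (cinner x y + cnj (cinner x y)))"
    by simp
  then show ?thesis
    unfolding cinner_self by simp
qed

lemma norm_sq_diff: "(norm (x - y))\<^sup>2 = (norm x)\<^sup>2 + (norm y)\<^sup>2 - 2 * Re (cinner x y)"
  using norm_sq_add[of x "- y"] by (simp add: cinner_minus_right)

lemma norm_sq_diff_proj:
  assumes "y \<noteq> 0"
  shows "(norm (x - (cinner x y / complex_of_real ((norm y)\<^sup>2)) *\<^sub>C y))\<^sup>2
    = (norm x)\<^sup>2 - (cmod (cinner x y))\<^sup>2 / (norm y)\<^sup>2"
proof -
  define c where "c = cinner x y / complex_of_real ((norm y)\<^sup>2)"
  have cn: "cmod c = cmod (cinner x y) / (norm y)\<^sup>2"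
    by (simp add: c_def norm_divide norm_power)
  have "cnj c * cinner x y = complex_of_real ((cmod (cinner x y))\<^sup>2 / (norm y)\<^sup>2)"
    unfolding c_def
    by (simp add: complex_norm_square[symmetric] mult.commute)
  then have re: "Re (cinner x (c *\<^sub>C y)) = (cmod (cinner x y))\<^sup>2 / (norm y)\<^sup>2"
    by simp
  have "(norm (c *\<^sub>C y))\<^sup>2 = (cmod (cinner x y))\<^sup>2 / (norm y)\<^sup>2"
    using assms by (simp add: cn power_mult_distrib power_divide power2_eq_square)
  then show ?thesis
    using norm_sq_diff[of x "c *\<^sub>C y"] re unfolding c_def by linarith
qed

lemma norm_cinner_le: "cmod (cinner x y) \<le> norm x * norm y"
proof (cases "y = 0")
  case True
  then show ?thesis by simp
next
  case False
  then have y: "(norm y)\<^sup>2 > 0"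
    by simp
  have "0 \<le> (norm x)\<^sup>2 - (cmod (cinner x y))\<^sup>2 / (norm y)\<^sup>2"
    unfolding norm_sq_diff_proj[OF False, symmetric] by simp
  then have "(cmod (cinner x y))\<^sup>2 \<le> (norm x * norm y)\<^sup>2"
    using y by (simp add: pos_divide_le_eq power_mult_distrib)
  then show ?thesis
    by (rule power2_le_imp_le) simp
qed

lemma cinner_left_eqI:
  assumes "\<And>z. cinner z x = cinner z y"
  shows "x = y"
proof -
  have "cinner (x - y) (x - y) = 0"
    by (simp add: cinner_diff_right assms)
  then show ?thesis
    by (simp add: cinner_self)
qed

end

theorem riesz_representation:
  fixes f :: "'a::chilbert_space \<Rightarrow> complex"
  assumes add: "\<And>x y. f (x + y) = f x + f y"
    and scale: "\<And>c x. f (c *\<^sub>C x) = c * f x"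
    and bound: "\<And>x. cmod (f x) \<le> norm x * K"
  shows "\<exists>z. \<forall>x. f x = cinner x z"
proof (cases "\<forall>x. f x = 0")
  case True
  then show ?thesis
    by (intro exI[of _ 0]) simp
next
  case False
  then obtain w where w: "f w \<noteq> 0"
    by blast
  have bl: "bounded_linear f"
    using add scale bound
    by (intro bounded_linear_intro[where K = K])
       (auto simp: scaleR_scaleC scaleR_conv_of_real)
  define S where "S = {x. f x = 1}"
  define d where "d = Inf (norm ` S)"
  have S_ne: "norm ` S \<noteq> {}"
    using w scale[of "1 / f w" w] by (auto simp: S_def)
  have bb: "bdd_below (norm ` S)"
    by (rule bdd_belowI[of _ 0]) auto
  have d_le: "d \<le> norm x" if "x \<in> S" for x
    unfolding d_def using that bb by (intro cInf_lower) auto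
  have d0: "0 \<le> d"
    unfolding d_def using S_ne by (intro cInf_greatest) auto
  have "\<exists>x. x \<in> S \<and> norm x < d + 1 / real (Suc n)" for n
    using cInf_lessD[OF S_ne, of "d + 1 / real (Suc n)"] by (auto simp: d_def)
  then obtain X where XS: "\<And>n. X n \<in> S" and Xd: "\<And>n. norm (X n) < d + 1 / real (Suc n)"
    by metis
  have lim1: "(\<lambda>n. d + 1 / real (Suc n)) \<longlonglongrightarrow> d"
    using tendsto_add[OF tendsto_const LIMSEQ_inverse_real_of_nat, of d]
    by (simp add: inverse_eq_divide)
  have limn: "(\<lambda>n. norm (X n)) \<longlonglongrightarrow> d"
    by (rule tendsto_sandwich[OF _ _ tendsto_const lim1])
       (use d_le XS Xd in \<open>auto intro!: always_eventually less_imp_le\<close>)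
  have par: "(norm (x - y))\<^sup>2 \<le> 2 * (norm x)\<^sup>2 + 2 * (norm y)\<^sup>2 - 4 * d\<^sup>2"
    if "x \<in> S" "y \<in> S" for x y
  proof -
    have "(1/2) *\<^sub>C (x + y) \<in> S"
      using that by (simp add: S_def scale add)
    then have "d \<le> norm ((1/2) *\<^sub>C (x + y))"
      by (rule d_le)
    then have "2 * d \<le> norm (x + y)"
      by simp
    then have "(2 * d)\<^sup>2 \<le> (norm (x + y))\<^sup>2"
      using d0 by (intro power_mono) auto
    then have "4 * d\<^sup>2 \<le> (norm (x + y))\<^sup>2"
      by (simp add: power_mult_distrib)
    then show ?thesis
      using norm_sq_add[of x y] norm_sq_diff[of x y] by linarith
  qed
  have "Cauchy X"
  proof (rule CauchyI)
    fix e :: real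
    assume e: "0 < e"
    have "(\<lambda>n. (norm (X n))\<^sup>2) \<longlonglongrightarrow> d\<^sup>2"
      using limn by (intro tendsto_intros)
    then have "\<forall>\<^sub>F n in sequentially. (norm (X n))\<^sup>2 < d\<^sup>2 + e\<^sup>2 / 4"
      by (rule order_tendstoD) (use e in simp)
    then obtain M where M: "\<And>n. n \<ge> M \<Longrightarrow> (norm (X n))\<^sup>2 < d\<^sup>2 + e\<^sup>2 / 4"
      by (auto simp: eventually_sequentially)
    have "norm (X m - X n) < e" if "m \<ge> M" "n \<ge> M" for m n
    proof -
      have "(norm (X m - X n))\<^sup>2 < e\<^sup>2"
        using par[OF XS[of m] XS[of n]] M[OF that(1)] M[OF that(2)] by linarith
      then show ?thesis
        using e by (simp add: power_less_imp_less_base)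
    qed
    then show "\<exists>M. \<forall>m\<ge>M. \<forall>n\<ge>M. norm (X m - X n) < e"
      by blast
  qed
  then obtain x where x: "X \<longlonglongrightarrow> x"
    using Cauchy_convergent_iff convergent_def by blast
  have "(\<lambda>n. f (X n)) \<longlonglongrightarrow> f x"
    by (rule bounded_linear.tendsto[OF bl x])
  moreover have "(\<lambda>n. f (X n)) = (\<lambda>n. 1)"
    using XS by (simp add: S_def)
  ultimately have fx: "f x = 1"
    using LIMSEQ_unique tendsto_const by metis
  have nx: "norm x = d"
    using LIMSEQ_unique[OF tendsto_norm[OF x] limn] .
  have diff: "f (u - v) = f u - f v" for u v
    using bl by (simp add: bounded_linear.linear linear_diff)
  have orth: "cinner x h = 0" if h: "f h = 0" for h
  proof (cases "h = 0")
    case True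
    then show ?thesis by simp
  next
    case False
    let ?p = "x - (cinner x h / complex_of_real ((norm h)\<^sup>2)) *\<^sub>C h"
    have "?p \<in> S"
      using h fx by (simp add: S_def diff scale)
    then have "(norm x)\<^sup>2 \<le> (norm ?p)\<^sup>2"
      using d_le d0 nx by (intro power_mono) auto
    then have "(cmod (cinner x h))\<^sup>2 / (norm h)\<^sup>2 \<le> 0"
      unfolding norm_sq_diff_proj[OF False] by linarith
    then show ?thesis
      using False by (simp add: divide_le_0_iff)
  qed
  have x0: "norm x \<noteq> 0"
    using fx bound[of x] by auto
  have "f y = cinner y ((1 / complex_of_real ((norm x)\<^sup>2)) *\<^sub>C x)" for y
  proof -
    have "cinner x (y - f y *\<^sub>C x) = 0"
      by (rule orth) (simp add: diff scale fx)
    then have "cinner (y - f y *\<^sub>C x) x = 0"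
      by (metis cinner_commute complex_cnj_zero)
    then have "cinner y x = f y * complex_of_real ((norm x)\<^sup>2)"
      by (simp add: cinner_diff_left cinner_self)
    then show ?thesis
      using x0 by simp
  qed
  then show ?thesis
    by blast
qed


section \<open>C*-algebras\<close>

text \<open>Algebras are not required to have a unit (or to be nonzero), so that the operators on the
  zero space are covered.  A general C*-algebra is handled below as a carrier set: a norm-closed
  *-subalgebra of a type of this class.\<close>

class cstar_algebra = complex_normed_vector + banach + real_normed_algebra +
  fixes star :: "'a \<Rightarrow> 'a"
  assumes mult_scaleC_left [simp]: "(c *\<^sub>C a) * b = c *\<^sub>C (a * b)"
    and mult_scaleC_right [simp]: "a * (c *\<^sub>C b) = c *\<^sub>C (a * b)"
    and star_star [simp]: "star (star a) = a"
    and star_add: "star (a + b) = star a + star b"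
    and star_scaleC: "star (c *\<^sub>C a) = cnj c *\<^sub>C star a"
    and star_mult: "star (a * b) = star b * star a"
    and norm_star_mult_self: "norm (star a * a) = (norm a)\<^sup>2"

definition star_automorphism :: "'a::cstar_algebra set \<Rightarrow> ('a \<Rightarrow> 'a) \<Rightarrow> bool"
  where "star_automorphism \<AA> \<alpha> \<longleftrightarrow>
    bij_betw \<alpha> \<AA> \<AA> \<and>
    (\<forall>a\<in>\<AA>. \<forall>b\<in>\<AA>. \<alpha> (a + b) = \<alpha> a + \<alpha> b) \<and>
    (\<forall>c. \<forall>a\<in>\<AA>. \<alpha> (c *\<^sub>C a) = c *\<^sub>C \<alpha> a) \<and>
    (\<forall>a\<in>\<AA>. \<forall>b\<in>\<AA>. \<alpha> (a * b) = \<alpha> a * \<alpha> b) \<and>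
    (\<forall>a\<in>\<AA>. \<alpha> (star a) = star (\<alpha> a))"

text \<open>A state is a positive linear functional of norm 1; only its values on the carrier matter.\<close>

definition state_on :: "'a::cstar_algebra set \<Rightarrow> ('a \<Rightarrow> complex) \<Rightarrow> bool"
  where "state_on \<AA> \<rho> \<longleftrightarrow>
    (\<forall>a\<in>\<AA>. \<forall>b\<in>\<AA>. \<rho> (a + b) = \<rho> a + \<rho> b) \<and>
    (\<forall>c. \<forall>a\<in>\<AA>. \<rho> (c *\<^sub>C a) = c * \<rho> a) \<and>
    (\<forall>a\<in>\<AA>. \<rho> (star a * a) \<in> \<real>\<^sub>\<ge>\<^sub>0) \<and>
    bdd_above {cmod (\<rho> a) | a. a \<in> \<AA> \<and> norm a \<le> 1} \<and>
    Sup {cmod (\<rho> a) | a. a \<in> \<AA> \<and> norm a \<le> 1} = 1"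

definition moebius_mu :: "nat \<Rightarrow> int"
  where "moebius_mu n = (if squarefree n then (-1) ^ card (prime_factors n) else 0)"

definition linearly_disjoint ::
    "(nat \<Rightarrow> int) \<Rightarrow> 'a::cstar_algebra set \<Rightarrow> ('a \<Rightarrow> 'a) \<Rightarrow> bool"
  where "linearly_disjoint f \<AA> \<alpha> \<longleftrightarrow>
    (\<forall>\<rho> a. state_on \<AA> \<rho> \<longrightarrow> a \<in> \<AA> \<longrightarrow>
      (\<lambda>N. 1 / of_nat N * (\<Sum>n = 1..N. of_int (f n) * \<rho> ((\<alpha> ^^ n) a))) \<longlonglongrightarrow> 0)"


section \<open>The C*-algebra of bounded operators on a Hilbert space\<close>

typedef (overloaded) 'a bounded_op =
  "{f :: 'a::chilbert_space \<Rightarrow> 'a. bounded_linear f \<and> (\<forall>c x. f (c *\<^sub>C x) = c *\<^sub>C f x)}"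
  morphisms op_apply Bounded_op
  by (rule exI[of _ "\<lambda>x. x"]) simp

setup_lifting type_definition_bounded_op

lemma bounded_op_eqI: "(\<And>x. op_apply A x = op_apply B x) \<Longrightarrow> A = B"
  by transfer auto

lemma bounded_linear_op_apply: "bounded_linear (op_apply A)"
  by transfer simp

lemma op_apply_scaleC: "op_apply A (c *\<^sub>C x) = c *\<^sub>C op_apply A x"
  by transfer simp

lemmas op_apply_add_right = linear_add[OF bounded_linear.linear[OF bounded_linear_op_apply]]

instantiation bounded_op :: (chilbert_space) real_normed_vector
begin

lift_definition norm_bounded_op :: "'a bounded_op \<Rightarrow> real" is onorm .

lift_definition minus_bounded_op :: "'a bounded_op \<Rightarrow> 'a bounded_op \<Rightarrow> 'a bounded_op"
  is "\<lambda>f g x. f x - g x"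
  by (auto intro: bounded_linear_sub simp: scaleC_diff_right)

lift_definition uminus_bounded_op :: "'a bounded_op \<Rightarrow> 'a bounded_op" is "\<lambda>f x. - f x"
  by (auto intro: bounded_linear_minus simp: scaleC_minus_right)

lift_definition zero_bounded_op :: "'a bounded_op" is "\<lambda>x. 0"
  by simp

lift_definition plus_bounded_op :: "'a bounded_op \<Rightarrow> 'a bounded_op \<Rightarrow> 'a bounded_op"
  is "\<lambda>f g x. f x + g x"
  by (auto intro: bounded_linear_add simp: scaleC_add_right)

lift_definition scaleR_bounded_op :: "real \<Rightarrow> 'a bounded_op \<Rightarrow> 'a bounded_op"
  is "\<lambda>r f x. r *\<^sub>R f x"
  by (intro conjI bounded_linear_compose[OF bounded_linear_scaleR_right])
     (auto simp: scaleR_scaleC mult.commute)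

definition sgn_bounded_op :: "'a bounded_op \<Rightarrow> 'a bounded_op"
  where "sgn_bounded_op A = inverse (norm A) *\<^sub>R A"

definition dist_bounded_op :: "'a bounded_op \<Rightarrow> 'a bounded_op \<Rightarrow> real"
  where "dist_bounded_op A B = norm (A - B)"

definition [code del]:
  "(uniformity :: ('a bounded_op \<times> 'a bounded_op) filter)
    = (INF e\<in>{0 <..}. principal {(x, y). dist x y < e})"

definition open_bounded_op :: "'a bounded_op set \<Rightarrow> bool"
  where [code del]: "open_bounded_op S = (\<forall>x\<in>S. \<forall>\<^sub>F (x', y) in uniformity. x' = x \<longrightarrow> y \<in> S)"

instance
  apply standard
  unfolding dist_bounded_op_def open_bounded_op_def sgn_bounded_op_def uniformity_bounded_op_def
  apply (rule refl | (transfer, force simp: onorm_triangle onorm_scaleR onorm_eq_0 algebra_simps))+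
  done

end

lemma op_apply_simps [simp]:
  "op_apply (A + B) x = op_apply A x + op_apply B x"
  "op_apply (A - B) x = op_apply A x - op_apply B x"
  "op_apply (- A) x = - op_apply A x"
  "op_apply 0 x = 0"
  "op_apply (r *\<^sub>R A) x = r *\<^sub>R op_apply A x"
  by (transfer, simp)+

lemma norm_op_apply: "norm (op_apply A x) \<le> norm A * norm x"
  by transfer (auto intro: onorm)

lemma norm_bounded_op_le: "0 \<le> b \<Longrightarrow> (\<And>x. norm (op_apply A x) \<le> b * norm x) \<Longrightarrow> norm A \<le> b"
  by transfer (rule onorm_bound)

lift_definition to_blinfun :: "'a::chilbert_space bounded_op \<Rightarrow> 'a \<Rightarrow>\<^sub>L 'a" is "\<lambda>f. f"
  by simp

lemma to_blinfun_apply [simp]: "blinfun_apply (to_blinfun A) x = op_apply A x"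
  by transfer simp

lemma norm_to_blinfun [simp]: "norm (to_blinfun A) = norm A"
  by transfer simp

lemma to_blinfun_diff: "to_blinfun (A - B) = to_blinfun A - to_blinfun B"
  by transfer simp

instance bounded_op :: (chilbert_space) banach
proof
  fix X :: "nat \<Rightarrow> 'a bounded_op"
  assume X: "Cauchy X"
  have "Cauchy (\<lambda>n. to_blinfun (X n))"
    using X by (simp add: Cauchy_def dist_norm flip: to_blinfun_diff)
  then obtain L where L: "(\<lambda>n. to_blinfun (X n)) \<longlonglongrightarrow> L"
    using Cauchy_convergent_iff convergent_def by blast
  have pt: "(\<lambda>n. op_apply (X n) x) \<longlonglongrightarrow> blinfun_apply L x" for x
    using blinfun.tendsto[OF L tendsto_const, of x] by simp
  have lin: "blinfun_apply L (c *\<^sub>C x) = c *\<^sub>C blinfun_apply L x" for c x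
  proof (rule LIMSEQ_unique[OF pt])
    show "(\<lambda>n. op_apply (X n) (c *\<^sub>C x)) \<longlonglongrightarrow> c *\<^sub>C blinfun_apply L x"
      unfolding op_apply_scaleC
      by (rule bounded_linear.tendsto[OF bounded_linear_scaleC_right pt])
  qed
  define B where "B = Bounded_op (blinfun_apply L)"
  have "op_apply B = blinfun_apply L"
    unfolding B_def
    by (rule Bounded_op_inverse) (simp add: lin blinfun.bounded_linear_right)
  then have "to_blinfun B = L"
    by (intro blinfun_eqI) simp
  with L have "(\<lambda>n. to_blinfun (X n)) \<longlonglongrightarrow> to_blinfun B"
    by simp
  then have "X \<longlonglongrightarrow> B"
    by (simp add: tendsto_iff dist_norm flip: to_blinfun_diff)
  then show "convergent X"
    by (auto simp: convergent_def)
qed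

lemma adjoint_exists:
  fixes A :: "'a::chilbert_space bounded_op"
  shows "\<exists>B. \<forall>x y. cinner (op_apply A x) y = cinner x (op_apply B y)"
proof -
  have "\<exists>z. \<forall>x. cinner (op_apply A x) y = cinner x z" for y
  proof (rule riesz_representation)
    show "cmod (cinner (op_apply A x) y) \<le> norm x * (norm A * norm y)" for x
    proof -
      have "cmod (cinner (op_apply A x) y) \<le> norm (op_apply A x) * norm y"
        by (rule norm_cinner_le)
      also have "\<dots> \<le> (norm A * norm x) * norm y"
        by (intro mult_right_mono norm_op_apply) simp
      finally show ?thesis
        by (simp add: ac_simps)
    qed
  qed (simp_all add: op_apply_add_right op_apply_scaleC cinner_add_left)
  then obtain g where g: "\<And>x y. cinner (op_apply A x) y = cinner x (g y)"
    by metis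
  have g_scaleC: "g (c *\<^sub>C y) = c *\<^sub>C g y" for c y
    by (rule cinner_left_eqI) (simp flip: g)
  have g_add: "g (y + z) = g y + g z" for y z
    by (rule cinner_left_eqI) (simp add: cinner_add_right flip: g)
  have g_bound: "norm (g y) \<le> norm y * norm A" for y
  proof (cases "norm (g y) = 0")
    case True
    then show ?thesis by simp
  next
    case False
    have "(norm (g y))\<^sup>2 = cmod (cinner (op_apply A (g y)) y)"
      by (simp add: g cinner_self norm_power)
    also have "\<dots> \<le> norm (op_apply A (g y)) * norm y"
      by (rule norm_cinner_le)
    also have "\<dots> \<le> (norm A * norm (g y)) * norm y"
      by (intro mult_right_mono norm_op_apply) simp
    finally have "norm (g y) * norm (g y) \<le> norm (g y) * (norm y * norm A)"
      by (simp add: power2_eq_square ac_simps)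
    then show ?thesis
      using False by (simp add: mult_le_cancel_left_pos)
  qed
  have "bounded_linear g"
    by (rule bounded_linear_intro[of g "norm A"])
       (simp_all add: g_add g_bound g_scaleC scaleR_scaleC)
  then have "op_apply (Bounded_op g) = g"
    by (intro Bounded_op_inverse) (simp add: g_scaleC)
  then show ?thesis
    using g by metis
qed

lemma adjoint_unique:
  assumes "\<forall>x y. cinner (op_apply A x) y = cinner x (op_apply B y)"
    and "\<forall>x y. cinner (op_apply A x) y = cinner x (op_apply C y)"
  shows "B = C"
  by (rule bounded_op_eqI, rule cinner_left_eqI) (use assms in metis)

instantiation bounded_op :: (chilbert_space) cstar_algebra
begin

lift_definition scaleC_bounded_op :: "complex \<Rightarrow> 'a bounded_op \<Rightarrow> 'a bounded_op"
  is "\<lambda>c f x. c *\<^sub>C f x"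
  by (auto intro: bounded_linear_compose[OF bounded_linear_scaleC_right] simp: mult.commute)

lift_definition times_bounded_op :: "'a bounded_op \<Rightarrow> 'a bounded_op \<Rightarrow> 'a bounded_op"
  is "\<lambda>f g x. f (g x)"
  by (auto intro: bounded_linear_compose)

definition star_bounded_op :: "'a bounded_op \<Rightarrow> 'a bounded_op"
  where "star_bounded_op A = (THE B. \<forall>x y. cinner (op_apply A x) y = cinner x (op_apply B y))"

lemma op_apply_scaleC_left: "op_apply (c *\<^sub>C A) x = c *\<^sub>C op_apply A x"
  by transfer simp

lemma op_apply_times: "op_apply (A * B) x = op_apply A (op_apply B x)"
  by transfer simp

lemma cinner_star_right: "cinner x (op_apply (star A) y) = cinner (op_apply A x) y"
proof -
  have "\<exists>!B. \<forall>x y. cinner (op_apply A x) y = cinner x (op_apply B y)"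
    using adjoint_exists[of A] adjoint_unique[of A] by blast
  from theI'[OF this] show ?thesis
    unfolding star_bounded_op_def by metis
qed

lemma cinner_star_left: "cinner (op_apply (star A) x) y = cinner x (op_apply A y)"
  by (metis cinner_star_right cinner_commute)

lemma star_eqI:
  assumes "\<And>x y. cinner (op_apply A x) y = cinner x (op_apply B y)"
  shows "star A = B"
  using adjoint_unique[of A "star A" B] assms by (simp add: cinner_star_right)

lemma norm_bounded_op_sq_le: "(norm A)\<^sup>2 \<le> norm (star A * A)" for A :: "'a bounded_op"
proof -
  have "norm A \<le> sqrt (norm (star A * A))"
  proof (rule norm_bounded_op_le)
    fix x
    have "(norm (op_apply A x))\<^sup>2 = cmod (cinner (op_apply (star A * A) x) x)"
      by (simp add: op_apply_times cinner_star_left cinner_self norm_power)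
    also have "\<dots> \<le> norm (op_apply (star A * A) x) * norm x"
      by (rule norm_cinner_le)
    also have "\<dots> \<le> (norm (star A * A) * norm x) * norm x"
      by (intro mult_right_mono norm_op_apply) simp
    finally have "(norm (op_apply A x))\<^sup>2 \<le> (sqrt (norm (star A * A)) * norm x)\<^sup>2"
      by (simp add: power_mult_distrib power2_eq_square[of "norm x"] mult.assoc)
    then show "norm (op_apply A x) \<le> sqrt (norm (star A * A)) * norm x"
      by (rule power2_le_imp_le) simp
  qed simp
  then have "(norm A)\<^sup>2 \<le> (sqrt (norm (star A * A)))\<^sup>2"
    by (intro power_mono) auto
  then show ?thesis
    by simp
qed

lemma norm_times_bounded_op_le: "norm (A * B) \<le> norm A * norm B" for A B :: "'a bounded_op"
proof (rule norm_bounded_op_le)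
  fix x
  have "norm (op_apply A (op_apply B x)) \<le> norm A * norm (op_apply B x)"
    by (rule norm_op_apply)
  also have "\<dots> \<le> norm A * (norm B * norm x)"
    by (intro mult_left_mono norm_op_apply) simp
  finally show "norm (op_apply (A * B) x) \<le> norm A * norm B * norm x"
    by (simp add: op_apply_times mult.assoc)
qed simp

lemma star_star_bounded_op: "star (star A) = A" for A :: "'a bounded_op"
  by (rule star_eqI) (rule cinner_star_left)

lemma norm_star_bounded_op: "norm (star A) = norm A" for A :: "'a bounded_op"
proof -
  have le: "norm B \<le> norm (star B)" for B :: "'a bounded_op"
  proof (cases "norm B = 0")
    case False
    have "norm B * norm B \<le> norm (star B) * norm B"
      using norm_bounded_op_sq_le[of B] norm_times_bounded_op_le[of "star B" B]
      by (simp add: power2_eq_square)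
    then show ?thesis
      using False by (simp add: mult_le_cancel_right_pos)
  qed simp
  show ?thesis
    using le[of A] le[of "star A"] by (simp add: star_star_bounded_op)
qed

lemma norm_scaleC_bounded_op: "norm (c *\<^sub>C A) = cmod c * norm A" for A :: "'a bounded_op"
proof -
  have le: "norm (d *\<^sub>C B) \<le> cmod d * norm B" for d and B :: "'a bounded_op"
  proof (rule norm_bounded_op_le)
    show "norm (op_apply (d *\<^sub>C B) x) \<le> cmod d * norm B * norm x" for x
      using mult_left_mono[OF norm_op_apply[of B x], of "cmod d"]
      by (simp add: op_apply_scaleC_left mult.assoc)
  qed simp
  show ?thesis
  proof (cases "c = 0")
    case True
    then show ?thesis
      using le[of 0 A] by simp
  next
    case False
    have "inverse c *\<^sub>C c *\<^sub>C A = A"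
      by (rule bounded_op_eqI) (simp add: op_apply_scaleC_left False)
    then have "norm A \<le> cmod (inverse c) * norm (c *\<^sub>C A)"
      using le[of "inverse c" "c *\<^sub>C A"] by simp
    then have "cmod c * norm A \<le> norm (c *\<^sub>C A)"
      using False by (simp add: norm_divide field_simps)
    with le[of c A] show ?thesis
      by simp
  qed
qed

instance
proof
  fix A B C :: "'a bounded_op" and c d :: complex and r :: real
  show "c *\<^sub>C (A + B) = c *\<^sub>C A + c *\<^sub>C B" "(c + d) *\<^sub>C A = c *\<^sub>C A + d *\<^sub>C A"
    "c *\<^sub>C d *\<^sub>C A = (c * d) *\<^sub>C A" "1 *\<^sub>C A = A" "r *\<^sub>R A = complex_of_real r *\<^sub>C A"
    by (rule bounded_op_eqI;
        simp add: op_apply_scaleC_left scaleC_add_left scaleC_add_right scaleR_scaleC)+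
  show "norm (c *\<^sub>C A) = cmod c * norm A"
    by (rule norm_scaleC_bounded_op)
  show "A * B * C = A * (B * C)" "(A + B) * C = A * C + B * C" "A * (B + C) = A * B + A * C"
    "(r *\<^sub>R A) * B = r *\<^sub>R (A * B)" "A * (r *\<^sub>R B) = r *\<^sub>R (A * B)"
    "(c *\<^sub>C A) * B = c *\<^sub>C (A * B)" "A * (c *\<^sub>C B) = c *\<^sub>C (A * B)"
    by (rule bounded_op_eqI;
        simp add: op_apply_scaleC_left op_apply_times op_apply_add_right op_apply_scaleC
          scaleR_scaleC)+
  show "norm (A * B) \<le> norm A * norm B"
    by (rule norm_times_bounded_op_le)
  show "star (star A) = A"
    by (rule star_star_bounded_op)
  show "star (A + B) = star A + star B"
    by (rule star_eqI) (simp add: cinner_add_left cinner_add_right cinner_star_right)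
  show "star (c *\<^sub>C A) = cnj c *\<^sub>C star A"
    by (rule star_eqI) (simp add: op_apply_scaleC_left cinner_star_right)
  show "star (A * B) = star B * star A"
    by (rule star_eqI) (simp add: op_apply_times cinner_star_right)
  show "norm (star A * A) = (norm A)\<^sup>2"
    using norm_bounded_op_sq_le[of A] norm_times_bounded_op_le[of "star A" A]
    by (simp add: norm_star_bounded_op power2_eq_square)
qed

end

declare op_apply_scaleC_left [simp] op_apply_times [simp]

instantiation bounded_op :: (chilbert_space) one
begin

lift_definition one_bounded_op :: "'a bounded_op" is "\<lambda>x. x"
  by simp

instance ..

end

lemma op_apply_one [simp]: "op_apply 1 x = x"
  by transfer simp

instance bounded_op :: (chilbert_space) monoid_mult
  by standard (rule bounded_op_eqI; simp)+


section \<open>Compact operators and their unitization\<close>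

definition compact_ops :: "'a::chilbert_space bounded_op set"
  where "compact_ops = {A. compact (closure (op_apply A ` cball 0 1))}"

definition compact_ops_plus_scalars :: "'a::chilbert_space bounded_op set"
  where "compact_ops_plus_scalars = {A + c *\<^sub>C 1 | A c. A \<in> compact_ops}"

text \<open>The extension of an automorphism of the compact operators by \<open>\<alpha>(I) = I\<close>.  The decomposition
  \<open>T = A + c I\<close> is not unique if the space is finite-dimensional, but the value does not depend
  on it; see \<open>unital_extension_eq\<close> below.\<close>

definition unital_extension ::
    "('a::chilbert_space bounded_op \<Rightarrow> 'a bounded_op) \<Rightarrow> 'a bounded_op \<Rightarrow> 'a bounded_op"
  where "unital_extension \<alpha> T =
    (THE S. \<exists>A c. A \<in> compact_ops \<and> T = A + c *\<^sub>C 1 \<and> S = \<alpha> A + c *\<^sub>C 1)"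

lemma compact_ops_iff: "A \<in> compact_ops \<longleftrightarrow> (\<exists>K. compact K \<and> op_apply A ` cball 0 1 \<subseteq> K)"
proof
  assume "\<exists>K. compact K \<and> op_apply A ` cball 0 1 \<subseteq> K"
  then obtain K where K: "compact K" "op_apply A ` cball 0 1 \<subseteq> K"
    by blast
  have "closure (op_apply A ` cball 0 1) \<subseteq> K"
    using K by (simp add: closure_minimal compact_imp_closed)
  with K(1) have "compact (K \<inter> closure (op_apply A ` cball 0 1))"
    by (intro compact_Int_closed) auto
  with \<open>closure (op_apply A ` cball 0 1) \<subseteq> K\<close> show "A \<in> compact_ops"
    by (simp add: compact_ops_def Int_absorb1)
next
  assume "A \<in> compact_ops"
  then show "\<exists>K. compact K \<and> op_apply A ` cball 0 1 \<subseteq> K"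
    by (intro exI[of _ "closure (op_apply A ` cball 0 1)"]) (simp add: compact_ops_def closure_subset)
qed

lemma compact_ops_add: "A \<in> compact_ops \<Longrightarrow> B \<in> compact_ops \<Longrightarrow> A + B \<in> compact_ops"
proof -
  assume "A \<in> compact_ops" "B \<in> compact_ops"
  then obtain K L where "compact K" "op_apply A ` cball 0 1 \<subseteq> K"
    "compact L" "op_apply B ` cball 0 1 \<subseteq> L"
    unfolding compact_ops_iff by blast
  then have "compact {x + y | x y. x \<in> K \<and> y \<in> L}"
    "op_apply (A + B) ` cball 0 1 \<subseteq> {x + y | x y. x \<in> K \<and> y \<in> L}"
    by (blast intro: compact_sums, fastforce)
  then show ?thesis
    unfolding compact_ops_iff by blast
qed

lemma compact_ops_scaleC: "A \<in> compact_ops \<Longrightarrow> c *\<^sub>C A \<in> compact_ops"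
proof -
  assume "A \<in> compact_ops"
  then obtain K where K: "compact K" "op_apply A ` cball 0 1 \<subseteq> K"
    unfolding compact_ops_iff by blast
  have "compact ((\<lambda>x. c *\<^sub>C x) ` K)"
    using K(1) bounded_linear_scaleC_right
    by (intro compact_continuous_image) (auto intro: linear_continuous_on)
  moreover have "op_apply (c *\<^sub>C A) ` cball 0 1 \<subseteq> (\<lambda>x. c *\<^sub>C x) ` K"
    using K(2) by auto
  ultimately show ?thesis
    unfolding compact_ops_iff by blast
qed

lemma unital_extension_eq:
  assumes \<alpha>: "star_automorphism compact_ops \<alpha>" and A: "A \<in> compact_ops"
  shows "unital_extension \<alpha> (A + c *\<^sub>C 1) = \<alpha> A + c *\<^sub>C 1"
  unfolding unital_extension_def
proof (rule the_equality)
  show "\<exists>A' c'. A' \<in> compact_ops \<and> A + c *\<^sub>C 1 = A' + c' *\<^sub>C 1 \<and>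
      \<alpha> A + c *\<^sub>C 1 = \<alpha> A' + c' *\<^sub>C 1"
    using A by (intro exI[of _ A] exI[of _ c]) simp
next
  fix S
  assume "\<exists>A' c'. A' \<in> compact_ops \<and> A + c *\<^sub>C 1 = A' + c' *\<^sub>C 1 \<and> S = \<alpha> A' + c' *\<^sub>C 1"
  then obtain B d where B: "B \<in> compact_ops" and eq: "A + c *\<^sub>C 1 = B + d *\<^sub>C 1"
    and S: "S = \<alpha> B + d *\<^sub>C 1"
    by (elim exE conjE)
  show "S = \<alpha> A + c *\<^sub>C 1"
  proof (cases "c = d")
    case True
    with eq S show ?thesis by simp
  next
    case False
    have BA: "B = A + (c - d) *\<^sub>C 1"
      using eq by (simp add: scaleC_diff_left add_diff_eq)
    have "A + (-1) *\<^sub>C B = - ((c - d) *\<^sub>C 1)"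
      by (simp add: BA scaleC_add_right scaleC_minus_left scaleC_diff_left)
    then have "(- inverse (c - d)) *\<^sub>C (A + (-1) *\<^sub>C B)
        = (- inverse (c - d)) *\<^sub>C (- ((c - d) *\<^sub>C 1))"
      by (rule arg_cong)
    also have "\<dots> = 1"
      using False by (simp only: scaleC_minus_left scaleC_minus_right) simp
    finally have "1 = (- inverse (c - d)) *\<^sub>C (A + (-1) *\<^sub>C B)"
      by (rule sym)
    moreover have "(- inverse (c - d)) *\<^sub>C (A + (-1) *\<^sub>C B) \<in> compact_ops"
      by (intro compact_ops_scaleC compact_ops_add A B)
    ultimately have one: "1 \<in> (compact_ops :: 'a bounded_op set)"
      by (rule ssubst)
    have \<alpha>_add: "\<alpha> (F + G) = \<alpha> F + \<alpha> G" if "F \<in> compact_ops" "G \<in> compact_ops" for F G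
      using \<alpha> that by (simp add: star_automorphism_def)
    have \<alpha>_scale: "\<alpha> (e *\<^sub>C F) = e *\<^sub>C \<alpha> F" if "F \<in> compact_ops" for e F
      using \<alpha> that by (simp add: star_automorphism_def)
    have \<alpha>_mult: "\<alpha> (F * G) = \<alpha> F * \<alpha> G" if "F \<in> compact_ops" "G \<in> compact_ops" for F G
      using \<alpha> that by (simp add: star_automorphism_def)
    have "\<alpha> ` compact_ops = compact_ops"
      using \<alpha> by (simp add: star_automorphism_def bij_betw_def)
    with one have "1 \<in> \<alpha> ` compact_ops"
      by simp
    then obtain E where E: "E \<in> compact_ops" "1 = \<alpha> E"
      by (rule imageE)
    have "\<alpha> 1 = 1"
      using \<alpha>_mult[OF one E(1)] by (simp flip: E(2))
    moreover have "\<alpha> B = \<alpha> A + (c - d) *\<^sub>C \<alpha> 1"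
      unfolding BA by (simp only: \<alpha>_add[OF A compact_ops_scaleC[OF one]] \<alpha>_scale[OF one])
    ultimately show ?thesis
      using S by (simp add: scaleC_diff_left)
  qed
qed

end

theory Submission
  imports Defs "HOL-Complex_Analysis.Complex_Analysis" "HOL-Probability.Sinc_Integral"
    "HOL-Number_Theory.Number_Theory"
begin

text \<open>The theorem is a statement about one unitary operator and one sequence of signs.  An automorphism
of the compact operators has the form \<open>A \<mapsto> U A U\<^sup>*\<close> with \<open>U\<close> unitary
(\<open>compact_automorphism_spatial\<close>), so on a rank-one operator the averages in question are
\<open>1/N (\<Sum>n\<le>N. \<mu>(n) U\<^sup>n v \<otimes> (U\<^sup>n w)\<^sup>*)\<close>.  These tend to 0 even in operator norm.
A state is bounded by the norm, a compact operator is a norm limit of finite-rank operators, and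
the automorphism is contractive; hence the rank-one case gives all compact operators.  On the
scalars the claim is that \<open>\<mu>\<close> has mean 0.

The norm estimate is a transference principle (\<open>norm_unitary_orbit_sum\<close>).  The operator norm is
at most the Hilbert-Schmidt norm, and on the Hilbert-Schmidt operators \<open>A \<mapsto> U A U\<^sup>*\<close> is again
unitary.  For any unitary \<open>W\<close> a trigonometric polynomial \<open>\<Sum>n. c\<^sub>n W\<^sup>n\<close> is bounded by a multiple of
the maximum of \<open>\<bar>\<Sum>n. c\<^sub>n z\<^sup>n\<bar>\<close> on the unit circle.  Spectral measures are not needed for this: averaging
over translates reduces it to Parseval's identity on a finite cyclic group.

What remains is Davenport's theorem in the form \<open>\<Sum>n\<le>N. \<mu>(n) z\<^sup>n = o(N)\<close>, uniformly in \<open>\<bar>z\<bar> = 1\<close>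
(\<open>moebius_exponential_sum_uniform\<close>).  There are two ranges.  If \<open>z\<^sup>k\<close> is not too close to 1 for all
\<open>k\<close> up to a constant, then the sequences \<open>z\<^bsup>pm\<^esup>\<close> and \<open>z\<^bsup>qm\<^esup>\<close> are nearly orthogonal for different small
primes \<open>p\<close> and \<open>q\<close>; as \<open>\<mu>(pm) = -\<mu>(m)\<close> for most \<open>m\<close>, the sum is small by a criterion of Katai
(\<open>katai_bound\<close>), which uses only that \<open>\<Sum>1/p\<close> diverges.  Otherwise \<open>z\<close> is within \<open>O(1/N)\<close> of a root
of unity of bounded order, and summation by parts reduces to the roots of unity themselves.

For a root of unity the claim is that \<open>\<mu>\<close> has mean 0 along residue classes, which is equivalent to
the prime number theorem in arithmetic progressions.  Sorting \<open>n\<close> by its greatest common divisor with the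
modulus and decomposing functions on the units into Dirichlet characters \<open>\<psi>\<close>, it suffices to treat
\<open>\<mu>\<psi>\<close>, whose Dirichlet series is \<open>1/L(s,\<psi>)\<close>.  This function is continuous on \<open>Re s \<ge> 1\<close> because
\<open>L(s,\<psi>)\<close> has no zero there (\<open>L_num_nonzero\<close>): the inequality \<open>3 + 4 cos \<theta> + cos 2\<theta> \<ge> 0\<close> excludes zeros
on the line \<open>Re s = 1\<close>, except at \<open>s = 1\<close> for real \<open>\<psi>\<close>, where Monsky's argument with Lambert series
applies (\<open>real_character_series_at_1\<close>).  A Tauberian theorem for bounded coefficients
(\<open>mean_tendsto_0_of_dirichlet_series\<close>) turns the continuity into the vanishing of the mean.\<close>

section \<open>The Moebius function\<close>

lemma moebius_mu_1 [simp]: "moebius_mu (Suc 0) = 1"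
  by (simp add: moebius_mu_def)

lemma norm_moebius_mu_le: "norm (of_int (moebius_mu n) :: 'a :: real_normed_algebra_1) \<le> 1"
  by (simp add: moebius_mu_def norm_power)

lemma moebius_mu_mult:
  assumes "coprime a b"
  shows "moebius_mu (a * b) = moebius_mu a * moebius_mu b"
proof (cases "squarefree a \<and> squarefree b")
  case True
  then have nz: "a \<noteq> 0" "b \<noteq> 0" by (metis not_squarefree_0)+
  have "prime_factors a \<inter> prime_factors b = {}"
    using assms by (auto simp: in_prime_factors_iff) (metis coprime_common_divisor not_prime_unit)
  moreover have "prime_factors (a * b) = prime_factors a \<union> prime_factors b"
    using nz by (rule prime_factors_product)
  ultimately show ?thesis
    using True assms by (simp add: moebius_mu_def squarefree_mult_coprime card_Un_disjoint power_add)
next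
  case False
  then show ?thesis
    using squarefree_multD[of a b] by (auto simp: moebius_mu_def)
qed

lemma moebius_mu_prime_mult:
  assumes "prime p" "\<not> p dvd m"
  shows "moebius_mu (p * m) = - moebius_mu m"
proof -
  have "moebius_mu p = -1"
    using assms by (simp add: moebius_mu_def squarefree_prime prime_prime_factors)
  then show ?thesis
    using moebius_mu_mult[of p m] assms by (simp add: prime_imp_coprime)
qed

lemma moebius_mu_not_coprime:
  assumes "\<not> coprime a b"
  shows "moebius_mu (a * b) = 0"
proof (cases "a = 0 \<or> b = 0")
  case False
  then have "gcd a b ^ 2 dvd a * b" "\<not> gcd a b dvd 1"
    using assms by (auto simp: power2_eq_square intro: mult_dvd_mono coprime_iff_gcd_eq_1[THEN iffD2])
  then have "\<not> squarefree (a * b)"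
    by (rule not_squarefreeI)
  then show ?thesis by (simp add: moebius_mu_def)
qed (auto simp: moebius_mu_def)

text \<open>The squarefree divisors of \<open>n\<close> cancel in pairs \<open>d\<close>, \<open>p d\<close>, where \<open>p\<close> is a fixed prime factor of \<open>n\<close>.\<close>

lemma sum_moebius_mu_divisors:
  assumes "0 < n"
  shows "(\<Sum>d | d dvd n. moebius_mu d) = (if n = 1 then 1 else 0)"
proof (cases "n = 1")
  case False
  with assms obtain p where p: "prime p" "p dvd n"
    using prime_factor_nat by blast
  define A where "A = {d. d dvd n \<and> \<not> p dvd d \<and> squarefree d}"
  have finA: "finite A"
    using assms by (auto simp: A_def intro: finite_subset[OF _ finite_divisors_nat])
  have "(\<Sum>d | d dvd n. moebius_mu d) = (\<Sum>d\<in>A \<union> (\<lambda>d. p * d) ` A. moebius_mu d)"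
  proof (rule sum.mono_neutral_right)
    show "finite {d. d dvd n}" using assms by simp
    show "A \<union> (\<lambda>d. p * d) ` A \<subseteq> {d. d dvd n}"
    proof (safe)
      fix d assume "d \<in> A"
      then have "d dvd n" "coprime p d" using p by (auto simp: A_def prime_imp_coprime)
      then show "p * d dvd n" using p by (simp add: divides_mult)
    qed (auto simp: A_def)
    show "\<forall>d\<in>{d. d dvd n} - (A \<union> (\<lambda>d. p * d) ` A). moebius_mu d = 0"
    proof (intro ballI, rule ccontr)
      fix d assume d: "d \<in> {d. d dvd n} - (A \<union> (\<lambda>d. p * d) ` A)" and nz: "moebius_mu d \<noteq> 0"
      then have sq: "squarefree d" by (auto simp: moebius_mu_def split: if_splits)
      with d have "p dvd d" by (auto simp: A_def)
      then obtain e where e: "d = p * e" by (elim dvdE)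
      have "coprime p e" using nz moebius_mu_not_coprime[of p e] e by auto
      then have "\<not> p dvd e" using p(1) by (metis coprime_absorb_left not_prime_unit)
      moreover have "squarefree e" using sq e squarefree_multD(2) by blast
      moreover have "e dvd n" using d e dvd_mult_right by auto
      ultimately have "e \<in> A" by (simp add: A_def)
      with d e show False by auto
    qed
  qed
  also have "\<dots> = (\<Sum>d\<in>A. moebius_mu d) + (\<Sum>d\<in>(\<lambda>d. p * d) ` A. moebius_mu d)"
    using finA by (intro sum.union_disjoint) (auto simp: A_def)
  also have "(\<Sum>d\<in>(\<lambda>d. p * d) ` A. moebius_mu d) = (\<Sum>d\<in>A. moebius_mu (p * d))"
    using p(1) by (subst sum.reindex) (auto simp: inj_on_def)
  also have "\<dots> = (\<Sum>d\<in>A. - moebius_mu d)"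
    using p(1) by (intro sum.cong) (auto simp: A_def moebius_mu_prime_mult)
  finally show ?thesis using False by (simp add: sum_negf)
qed simp

section \<open>Dirichlet characters\<close>

text \<open>Dirichlet characters modulo \<open>d\<close>, as functions on the natural numbers.  The value at 1 and the
modulus of the values are consequences.\<close>

definition dchar :: "nat \<Rightarrow> (nat \<Rightarrow> complex) \<Rightarrow> bool"
  where "dchar d \<psi> \<longleftrightarrow> 0 < d \<and> (\<forall>m n. \<psi> (m * n) = \<psi> m * \<psi> n) \<and> (\<forall>n. \<psi> (n + d) = \<psi> n) \<and>
    (\<forall>n. \<psi> n \<noteq> 0 \<longleftrightarrow> coprime n d)"

lemma periodic_add_mult:
  fixes f :: "nat \<Rightarrow> 'a"
  assumes "\<And>n. f (n + d) = f n"
  shows "f (n + k * d) = f n"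
proof (induction k)
  case (Suc k)
  then show ?case using assms[of "n + k * d"] by (simp add: ac_simps)
qed simp

lemma periodic_mod:
  fixes f :: "nat \<Rightarrow> 'a"
  assumes "\<And>n. f (n + d) = f n"
  shows "f (n mod d) = f n"
  using periodic_add_mult[of f d "n mod d" "n div d", OF assms] by (simp add: add.commute mult.commute)

lemma periodic_cong:
  fixes f :: "nat \<Rightarrow> 'a"
  assumes "\<And>n. f (n + d) = f n" "[m = n] (mod d)"
  shows "f m = f n"
  using periodic_mod[of f d m, OF assms(1)] periodic_mod[of f d n, OF assms(1)] assms(2)
  by (simp add: cong_def)

context
  fixes d \<psi> assumes chi: "dchar d \<psi>"
begin

lemma dchar_mult: "\<psi> (m * n) = \<psi> m * \<psi> n"
  and dchar_periodic: "\<psi> (n + d) = \<psi> n"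
  and dchar_nonzero_iff: "\<psi> n \<noteq> 0 \<longleftrightarrow> coprime n d"
  and dchar_pos: "0 < d"
  using chi by (auto simp: dchar_def)

lemma dchar_1: "\<psi> (Suc 0) = 1"
  using dchar_mult[of 1 1] dchar_nonzero_iff[of 1] by simp

lemma dchar_power: "\<psi> (m ^ k) = \<psi> m ^ k"
  by (induction k) (simp_all add: dchar_1 dchar_mult)

lemma dchar_norm: "norm (\<psi> n) = (if coprime n d then 1 else 0)"
proof (cases "coprime n d")
  case True
  have "[n ^ totient d = 1] (mod d)" by (rule euler_theorem[OF True])
  from periodic_cong[of \<psi> d, OF dchar_periodic this] have "\<psi> n ^ totient d = 1"
    by (simp add: dchar_power dchar_1)
  then have "norm (\<psi> n) ^ totient d = 1" by (metis norm_one norm_power)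
  then have "norm (\<psi> n) = 1"
    using power_eq_imp_eq_base[of "norm (\<psi> n)" "totient d" 1] dchar_pos by simp
  then show ?thesis using True by simp
qed (use dchar_nonzero_iff[of n] in auto)

lemma dchar_norm_le: "norm (\<psi> n) \<le> 1"
  by (simp add: dchar_norm)

end

text \<open>The Dirichlet characters span the functions on the units modulo \<open>d\<close>; this is stated as an induction
rule because it is only used for properties that are closed under linear combinations.

The translations \<open>f \<mapsto> f(g n)\<close> by units \<open>g\<close> commute and satisfy \<open>T\<^sup>m = 1\<close> for \<open>m = \<phi>(d)\<close>.  So each of them
splits \<open>f\<close> into eigenfunctions by the projections \<open>(1/m) \<Sum>l<m. w\<^bsup>-jl\<^esup> T\<^sup>l\<close> with \<open>w = exp(2\<pi>i/m)\<close>, which preserve the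
eigenfunctions of the other translations.  After all units have been treated, every component is a simultaneous
eigenfunction, and such a function is a multiple of a character.\<close>

lemma character_span_induct:
  fixes Q :: "(nat \<Rightarrow> complex) \<Rightarrow> bool" and f :: "nat \<Rightarrow> complex"
  assumes d: "0 < d"
    and per: "\<And>n. f (n + d) = f n" and supp: "\<And>n. \<not> coprime n d \<Longrightarrow> f n = 0"
    and Q0: "Q (\<lambda>n. 0)" and Q_add: "\<And>f g. Q f \<Longrightarrow> Q g \<Longrightarrow> Q (\<lambda>n. f n + g n)"
    and Q_scale: "\<And>c f. Q f \<Longrightarrow> Q (\<lambda>n. c * f n)"
    and Q_char: "\<And>\<psi>. dchar d \<psi> \<Longrightarrow> Q \<psi>"
  shows "Q f"
proof -
  define good where "good f \<longleftrightarrow> (\<forall>n. f (n + d) = f n) \<and> (\<forall>n. \<not> coprime n d \<longrightarrow> f n = 0)" for f :: "nat \<Rightarrow> complex"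
  define eig where "eig f g \<longleftrightarrow> (\<exists>l. \<forall>n. f (g * n) = l * f n)" for f :: "nat \<Rightarrow> complex" and g :: nat
  define U where "U = {g. g < Suc d \<and> coprime g d}"
  \<comment> \<open>By Euler's theorem every translation by a unit has order dividing \<open>m\<close>.\<close>
  define m where "m = totient d"
  have m: "0 < m" using d by (simp add: m_def)
  have Q_sum: "Q (\<lambda>n. \<Sum>i<k. F i n)" if "\<And>i. i < k \<Longrightarrow> Q (F i)" for k :: nat and F
    using that
  proof (induction k)
    case (Suc k)
    then show ?case using Q_add[of "\<lambda>n. \<Sum>i<k. F i n" "F k"] by simp
  qed (simp add: Q0)
  have base: "Q f" if f: "good f" "\<forall>g\<in>U. eig f g" for f
  proof -
    have per: "\<And>n. f (n + d) = f n" using f by (simp add: good_def)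
    have eig: "eig f g" if "coprime g d" for g
    proof -
      have "g mod d \<in> U" using that d by (auto simp: U_def less_Suc_eq)
      then obtain l where l: "\<And>n. f ((g mod d) * n) = l * f n" using f(2) by (auto simp: eig_def)
      have "f (g * n) = l * f n" for n
      proof -
        have "[g * n = (g mod d) * n] (mod d)" by (simp add: cong_def mod_mult_left_eq)
        from periodic_cong[of f d, OF per this] show ?thesis by (simp add: l)
      qed
      then show ?thesis by (auto simp: eig_def)
    qed
    have mult: "f (g * n) * f 1 = f g * f n" if "coprime g d" for g n
    proof -
      obtain l where l: "\<And>n. f (g * n) = l * f n" using eig[OF \<open>coprime g d\<close>] by (auto simp: eig_def)
      then show ?thesis using l[of 1] by simp
    qed
    show ?thesis
    proof (cases "f 1 = 0")
      case True
      have "f n = 0" for n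
      proof (cases "coprime n d")
        case c: True
        from eig[OF c] obtain l where l: "\<And>k. f (n * k) = l * f k" by (auto simp: eig_def)
        show ?thesis using l[of 1] True by simp
      qed (use f in \<open>auto simp: good_def\<close>)
      then have "f = (\<lambda>n. 0)" by auto
      then show ?thesis using Q0 by simp
    next
      case False
      have "dchar d (\<lambda>n. inverse (f 1) * f n)"
        unfolding dchar_def
      proof (intro conjI allI)
        fix a b
        show "inverse (f 1) * f (a * b) = inverse (f 1) * f a * (inverse (f 1) * f b)"
          using mult[of a b] False f(1) by (cases "coprime a d") (auto simp: good_def field_simps)
        show "inverse (f 1) * f a \<noteq> 0 \<longleftrightarrow> coprime a d"
        proof
          assume c: "coprime a d"
          have "[a ^ m = 1] (mod d)" unfolding m_def by (rule euler_theorem[OF c])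
          from periodic_cong[of f d, OF per this] have 1: "f (a ^ m) = f 1" .
          have "f (a ^ (m - 1) * a) * f 1 = f (a ^ (m - 1)) * f a"
            by (rule mult) (use c in simp)
          with 1 m have "f 1 * f 1 = f (a ^ (m - 1)) * f a"
            by (cases m) (simp_all add: mult.commute)
          with False show "inverse (f 1) * f a \<noteq> 0" by auto
        qed (use f(1) in \<open>auto simp: good_def\<close>)
      qed (use d per in auto)
      from Q_scale[OF Q_char[OF this], of "f 1"] False show ?thesis
        by (simp add: mult.assoc[symmetric])
    qed
  qed
  have "\<forall>f. good f \<longrightarrow> (\<forall>g\<in>U - S. eig f g) \<longrightarrow> Q f" if "finite S" "S \<subseteq> U" for S
    using that
  proof (induction S rule: finite_induct)
    case empty
    then show ?case using base by auto
  next
    case (insert g S)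
    have g: "coprime g d" using insert.prems by (auto simp: U_def)
    show ?case
    proof (intro allI impI)
      fix f assume f: "good f" and eigf: "\<forall>h\<in>U - insert g S. eig f h"
      have per: "\<And>n. f (n + d) = f n" using f by (simp add: good_def)
      define w where "w = cis (2 * pi / m)"
      have wm: "w ^ m = 1" using m by (simp add: w_def Complex.DeMoivre)
      have w0: "w \<noteq> 0" by (simp add: w_def)
      define F where "F j n = (\<Sum>l<m. inverse w ^ (j * l) * f (g ^ l * n)) / of_nat m" for j n
      have orth: "(\<Sum>j<m. inverse w ^ (j * l)) = (if l = 0 then of_nat m else 0)" if "l < m" for l
      proof (cases "l = 0")
        case False
        have "inverse w ^ l = cis (- (2 * pi * l / m))"
          by (simp add: w_def cis_inverse Complex.DeMoivre mult.commute)
        also have "\<dots> \<noteq> 1"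
        proof
          assume "cis (- (2 * pi * l / m)) = 1"
          then have "cos (2 * pi * l / m) = 1" by (simp add: complex_eq_iff)
          then obtain k :: int where "2 * pi * l / m = of_int k * 2 * pi"
            by (auto simp: cos_one_2pi_int)
          then have "real l = of_int k * real m" using m by (simp add: field_simps)
          then have "int l = k * int m" by (metis of_int_eq_iff of_int_mult of_int_of_nat_eq)
          then have "int m dvd int l" by simp
          then have "m dvd l" by simp
          then show False using that False by (auto dest: dvd_imp_le)
        qed
        finally have 1: "inverse w ^ l \<noteq> 1" .
        have "(\<Sum>j<m. inverse w ^ (j * l)) = (\<Sum>j<m. (inverse w ^ l) ^ j)"
          by (simp add: power_mult[symmetric] mult.commute)
        also have "\<dots> = ((inverse w ^ l) ^ m - 1) / (inverse w ^ l - 1)"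
          by (rule geometric_sum[OF 1])
        also have "(inverse w ^ l) ^ m = 1"
          by (metis wm power_inverse inverse_1 power_commutes power_mult mult.commute power_one)
        finally show ?thesis using False by simp
      qed simp
      have "f = (\<lambda>n. \<Sum>j<m. F j n)"
      proof
        fix n
        have "(\<Sum>j<m. F j n) = (\<Sum>l<m. (\<Sum>j<m. inverse w ^ (j * l)) * f (g ^ l * n)) / of_nat m"
          unfolding F_def sum_divide_distrib[symmetric] sum_distrib_right
          by (subst sum.swap) simp
        also have "\<dots> = (\<Sum>l<m. if l = 0 then of_nat m * f n else 0) / of_nat m"
          by (intro arg_cong[where f = "\<lambda>x. x / _"] sum.cong) (auto simp: orth)
        also have "\<dots> = f n" using m by simp
        finally show "f n = (\<Sum>j<m. F j n)" ..
      qed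
      moreover have "Q (F j)" for j
      proof -
        have "good (F j)"
          unfolding good_def
        proof (intro conjI allI impI)
          fix n
          have "f (g ^ l * (n + d)) = f (g ^ l * n)" for l
            using periodic_add_mult[of f d "g ^ l * n" "g ^ l", OF per] by (simp add: distrib_left)
          then show "F j (n + d) = F j n" by (simp add: F_def)
          assume "\<not> coprime n d"
          then have "f (g ^ l * n) = 0" for l using f by (auto simp: good_def)
          then show "F j n = 0" by (simp add: F_def)
        qed
        moreover have "eig (F j) h" if h: "h \<in> U - S" for h
        proof (cases "h = g")
          case False
          with eigf h obtain l where l: "\<And>n. f (h * n) = l * f n" by (auto simp: eig_def)
          have "f (g ^ i * (h * n)) = l * f (g ^ i * n)" for i n
            using l[of "g ^ i * n"] by (simp add: ac_simps)
          then have "F j (h * n) = l * F j n" for n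
            unfolding F_def by (simp only: times_divide_eq_right sum_distrib_left mult.left_commute[of l])
          then show ?thesis by (auto simp: eig_def)
        next
          case True
          have "F j (g * n) = w ^ j * F j n" for n
          proof -
            define G where "G l = inverse w ^ (j * l) * f (g ^ l * n)" for l
            have "G m = G 0"
            proof -
              have "[g ^ m * n = 1 * n] (mod d)"
                unfolding m_def by (rule cong_scalar_right[OF euler_theorem[OF g]])
              from periodic_cong[of f d, OF per this] have "f (g ^ m * n) = f n" by simp
              moreover have "inverse w ^ (j * m) = 1"
                by (metis wm power_inverse inverse_1 power_mult mult.commute power_one)
              ultimately show ?thesis by (simp add: G_def)
            qed
            have "F j (g * n) = (\<Sum>l<m. w ^ j * G (Suc l)) / of_nat m"
              unfolding F_def G_def
              by (intro arg_cong[where f = "\<lambda>x. x / _"] sum.cong)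
                 (use w0 in \<open>auto simp: power_add power_inverse field_simps\<close>)
            also have "\<dots> = w ^ j * ((\<Sum>l<m. G (Suc l)) / of_nat m)"
              by (simp add: sum_distrib_left)
            also have "(\<Sum>l<m. G (Suc l)) = (\<Sum>l<m. G l)"
            proof -
              have "(\<Sum>l<Suc m. G l) = G 0 + (\<Sum>l<m. G (Suc l))" by (rule sum.lessThan_Suc_shift)
              moreover have "(\<Sum>l<Suc m. G l) = (\<Sum>l<m. G l) + G m" by simp
              ultimately show ?thesis using \<open>G m = G 0\<close> by simp
            qed
            finally show ?thesis by (simp add: F_def G_def)
          qed
          then show ?thesis using True by (auto simp: eig_def)
        qed
        ultimately show ?thesis using insert.IH insert.prems by auto
      qed
      ultimately show "Q f" using Q_sum[of m F] by metis
    qed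
  qed
  from this[of U] show ?thesis
    using per supp by (auto simp: good_def U_def)
qed

text \<open>Every \<open>n\<close> is uniquely \<open>g m\<close> with \<open>g = gcd n d\<close>.  If \<open>\<mu>(n) \<noteq> 0\<close>, then \<open>m\<close> is prime to \<open>g\<close>, and therefore prime
to \<open>d\<close>, and \<open>\<mu>(n) = \<mu>(g) \<mu>(m)\<close>.  So the sum splits into finitely many sums of \<open>\<mu>\<close> against functions on the units.\<close>

lemma moebius_mean_periodic:
  fixes f :: "nat \<Rightarrow> complex"
  assumes d: "0 < d" and per: "\<And>n. f (n + d) = f n"
    and chars: "\<And>\<psi>. dchar d \<psi> \<Longrightarrow> (\<lambda>N. (\<Sum>n=1..N. of_int (moebius_mu n) * \<psi> n) / of_nat N) \<longlonglongrightarrow> 0"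
  shows "(\<lambda>N. (\<Sum>n=1..N. of_int (moebius_mu n) * f n) / of_nat N) \<longlonglongrightarrow> 0"
proof -
  define Q where "Q f \<longleftrightarrow> (\<lambda>N. (\<Sum>n=1..N. of_int (moebius_mu n) * f n) / of_nat N) \<longlonglongrightarrow> 0" for f :: "nat \<Rightarrow> complex"
  define G where "G g m = (if coprime m d then f (g * m) else 0)" for g m
  have Q_G: "Q (G g)" for g
  proof (rule character_span_induct[where Q = Q and f = "G g", OF d])
    show "G g (n + d) = G g n" for n
    proof -
      have "coprime (n + d) d \<longleftrightarrow> coprime n d" by (metis coprime_iff_gcd_eq_1 gcd_add1)
      then show ?thesis
        using periodic_add_mult[of f d "g * n" g, OF per] by (simp add: G_def distrib_left)
    qed
    show "G g n = 0" if "\<not> coprime n d" for n using that by (simp add: G_def)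
    show "Q (\<lambda>n. 0)" by (simp add: Q_def)
    show "Q \<psi>" if "dchar d \<psi>" for \<psi> using chars[OF that] by (simp add: Q_def)
    show "Q (\<lambda>n. a n + b n)" if "Q a" "Q b" for a b
      using tendsto_add[OF that[unfolded Q_def]]
      by (simp add: Q_def distrib_left sum.distrib add_divide_distrib)
    show "Q (\<lambda>n. c * a n)" if "Q a" for c a
      using tendsto_mult_right_zero[OF that[unfolded Q_def], of c]
      by (simp add: Q_def sum_distrib_left mult_ac)
  qed
  define S where "S g M = (\<Sum>m=1..M. of_int (moebius_mu m) * G g m)" for g M
  have S_lim: "(\<lambda>N. S g (N div g) / of_nat N) \<longlonglongrightarrow> 0" if g: "0 < g" for g
  proof -
    have "filterlim (\<lambda>N. N div g) at_top sequentially"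
      unfolding filterlim_at_top
    proof
      fix Z
      show "\<forall>\<^sub>F x in sequentially. Z \<le> x div g"
        using eventually_ge_at_top[of "Z * g"] by eventually_elim (use g in \<open>simp add: less_eq_div_iff_mult_less_eq\<close>)
    qed
    from filterlim_compose[OF Q_G[of g, unfolded Q_def] this]
    have "(\<lambda>N. S g (N div g) / of_nat (N div g)) \<longlonglongrightarrow> 0" by (simp add: S_def)
    then have "(\<lambda>N. norm (S g (N div g) / of_nat (N div g))) \<longlonglongrightarrow> 0" by (rule tendsto_norm_zero)
    then show ?thesis
    proof (rule Lim_null_comparison[rotated], intro always_eventually allI)
      fix N
      show "norm (S g (N div g) / of_nat N) \<le> norm (S g (N div g) / of_nat (N div g))"
      proof (cases "N div g = 0")
        case True
        then show ?thesis by (simp add: S_def)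
      next
        case False
        have "N div g \<le> N" by simp
        then have "real (N div g) \<le> real N" by linarith
        moreover have "0 < N" using False by (cases "N = 0") auto
        ultimately show ?thesis using False
          unfolding norm_divide norm_of_nat by (intro divide_left_mono) auto
      qed
    qed
  qed
  have split: "(\<Sum>n=1..N. of_int (moebius_mu n) * f n) = (\<Sum>g | g dvd d. of_int (moebius_mu g) * S g (N div g))" for N
  proof -
    have "(\<Sum>n=1..N. of_int (moebius_mu n) * f n) = (\<Sum>g | g dvd d. \<Sum>n | n \<in> {1..N} \<and> gcd n d = g. of_int (moebius_mu n) * f n)"
      using d by (intro sum.group[symmetric]) auto
    also have "\<dots> = (\<Sum>g | g dvd d. of_int (moebius_mu g) * S g (N div g))"
    proof (rule sum.cong[OF refl])
      fix g assume "g \<in> {g. g dvd d}"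
      then have gd: "g dvd d" and g: "0 < g" using d by (auto intro: Nat.gr0I)
      define A where "A = {m. m \<in> {1..N div g} \<and> coprime m d}"
      have fin: "finite A" by (simp add: A_def)
      have "(\<Sum>n | n \<in> {1..N} \<and> gcd n d = g. of_int (moebius_mu n) * f n) = (\<Sum>n\<in>(\<lambda>m. g * m) ` A. of_int (moebius_mu n) * f n)"
      proof (rule sum.mono_neutral_right)
        show "(\<lambda>m. g * m) ` A \<subseteq> {n \<in> {1..N}. gcd n d = g}"
        proof safe
          fix m assume m: "m \<in> A"
          from gd obtain e where e: "d = g * e" by (elim dvdE)
          have "coprime m e" using m e by (auto simp: A_def)
          then show "gcd (g * m) d = g" by (simp add: e gcd_mult_distrib_nat[symmetric])
          have "m * g \<le> N" using m g by (simp add: A_def less_eq_div_iff_mult_less_eq)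
          then show "g * m \<in> {1..N}" using m g by (auto simp: A_def mult.commute)
        qed
        show "\<forall>n\<in>{n \<in> {1..N}. gcd n d = g} - (\<lambda>m. g * m) ` A. of_int (moebius_mu n) * f n = 0"
        proof
          fix n assume n: "n \<in> {n \<in> {1..N}. gcd n d = g} - (\<lambda>m. g * m) ` A"
          then have "g dvd n" by auto
          then obtain m where m: "n = g * m" by (elim dvdE)
          from gd obtain e where e: "d = g * e" by (elim dvdE)
          have "gcd n d = g * gcd m e" by (simp add: e m gcd_mult_distrib_nat)
          with n g have "gcd m e = 1" by auto
          then have me: "coprime m e" unfolding coprime_iff_gcd_eq_1 .
          have "m * g \<le> N" "1 \<le> m" using n m by (auto simp: mult.commute intro: Nat.gr0I)
          then have "m \<in> {1..N div g}" using g by (simp add: less_eq_div_iff_mult_less_eq)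
          with n m have "\<not> coprime m d" by (auto simp: A_def)
          then have "\<not> coprime m g" using me e by auto
          then have "moebius_mu n = 0" using moebius_mu_not_coprime[of g m] m by (simp add: coprime_commute)
          then show "of_int (moebius_mu n) * f n = 0" by simp
        qed
      qed simp
      also have "\<dots> = (\<Sum>m\<in>A. of_int (moebius_mu (g * m)) * f (g * m))"
        using g by (subst sum.reindex) (auto simp: inj_on_def)
      also have "\<dots> = (\<Sum>m\<in>A. of_int (moebius_mu g) * (of_int (moebius_mu m) * G g m))"
      proof (rule sum.cong[OF refl])
        fix m assume m: "m \<in> A"
        then have "coprime g m" using gd by (auto simp: A_def coprime_commute intro: coprime_divisors[of m m g d])
        then show "of_int (moebius_mu (g * m)) * f (g * m) = of_int (moebius_mu g) * (of_int (moebius_mu m) * G g m)"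
          using m by (simp add: moebius_mu_mult G_def A_def)
      qed
      also have "\<dots> = of_int (moebius_mu g) * S g (N div g)"
        unfolding S_def sum_distrib_left
        by (rule sum.mono_neutral_left) (auto simp: A_def G_def)
      finally show "(\<Sum>n | n \<in> {1..N} \<and> gcd n d = g. of_int (moebius_mu n) * f n) = of_int (moebius_mu g) * S g (N div g)" .
    qed
    finally show ?thesis .
  qed
  have "(\<lambda>N. \<Sum>g | g dvd d. of_int (moebius_mu g) * (S g (N div g) / of_nat N)) \<longlonglongrightarrow> (\<Sum>g | g dvd d. of_int (moebius_mu g) * 0)"
    using d by (intro tendsto_intros S_lim) (auto intro: Nat.gr0I)
  moreover have "(\<Sum>n=1..N. of_int (moebius_mu n) * f n) / of_nat N
      = (\<Sum>g | g dvd d. of_int (moebius_mu g) * (S g (N div g) / of_nat N))" for N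
    unfolding split sum_divide_distrib by simp
  ultimately show ?thesis by simp
qed

section \<open>A Tauberian theorem for Dirichlet series\<close>

text \<open>The Fourier transform of the tent function below, that is, the Fejer kernel of the real line.  A compactly
supported transform is what makes values of the Dirichlet series on a bounded part of the line \<open>Re s = 1\<close>
sufficient.\<close>

definition fejer :: "real \<Rightarrow> real"
  where "fejer w = (if w = 0 then 1 else (sin (w / 2) / (w / 2))\<^sup>2)"

lemma fejer_nonneg: "0 \<le> fejer w"
  by (simp add: fejer_def)

lemma fejer_le: "fejer w \<le> 8 * inverse (1 + w\<^sup>2)"
proof (cases "w = 0")
  case False
  have 1: "(sin (w/2))\<^sup>2 \<le> (w/2)\<^sup>2"
    using abs_sin_x_le_abs_x[of "w/2"] by (simp only: abs_le_square_iff)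
  have 2: "(sin (w/2))\<^sup>2 \<le> 1"
    by (simp add: abs_square_le_1)
  have "(sin (w/2))\<^sup>2 * (1 + w\<^sup>2) \<le> 8 * (w/2)\<^sup>2"
  proof -
    have "(sin (w/2))\<^sup>2 * (1 + w\<^sup>2) = (sin (w/2))\<^sup>2 + (sin (w/2))\<^sup>2 * w\<^sup>2"
      by (simp add: algebra_simps)
    also have "\<dots> \<le> (w/2)\<^sup>2 + 1 * w\<^sup>2"
      using 1 2 by (intro add_mono mult_right_mono) auto
    also have "\<dots> \<le> 8 * (w/2)\<^sup>2" by (simp add: power_divide)
    finally show ?thesis .
  qed
  moreover have "1 + w\<^sup>2 > 0" "(w/2)\<^sup>2 > 0" using False by (auto simp: add_pos_nonneg)
  ultimately show ?thesis
    using False by (simp add: fejer_def power_divide divide_simps mult.commute)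
qed (simp add: fejer_def)

lemma fejer_measurable [measurable]: "fejer \<in> borel_measurable borel"
  unfolding fejer_def by measurable

lemma fejer_integrable: "integrable lborel fejer"
proof (rule Bochner_Integration.integrable_bound)
  have "integrable lborel (\<lambda>w::real. inverse (1 + w\<^sup>2))"
    using integrable_inverse_1_plus_square by (simp add: set_integrable_def)
  then show "integrable lborel (\<lambda>w::real. 8 * inverse (1 + w\<^sup>2))"
    by simp
qed (auto simp: fejer_nonneg intro!: AE_I2 order.trans[OF fejer_le])

lemma fejer_integral_pos: "0 < (\<integral>w. fejer w \<partial>lborel)"
proof -
  have "(\<integral>w. fejer w \<partial>lborel) \<noteq> 0"
  proof
    assume "(\<integral>w. fejer w \<partial>lborel) = 0"
    then have "AE w in lborel. fejer w = 0"
      using integral_nonneg_eq_0_iff_AE[OF fejer_integrable] fejer_nonneg by auto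
    then have "AE w in lborel. w \<notin> {0<..<1::real}"
    proof eventually_elim
      case (elim w)
      have "sin (w/2) > 0" if "0 < w" "w < 1"
        using that pi_gt3 by (intro sin_gt_zero) auto
      then show ?case using elim by (auto simp: fejer_def split: if_splits)
    qed
    then have "emeasure lborel {0<..<1::real} = 0"
      by (subst (asm) AE_iff_measurable[OF _ refl]) (auto simp: greaterThanLessThan_def greaterThan_def lessThan_def Int_def)
    then show False by simp
  qed
  moreover have "0 \<le> (\<integral>w. fejer w \<partial>lborel)" by (simp add: fejer_nonneg)
  ultimately show ?thesis by simp
qed

definition tent :: "real \<Rightarrow> real" where "tent t = max 0 (1 - \<bar>t\<bar>)"

lemma continuous_tent: "continuous_on UNIV tent"
  unfolding tent_def by (intro continuous_intros)

lemma tent_integrable: "integrable lborel tent"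
proof -
  have "integrable lborel (\<lambda>t. indicator {-1..1} t *\<^sub>R tent t)"
    by (rule borel_integrable_compact) (auto intro: continuous_on_subset[OF continuous_tent])
  moreover have "(\<lambda>t. indicator {-1..1} t *\<^sub>R tent t) = tent"
    by (auto simp: fun_eq_iff tent_def indicator_def)
  ultimately show ?thesis by simp
qed

lemma tent_fourier: "(\<integral>t. tent t *\<^sub>R cis (t * w) \<partial>lborel) = of_real (fejer w)"
proof -
  have int: "integrable lborel (\<lambda>t. indicator {-1..1} t *\<^sub>R (tent t *\<^sub>R cis (t * w)))"
    by (rule borel_integrable_compact)
       (auto intro!: continuous_intros continuous_on_subset[OF continuous_tent])
  have eq: "(\<lambda>t. indicator {-1..1} t *\<^sub>R (tent t *\<^sub>R cis (t * w))) = (\<lambda>t. tent t *\<^sub>R cis (t * w))"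
    by (auto simp: fun_eq_iff tent_def indicator_def)
  have "((\<lambda>t. tent t *\<^sub>R cis (t * w)) has_integral of_real (fejer w)) {-1..1}"
  proof (cases "w = 0")
    case True
    have 1: "((\<lambda>t. of_real (1 + t) :: complex) has_integral (of_real (0 + 0^2/2) - of_real (-1 + (-1)^2/2))) {-1..0::real}"
      by (rule fundamental_theorem_of_calculus)
         (auto intro!: derivative_eq_intros has_vector_derivative_of_real simp: has_real_derivative_iff_has_vector_derivative[symmetric] simp del: of_real_add of_real_diff)
    have 2: "((\<lambda>t. of_real (1 - t) :: complex) has_integral (of_real (1 - 1^2/2) - of_real (0 - 0^2/2))) {0..1::real}"
      by (rule fundamental_theorem_of_calculus)
         (auto intro!: derivative_eq_intros has_vector_derivative_of_real simp: has_real_derivative_iff_has_vector_derivative[symmetric] simp del: of_real_add of_real_diff)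
    have 1: "((\<lambda>t. tent t *\<^sub>R cis (t * w)) has_integral (of_real (0 + 0^2/2) - of_real (-1 + (-1)^2/2))) {-1..0::real}"
      by (rule has_integral_eq[OF _ 1]) (auto simp: tent_def True scaleR_conv_of_real)
    have 2: "((\<lambda>t. tent t *\<^sub>R cis (t * w)) has_integral (of_real (1 - 1^2/2) - of_real (0 - 0^2/2))) {0..1::real}"
      by (rule has_integral_eq[OF _ 2]) (auto simp: tent_def True scaleR_conv_of_real)
    have "((\<lambda>t. tent t *\<^sub>R cis (t * w)) has_integral ((of_real (0 + 0^2/2) - of_real (-1 + (-1)^2/2)) + (of_real (1 - 1^2/2) - of_real (0 - 0^2/2)))) {-1..1}"
      by (rule has_integral_combine[OF _ _ 1 2]) auto
    then show ?thesis by (simp add: fejer_def True)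
  next
    case False
    define A where "A s t = of_real (1 - s * t) * cis (t * w) / (\<i> * w) - of_real s * cis (t * w) / (of_real (w\<^sup>2))" for s t :: real
    have dA: "(A s has_vector_derivative of_real (1 - s * t) * cis (t * w)) (at t within S)" for s t S
    proof -
      have c: "((\<lambda>t. cis (t * w)) has_vector_derivative (\<i> * w * cis (t * w))) (at t within S)"
        unfolding cis_conv_exp
        by (auto intro!: derivative_eq_intros exp_scaleR_has_vector_derivative_right has_vector_derivative_real_field simp: algebra_simps)
      have d: "((\<lambda>t. of_real (1 - s * t) :: complex) has_vector_derivative (of_real (-s))) (at t within S)"
        by (auto intro!: derivative_eq_intros simp: has_real_derivative_iff_has_vector_derivative[symmetric])
      have "(A s has_vector_derivative ((of_real (1 - s * t) * (\<i> * w * cis (t * w)) + of_real (-s) * cis (t*w)) / (\<i> * w)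
           - of_real s * (\<i> * w * cis (t * w)) / (of_real (w\<^sup>2)))) (at t within S)"
        unfolding A_def
        by (intro has_vector_derivative_diff has_vector_derivative_divide has_vector_derivative_mult c d has_vector_derivative_mult_right)
      moreover have "((of_real (1 - s * t) * (\<i> * w * cis (t * w)) + of_real (-s) * cis (t*w)) / (\<i> * w)
           - of_real s * (\<i> * w * cis (t * w)) / (of_real (w\<^sup>2))) = of_real (1 - s * t) * cis (t * w)"
        using False by (simp add: field_simps power2_eq_square)
      ultimately show ?thesis by simp
    qed
    have 1: "((\<lambda>t. of_real (1 - (-1) * t) * cis (t * w)) has_integral (A (-1) 0 - A (-1) (-1))) {-1..0}"
      by (rule fundamental_theorem_of_calculus[OF _ dA]) auto
    have 2: "((\<lambda>t. of_real (1 - 1 * t) * cis (t * w)) has_integral (A 1 1 - A 1 0)) {0..1}"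
      by (rule fundamental_theorem_of_calculus[OF _ dA]) auto
    have 1: "((\<lambda>t. tent t *\<^sub>R cis (t * w)) has_integral (A (-1) 0 - A (-1) (-1))) {-1..0}"
      by (rule has_integral_eq[OF _ 1]) (auto simp: tent_def scaleR_conv_of_real)
    have 2: "((\<lambda>t. tent t *\<^sub>R cis (t * w)) has_integral (A 1 1 - A 1 0)) {0..1}"
      by (rule has_integral_eq[OF _ 2]) (auto simp: tent_def scaleR_conv_of_real)
    have 3: "((\<lambda>t. tent t *\<^sub>R cis (t * w)) has_integral ((A (-1) 0 - A (-1) (-1)) + (A 1 1 - A 1 0))) {-1..1}"
      by (rule has_integral_combine[OF _ _ 1 2]) auto
    have "(A (-1) 0 - A (-1) (-1)) + (A 1 1 - A 1 0) = (2 - (cis w + cis (-w))) / of_real (w\<^sup>2)"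
      using False by (simp add: A_def field_simps)
    also have "cis w + cis (-w) = of_real (2 * cos w)"
      by (simp add: complex_eq_iff)
    also have "cos w = 1 - 2 * (sin (w/2))\<^sup>2"
      using cos_double_sin[of "w/2"] by simp
    also have "(2 - of_real (2 * (1 - 2 * (sin (w/2))\<^sup>2))) / of_real (w\<^sup>2) = complex_of_real (fejer w)"
      using False by (simp add: fejer_def power_divide)
    finally show ?thesis using 3 by simp
  qed
  moreover have "((\<lambda>t. tent t *\<^sub>R cis (t * w)) has_integral (\<integral>t. tent t *\<^sub>R cis (t * w) \<partial>lborel)) {-1..1}"
  proof -
    have "set_integrable lborel {-1..1} (\<lambda>t. tent t *\<^sub>R cis (t * w))"
      using int by (simp add: set_integrable_def)
    from set_borel_integral_eq_integral[OF this] show ?thesis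
      unfolding set_lebesgue_integral_def eq by (simp add: has_integral_integral)
  qed
  ultimately show ?thesis
    using has_integral_unique by blast
qed

text \<open>Fubini's theorem: smoothing by the Fejer kernel is the inverse Fourier transform cut off by the tent.\<close>

lemma tent_laplace:
  fixes h :: "real \<Rightarrow> complex"
  assumes h: "integrable lborel h"
  shows "(\<integral>t. tent t *\<^sub>R (cis (t * v) * (\<integral>u. h u * cis (- (t * u)) \<partial>lborel)) \<partial>lborel)
    = (\<integral>u. h u * fejer (v - u) \<partial>lborel)"
proof -
  note [measurable] = borel_measurable_integrable[OF h] borel_measurable_integrable[OF tent_integrable]
  have cis_meas [measurable]: "cis \<in> borel_measurable borel"
    by (intro borel_measurable_continuous_onI continuous_intros)
  define f where "f t u = tent t *\<^sub>R (cis (t * (v - u)) * h u)" for t u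
  have nf: "norm (f t u) = tent t * norm (h u)" for t u
    by (simp add: f_def norm_mult tent_def)
  have "integrable (lborel \<Otimes>\<^sub>M lborel) (case_prod f)"
  proof (rule lborel_pair.Fubini_integrable)
    show "(\<lambda>(x, y). f x y) \<in> borel_measurable (lborel \<Otimes>\<^sub>M lborel)"
      unfolding f_def by measurable
    show "integrable lborel (\<lambda>x. \<integral>y. norm (case (x, y) of (x, y) \<Rightarrow> f x y) \<partial>lborel)"
      using tent_integrable by (simp add: nf)
    have "integrable lborel (f x)" for x
    proof (rule Bochner_Integration.integrable_bound[of _ "\<lambda>u. tent x * norm (h u)"])
      show "f x \<in> borel_measurable lborel"
        unfolding f_def by measurable
      show "AE u in lborel. norm (f x u) \<le> norm (tent x * norm (h u))"
        by (intro AE_I2) (auto simp: nf tent_def)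
    qed (use h in auto)
    then show "AE x in lborel. integrable lborel (\<lambda>y. case (x, y) of (x, y) \<Rightarrow> f x y)"
      by simp
  qed
  from lborel_pair.Fubini_integral[OF this]
  have "(\<integral>u. (\<integral>t. f t u \<partial>lborel) \<partial>lborel) = (\<integral>t. (\<integral>u. f t u \<partial>lborel) \<partial>lborel)" .
  moreover have "(\<integral>t. f t u \<partial>lborel) = h u * fejer (v - u)" for u
  proof -
    have "(\<integral>t. f t u \<partial>lborel) = (\<integral>t. (tent t *\<^sub>R cis (t * (v - u))) * h u \<partial>lborel)"
      by (simp add: f_def)
    also have "\<dots> = (\<integral>t. tent t *\<^sub>R cis (t * (v - u)) \<partial>lborel) * h u"
      by (rule integral_mult_left_zero)
    finally show ?thesis by (simp add: tent_fourier)
  qed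
  moreover have "(\<integral>u. f t u \<partial>lborel) = tent t *\<^sub>R (cis (t * v) * (\<integral>u. h u * cis (- (t * u)) \<partial>lborel))" for t
  proof -
    have "f t u = (tent t *\<^sub>R cis (t * v)) * (h u * cis (- (t * u)))" for u
      by (simp add: f_def cis_mult right_diff_distrib flip: mult.assoc)
    then have "(\<integral>u. f t u \<partial>lborel) = (\<integral>u. (tent t *\<^sub>R cis (t * v)) * (h u * cis (- (t * u))) \<partial>lborel)"
      by simp
    also have "\<dots> = (tent t *\<^sub>R cis (t * v)) * (\<integral>u. h u * cis (- (t * u)) \<partial>lborel)"
      by (rule integral_mult_right_zero)
    finally show ?thesis by simp
  qed
  ultimately show ?thesis by simp
qed

text \<open>A quantitative Riemann-Lebesgue lemma.  A shift by half a period \<open>\<pi>/v\<close> changes the sign of the oscillating factor,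
so that twice the integral is the integral of a difference of nearby values.  The bound depends on \<open>\<phi>\<close> only through
its modulus of continuity, so it is uniform over equicontinuous families.\<close>

lemma half_period_shift_bound:
  fixes \<phi> :: "real \<Rightarrow> complex"
  assumes cont: "continuous_on UNIV \<phi>" and supp: "\<And>t. \<bar>t\<bar> \<ge> 1 \<Longrightarrow> \<phi> t = 0"
    and v: "pi < v" and osc: "\<And>t. norm (\<phi> t - \<phi> (t + pi / v)) \<le> e"
  shows "norm (\<integral>t. cis (t * v) * \<phi> t \<partial>lborel) \<le> 2 * e"
proof -
  define h where "h = pi / v"
  have h: "0 < h" "h < 1" using v pi_gt_zero less_trans[OF pi_gt_zero v] by (simp_all add: h_def)
  have int: "integrable lborel (\<lambda>t. cis (t * v) * \<phi> t)"
  proof -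
    have "integrable lborel (\<lambda>t. indicator {-1..1} t *\<^sub>R (cis (t * v) * \<phi> t))"
      by (rule borel_integrable_compact)
         (auto intro!: continuous_intros continuous_on_subset[OF cont])
    moreover have "(\<lambda>t. indicator {-1..1} t *\<^sub>R (cis (t * v) * \<phi> t)) = (\<lambda>t. cis (t * v) * \<phi> t)"
      using supp by (auto simp: fun_eq_iff indicator_def)
    ultimately show ?thesis by simp
  qed
  have ch: "cis ((h + t) * v) = - cis (t * v)" for t
  proof -
    have "(h + t) * v = pi + t * v" using less_trans[OF pi_gt_zero v] by (simp add: h_def field_simps)
    then show ?thesis by (simp add: complex_eq_iff)
  qed
  then have ch': "cis ((t + h) * v) = - cis (t * v)" for t
    by (metis add.commute)
  let ?I = "\<integral>t. cis (t * v) * \<phi> t \<partial>lborel"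
  have int2: "integrable lborel (\<lambda>t. cis (t * v) * \<phi> (t + h))"
    using lborel_integrable_real_affine[OF int, of 1 h] by (simp add: ch add.commute[of h _] ch')
  have "?I = (\<integral>t. cis ((h + t) * v) * \<phi> (h + t) \<partial>lborel)"
    using lborel_integral_real_affine[of 1 "\<lambda>t. cis (t * v) * \<phi> t" h] by simp
  also have "\<dots> = - (\<integral>t. cis (t * v) * \<phi> (t + h) \<partial>lborel)"
    by (simp add: add.commute[of h _] ch')
  finally have "2 * ?I = ?I - (\<integral>t. cis (t * v) * \<phi> (t + h) \<partial>lborel)"
    by simp
  also have "\<dots> = (\<integral>t. cis (t * v) * (\<phi> t - \<phi> (t + h)) \<partial>lborel)"
    by (simp add: int int2 right_diff_distrib)
  finally have "norm (2 * ?I) = norm (\<integral>t. cis (t * v) * (\<phi> t - \<phi> (t + h)) \<partial>lborel)"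
    by simp
  also have "\<dots> \<le> (\<integral>t. e * indicator {-2..2::real} t \<partial>lborel)"
  proof (rule Bochner_Integration.integral_norm_bound_integral)
    show "integrable lborel (\<lambda>t. cis (t * v) * (\<phi> t - \<phi> (t + h)))"
      using Bochner_Integration.integrable_diff[OF int int2] by (simp add: right_diff_distrib)
    show "norm (cis (t * v) * (\<phi> t - \<phi> (t + h))) \<le> e * indicator {-2..2::real} t" for t
      using osc[of t] h supp by (auto simp: norm_mult h_def indicator_def)
  qed simp
  also have "\<dots> = 4 * e" by simp
  finally show ?thesis by (simp add: norm_mult)
qed

text \<open>If the Laplace transform extends continuously to the imaginary axis, then the Fejer averages tend to 0.  On the line
\<open>Re z = \<delta> > 0\<close> the average is a Fourier integral of \<open>\<Phi>\<close> over a bounded interval; by uniform continuity of \<open>\<Phi>\<close> on a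
compact set it is small uniformly in \<open>\<delta>\<close>, and dominated convergence lets \<open>\<delta>\<close> tend to 0.\<close>

lemma fejer_average_tendsto_0:
  fixes g :: "real \<Rightarrow> complex" and \<Phi> :: "complex \<Rightarrow> complex"
  assumes g [measurable]: "g \<in> borel_measurable borel"
    and g_le: "\<And>u. norm (g u) \<le> 1" and g_0: "\<And>u. u \<le> 0 \<Longrightarrow> g u = 0"
    and cont: "continuous_on {z. 0 \<le> Re z} \<Phi>"
    and lap: "\<And>z. 0 < Re z \<Longrightarrow> \<Phi> z = (\<integral>u. g u * exp (- (z * of_real u)) \<partial>lborel)"
  shows "((\<lambda>v. \<integral>u. g u * fejer (v - u) \<partial>lborel) \<longlongrightarrow> 0) at_top"
proof (rule tendstoI)
  fix e :: real assume e: "0 < e"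
  define \<psi> where "\<psi> \<delta> t = tent t *\<^sub>R \<Phi> (Complex \<delta> t)" for \<delta> t
  have cont2: "continuous_on ({0..1} \<times> {-2..2}) (\<lambda>(\<delta>,t). \<psi> \<delta> t)"
    unfolding \<psi>_def case_prod_unfold
  proof (intro continuous_intros)
    show "continuous_on ({0..1} \<times> {- 2..2}) (\<lambda>x. tent (snd x))"
      by (rule continuous_on_compose2[OF continuous_tent]) (auto intro: continuous_intros)
    show "continuous_on ({0..1} \<times> {- 2..2}) (\<lambda>x. \<Phi> (Complex (fst x) (snd x)))"
      by (rule continuous_on_compose2[OF cont]) (auto simp: Complex_eq intro!: continuous_intros)
  qed
  have "uniformly_continuous_on ({0..1::real} \<times> {-2..2::real}) (\<lambda>(\<delta>,t). \<psi> \<delta> t)"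
    by (rule compact_uniformly_continuous[OF cont2]) (intro compact_Times compact_Icc)
  then obtain d where d: "0 < d" and dd: "\<And>x x'. x \<in> {0..1::real} \<times> {-2..2::real} \<Longrightarrow> x' \<in> {0..1} \<times> {-2..2} \<Longrightarrow>
      dist x' x < d \<Longrightarrow> dist (case x' of (\<delta>,t) \<Rightarrow> \<psi> \<delta> t) (case x of (\<delta>,t) \<Rightarrow> \<psi> \<delta> t) < e / 4"
    unfolding uniformly_continuous_on_def using e by (metis (no_types, lifting) divide_pos_pos zero_less_numeral)
  have main: "norm (\<integral>u. g u * fejer (v - u) \<partial>lborel) \<le> e / 2" if v: "v > pi" "v > pi / d" for v
  proof -
    have v0: "0 < v" using v pi_gt_zero by linarith
    define h where "h n u = g u * exp (- (of_real (1 / real (Suc n)) * of_real u))" for n u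
    have nh: "norm (h n u) = norm (g u) * exp (- (u / real (Suc n)))" for n u
      by (simp add: h_def norm_mult Re_divide_of_real del: of_nat_Suc)
    have h_int: "integrable lborel (h n)" for n
    proof (rule Bochner_Integration.integrable_bound)
      show "integrable lborel (\<lambda>u. indicator {0<..} u *\<^sub>R exp (- (u * (1 / real (Suc n)))))"
        using integrable_I0i_exp_mscale[of "1 / real (Suc n)"] by (simp add: set_integrable_def)
      show "h n \<in> borel_measurable lborel" unfolding h_def by measurable
      show "AE u in lborel. norm (h n u) \<le> norm (indicator {0<..} u *\<^sub>R exp (- (u * (1 / real (Suc n)))))"
        using g_le g_0 by (intro AE_I2) (auto simp: nh indicator_def not_less mult_le_cancel_right1)
    qed
    have bnd: "norm (\<integral>u. h n u * fejer (v - u) \<partial>lborel) \<le> e / 2" for n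
    proof -
      let ?\<delta> = "1 / real (Suc n)"
      have "(\<integral>u. h n u * cis (- (t * u)) \<partial>lborel) = \<Phi> (Complex ?\<delta> t)" for t
      proof -
        have "\<Phi> (Complex ?\<delta> t) = (\<integral>u. g u * exp (- (Complex ?\<delta> t * of_real u)) \<partial>lborel)"
          by (rule lap) simp
        also have "\<dots> = (\<integral>u. h n u * cis (- (t * u)) \<partial>lborel)"
        proof (rule Bochner_Integration.integral_cong[OF refl])
          fix u :: real
          have "exp (- (Complex ?\<delta> t * of_real u)) = exp (- (of_real ?\<delta> * of_real u)) * cis (- (t * u))"
            unfolding cis_conv_exp exp_add[symmetric]
            by (rule arg_cong[where f = exp]) (simp add: complex_eq_iff)
          then show "g u * exp (- (Complex ?\<delta> t * of_real u)) = h n u * cis (- (t * u))"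
            by (simp add: h_def)
        qed
        finally show ?thesis ..
      qed
      with tent_laplace[OF h_int, of v n]
      have "(\<integral>u. h n u * fejer (v - u) \<partial>lborel) = (\<integral>t. cis (t * v) * \<psi> ?\<delta> t \<partial>lborel)"
        by (simp add: \<psi>_def)
      also have "norm \<dots> \<le> 2 * (e / 4)"
      proof (rule half_period_shift_bound)
        show "continuous_on UNIV (\<psi> ?\<delta>)"
          unfolding \<psi>_def
          by (intro continuous_intros continuous_tent continuous_on_compose2[OF cont])
             (auto simp: Complex_eq intro!: continuous_intros)
        show "\<psi> ?\<delta> t = 0" if "\<bar>t\<bar> \<ge> 1" for t using that by (simp add: \<psi>_def tent_def)
        show "norm (\<psi> ?\<delta> t - \<psi> ?\<delta> (t + pi / v)) \<le> e / 4" for t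
        proof (cases "\<bar>t\<bar> < 1 \<or> \<bar>t + pi / v\<bar> < 1")
          case True
          have pv: "0 < pi / v" "pi / v < 1" "pi / v < d"
            using v v0 d by (auto simp: field_simps)
          have "dist (\<psi> ?\<delta> t) (\<psi> ?\<delta> (t + pi / v)) < e / 4"
            using dd[of "(?\<delta>, t + pi / v)" "(?\<delta>, t)"] True pv
            by (auto simp: dist_Pair_Pair dist_real_def)
          then show ?thesis by (simp add: dist_norm)
        next
          case False
          then show ?thesis using e by (simp add: \<psi>_def tent_def)
        qed
      qed (fact v)
      finally show ?thesis by simp
    qed
    have "(\<lambda>n. \<integral>u. h n u * fejer (v - u) \<partial>lborel) \<longlonglongrightarrow> (\<integral>u. g u * fejer (v - u) \<partial>lborel)"
    proof (rule integral_dominated_convergence)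
      show "integrable lborel (\<lambda>u. fejer (v - u))"
        using lborel_integrable_real_affine[OF fejer_integrable, of "-1" v] by simp
      show "AE u in lborel. (\<lambda>n. h n u * fejer (v - u)) \<longlonglongrightarrow> g u * fejer (v - u)"
      proof (rule AE_I2)
        fix u :: real
        have "(\<lambda>n. g u * exp (- (of_real (1 / real (Suc n)) * of_real u)) * of_real (fejer (v - u)))
            \<longlonglongrightarrow> g u * exp (- (of_real 0 * of_real u)) * of_real (fejer (v - u))"
          by (intro tendsto_intros LIMSEQ_Suc[OF lim_1_over_n])
        then show "(\<lambda>n. h n u * fejer (v - u)) \<longlonglongrightarrow> g u * fejer (v - u)"
          by (simp add: h_def)
      qed
      show "AE u in lborel. norm (h n u * complex_of_real (fejer (v - u))) \<le> fejer (v - u)" for n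
      proof (rule AE_I2)
        fix u :: real
        have "norm (h n u) \<le> 1"
          using g_le[of u] g_0[of u] by (cases "u \<le> 0") (auto simp: nh intro!: mult_le_one)
        then show "norm (h n u * complex_of_real (fejer (v - u))) \<le> fejer (v - u)"
          by (simp add: norm_mult fejer_nonneg mult_left_le_one_le)
      qed
    qed (unfold h_def, measurable)
    then show ?thesis
      by (rule tendsto_upperbound[OF tendsto_norm]) (use bnd in auto)
  qed
  have "eventually (\<lambda>v. v > pi \<and> v > pi / d) at_top"
    by (intro eventually_conj eventually_gt_at_top)
  then show "eventually (\<lambda>v. dist (\<integral>u. g u * fejer (v - u) \<partial>lborel) 0 < e) at_top"
  proof eventually_elim
    case (elim v)
    then show ?case using main[of v] e by simp
  qed
qed

text \<open>A Fejer kernel that is concentrated on a scale on which \<open>g\<close> hardly varies recovers \<open>g\<close> from its averages.\<close>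

lemma slowly_oscillating_tendsto_0:
  fixes g :: "real \<Rightarrow> complex" and \<Phi> :: "complex \<Rightarrow> complex"
  assumes g [measurable]: "g \<in> borel_measurable borel"
    and g_le: "\<And>u. norm (g u) \<le> 1" and g_0: "\<And>u. u \<le> 0 \<Longrightarrow> g u = 0"
    and cont: "continuous_on {z. 0 \<le> Re z} \<Phi>"
    and lap: "\<And>z. 0 < Re z \<Longrightarrow> \<Phi> z = (\<integral>u. g u * exp (- (z * of_real u)) \<partial>lborel)"
    and slow: "\<And>e. 0 < e \<Longrightarrow> \<exists>d>0. \<exists>v0. \<forall>v\<ge>v0. \<forall>u. \<bar>u - v\<bar> \<le> d \<longrightarrow> norm (g u - g v) \<le> e"
  shows "(g \<longlongrightarrow> 0) at_top"
proof (rule tendstoI)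
  fix e :: real assume e: "0 < e"
  define I where "I = (\<integral>w. fejer w \<partial>lborel)"
  have I: "I > 0" using fejer_integral_pos by (simp add: I_def)
  define e' where "e' = e * I / 8"
  have e': "e' > 0" using e I by (simp add: e'_def)
  from slow[of "e/4"] e obtain d v0 where d: "d > 0"
    and dv: "\<And>u v. v \<ge> v0 \<Longrightarrow> \<bar>u - v\<bar> \<le> d \<Longrightarrow> norm (g u - g v) \<le> e / 4" by auto
  have tail: "((\<lambda>R. \<integral>w. indicator {w. R < \<bar>w\<bar>} w * fejer w \<partial>lborel) \<longlongrightarrow> (\<integral>w. 0 \<partial>(lborel :: real measure))) at_top"
  proof (rule integral_dominated_convergence_at_top)
    show "AE x in lborel. ((\<lambda>R. indicat_real {w. R < \<bar>w\<bar>} x * fejer x) \<longlongrightarrow> 0) at_top"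
    proof (rule AE_I2, rule tendsto_eventually)
      fix x :: real
      show "\<forall>\<^sub>F R in at_top. indicat_real {w. R < \<bar>w\<bar>} x * fejer x = 0"
        using eventually_ge_at_top[of "\<bar>x\<bar>"] by eventually_elim (auto simp: indicator_def)
    qed
    show "\<forall>\<^sub>F R in at_top. AE x in lborel. norm (indicat_real {w. R < \<bar>w\<bar>} x * fejer x) \<le> fejer x"
      by (intro always_eventually allI AE_I2) (auto simp: indicator_def fejer_nonneg)
  qed (auto intro: fejer_integrable)
  have "eventually (\<lambda>R. (\<integral>w. indicator {w. R < \<bar>w\<bar>} w * fejer w \<partial>lborel) < e') at_top"
    using order_tendstoD(2)[OF tail, of e'] e' by simp
  from eventually_happens'[OF _ eventually_conj[OF this eventually_gt_at_top[of 0]]]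
  obtain R where R: "R > 0" and Rt: "(\<integral>w. indicator {w. R < \<bar>w\<bar>} w * fejer w \<partial>lborel) < e'"
    by auto
  define T where "T = R / d"
  have T: "T > 0" using R d by (simp add: T_def)
  \<comment> \<open>Rescaling by \<open>T\<close> gives a Fejer kernel whose mass outside \<open>\<bar>u - v\<bar> \<le> d\<close> is less than \<open>e'\<close>.\<close>
  have avg: "((\<lambda>v. \<integral>u. g (u / T) * fejer (v - u) \<partial>lborel) \<longlongrightarrow> 0) at_top"
  proof (rule fejer_average_tendsto_0)
    show "continuous_on {z. 0 \<le> Re z} (\<lambda>z. of_real T * \<Phi> (of_real T * z))"
      by (intro continuous_intros continuous_on_compose2[OF cont]) (use T in auto)
    fix z :: complex assume z: "0 < Re z"
    have "\<Phi> (of_real T * z) = (\<integral>u. g u * exp (- ((of_real T * z) * of_real u)) \<partial>lborel)"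
      using z T by (intro lap) auto
    also have "\<dots> = (1 / T) *\<^sub>R (\<integral>u. g (u / T) * exp (- (z * of_real u)) \<partial>lborel)"
      using lborel_integral_real_affine[of "1 / T" "\<lambda>u. g u * exp (- ((of_real T * z) * of_real u))" 0] T
      by (simp add: mult.commute)
    finally show "of_real T * \<Phi> (of_real T * z) = (\<integral>u. g (u / T) * exp (- (z * of_real u)) \<partial>lborel)"
      using T by (simp add: scaleR_conv_of_real)
  qed (use g_le g_0 T in \<open>auto simp: divide_nonpos_pos\<close>)
  have "filterlim (\<lambda>v. T * v) at_top at_top"
    using T by (simp add: filterlim_tendsto_pos_mult_at_top[OF tendsto_const] filterlim_ident)
  from filterlim_compose[OF avg this] 
  have "((\<lambda>v. \<integral>u. g (u / T) * fejer (T * v - u) \<partial>lborel) \<longlongrightarrow> 0) at_top" .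
  then have ev: "eventually (\<lambda>v. norm (\<integral>u. g (u / T) * fejer (T * v - u) \<partial>lborel) < e') at_top"
    using e' by (auto simp: tendsto_iff)
  show "eventually (\<lambda>v. dist (g v) 0 < e) at_top"
    using ev eventually_ge_at_top[of v0]
  proof eventually_elim
    case (elim v)
    have fi: "integrable lborel (\<lambda>u. fejer (T * v - u))"
      using lborel_integrable_real_affine[OF fejer_integrable, of "-1" "T * v"] by simp
    have fI: "(\<integral>u. fejer (T * v - u) \<partial>lborel) = I"
      using lborel_integral_real_affine[of "-1" fejer "T * v"] by (simp add: I_def)
    have ti: "(\<integral>u. indicator {w. R < \<bar>w\<bar>} (T * v - u) * fejer (T * v - u) \<partial>lborel)
        = (\<integral>w. indicator {w. R < \<bar>w\<bar>} w * fejer w \<partial>lborel)"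
      using lborel_integral_real_affine[of "-1" "\<lambda>w. indicator {w. R < \<bar>w\<bar>} w * fejer w" "T * v"] by simp
    have tint: "integrable lborel (\<lambda>u. indicator {w. R < \<bar>w\<bar>} (T * v - u) * fejer (T * v - u))"
      by (rule Bochner_Integration.integrable_bound[OF fi]) (auto simp: indicator_def fejer_nonneg)
    have fic: "integrable lborel (\<lambda>u. complex_of_real (fejer (T * v - u)))"
      using fi by simp
    have gi: "integrable lborel (\<lambda>u. g (u / T) * fejer (T * v - u))"
      by (rule Bochner_Integration.integrable_bound[OF fi])
         (auto simp: norm_mult fejer_nonneg g_le intro!: mult_left_le_one_le)
    have "norm (\<integral>u. (g (u / T) - g v) * fejer (T * v - u) \<partial>lborel)
      \<le> (\<integral>u. (e / 4) * fejer (T * v - u) + 2 * (indicator {w. R < \<bar>w\<bar>} (T * v - u) * fejer (T * v - u)) \<partial>lborel)"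
    proof (rule Bochner_Integration.integral_norm_bound_integral)
      have "integrable lborel (\<lambda>u. g (u / T) * fejer (T * v - u) - g v * fejer (T * v - u))"
        by (rule Bochner_Integration.integrable_diff[OF gi integrable_mult_right[OF fic]])
      then show "integrable lborel (\<lambda>u. (g (u / T) - g v) * fejer (T * v - u))"
        by (simp only: left_diff_distrib)
      fix u
      have "norm (g (u / T) - g v) \<le> e / 4 + 2 * indicator {w. R < \<bar>w\<bar>} (T * v - u)"
      proof (cases "R < \<bar>T * v - u\<bar>")
        case True
        have "norm (g (u / T) - g v) \<le> 1 + 1"
          by (rule order.trans[OF norm_triangle_ineq4]) (intro add_mono g_le)
        then show ?thesis using True e by simp
      next
        case False
        have "u / T - v = (u - T * v) / T"
          using T by (simp add: diff_divide_distrib)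
        then have "\<bar>u / T - v\<bar> = \<bar>T * v - u\<bar> / T"
          using T by (simp add: abs_minus_commute)
        also have "\<dots> \<le> d" using False T d R by (simp add: T_def field_simps)
        finally show ?thesis using dv[OF elim(2), of "u / T"] False by simp
      qed
      from mult_right_mono[OF this fejer_nonneg[of "T * v - u"]]
      show "norm ((g (u / T) - g v) * fejer (T * v - u)) \<le> e / 4 * fejer (T * v - u) +
         2 * (indicator {w. R < \<bar>w\<bar>} (T * v - u) * fejer (T * v - u))"
        by (simp add: norm_mult fejer_nonneg distrib_right mult.assoc)
    qed (use fi tint in auto)
    also have "\<dots> = e / 4 * I + 2 * (\<integral>w. indicator {w. R < \<bar>w\<bar>} w * fejer w \<partial>lborel)"
      using fi tint by (simp add: fI ti)
    finally have B: "norm (\<integral>u. (g (u / T) - g v) * fejer (T * v - u) \<partial>lborel)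
      \<le> e / 4 * I + 2 * (\<integral>w. indicator {w. R < \<bar>w\<bar>} w * fejer w \<partial>lborel)" .
    have eq: "of_real I * g v = (\<integral>u. g (u / T) * fejer (T * v - u) \<partial>lborel) - (\<integral>u. (g (u / T) - g v) * fejer (T * v - u) \<partial>lborel)"
      using gi fic fI by (simp add: left_diff_distrib)
    have C: "norm (of_real I * g v) \<le> norm (\<integral>u. g (u / T) * fejer (T * v - u) \<partial>lborel) + norm (\<integral>u. (g (u / T) - g v) * fejer (T * v - u) \<partial>lborel)"
      unfolding eq by (rule norm_triangle_ineq4)
    have "norm (of_real I * g v) = I * norm (g v)"
      using I by (simp add: norm_mult)
    then have "I * norm (g v) \<le> e' + (e / 4 * I + 2 * e')"
      using C elim(1) Rt B by linarith
    also have "\<dots> < I * e" using I e by (simp add: e'_def field_simps)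
    finally show ?case using I by simp
  qed
qed

lemma integral_exp_half_line:
  fixes s :: complex
  assumes s: "0 < Re s"
  shows "integrable lborel (\<lambda>u. indicator {L<..} u *\<^sub>R exp (- (s * of_real u)))"
    and "(\<integral>u. indicator {L<..} u *\<^sub>R exp (- (s * of_real u)) \<partial>lborel) = exp (- (s * of_real L)) / s"
    and "(\<integral>u. norm (indicator {L<..} u *\<^sub>R exp (- (s * of_real u))) \<partial>lborel) = exp (- (Re s * L)) / Re s"
proof -
  have s0: "s \<noteq> 0" using s by auto
  have int0: "integrable lborel (\<lambda>u. indicator {0<..} u *\<^sub>R exp (- (z * of_real u)))" if z: "0 < Re z" for z :: complex
  proof (rule Bochner_Integration.integrable_bound)
    show "integrable lborel (\<lambda>u. indicator {0<..} u *\<^sub>R exp (- (u * Re z)))"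
      using integrable_I0i_exp_mscale[OF z] by (simp add: set_integrable_def)
  qed (auto simp: indicator_def mult.commute intro!: AE_I2)
  have val0: "(\<integral>u. indicator {0<..} u *\<^sub>R exp (- (z * of_real u)) \<partial>lborel) = 1 / z" if z: "0 < Re z" for z :: complex
  proof -
    have z0: "z \<noteq> 0" using z by auto
    have "(LBINT u=0..\<infinity>. exp (- (z * of_real u))) = 0 - (- (1 / z))"
    proof (rule interval_integral_FTC_integrable[where F = "\<lambda>u. - (exp (- (z * of_real u)) / z)"])
      show "((\<lambda>u. - (exp (- (z * of_real u)) / z)) has_vector_derivative exp (- (z * of_real x))) (at x)" for x :: real
        by (rule has_vector_derivative_eq_rhs, rule has_vector_derivative_real_field)
           (auto intro!: derivative_eq_intros simp: z0)
      show "set_integrable lborel (einterval 0 \<infinity>) (\<lambda>u. exp (- (z * of_real u)))"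
        using int0[OF z] by (simp add: set_integrable_def zero_ereal_def)
      show "(((\<lambda>u. - (exp (- (z * of_real u)) / z)) \<circ> real_of_ereal) \<longlongrightarrow> - (1 / z)) (at_right 0)"
      proof -
        have "((\<lambda>u. - (exp (- (z * of_real u)) / z)) \<longlongrightarrow> - (exp (- (z * of_real 0)) / z)) (at_right 0)"
          by (intro tendsto_intros) (use z0 in auto)
        then show ?thesis
          by (simp add: zero_ereal_def ereal_tendsto_simps)
      qed
      show "(((\<lambda>u. - (exp (- (z * of_real u)) / z)) \<circ> real_of_ereal) \<longlongrightarrow> 0) (at_left \<infinity>)"
      proof -
        have "((\<lambda>u. exp (- (Re z * u))) \<longlongrightarrow> 0) at_top"
          by (intro filterlim_compose[OF exp_at_bot] filterlim_compose[OF filterlim_uminus_at_bot_at_top]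
                filterlim_tendsto_pos_mult_at_top[OF tendsto_const z filterlim_ident])
        then have "((\<lambda>u. norm (exp (- (z * of_real u)))) \<longlongrightarrow> 0) at_top" by simp
        then have "((\<lambda>u. exp (- (z * of_real u))) \<longlongrightarrow> 0) at_top"
          by (rule tendsto_norm_zero_cancel)
        from tendsto_minus[OF tendsto_divide[OF this tendsto_const[of z]]] z0
        show ?thesis by (simp add: ereal_tendsto_simps)
      qed
    qed auto
    then show ?thesis
      by (simp add: interval_lebesgue_integral_0_infty set_lebesgue_integral_def)
  qed
  have shift: "indicator {L<..} (L + 1 * u) *\<^sub>R exp (- (z * of_real (L + 1 * u)))
      = exp (- (z * of_real L)) * (indicator {0<..} u *\<^sub>R exp (- (z * of_real u)))" for u and z :: complex
    by (auto simp: indicator_def exp_add[symmetric] algebra_simps)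
  have int: "integrable lborel (\<lambda>u. indicator {L<..} u *\<^sub>R exp (- (z * of_real u)))" if z: "0 < Re z" for z :: complex
  proof -
    have "integrable lborel (\<lambda>u. indicator {L<..} (L + 1 * u) *\<^sub>R exp (- (z * of_real (L + 1 * u))))"
      unfolding shift by (rule integrable_mult_right[OF int0[OF z]])
    then show ?thesis
      by (rule lborel_integrable_real_affine_iff[of 1 "\<lambda>u. indicator {L<..} u *\<^sub>R exp (- (z * of_real u))" L, THEN iffD1, rotated]) simp
  qed
  have val: "(\<integral>u. indicator {L<..} u *\<^sub>R exp (- (z * of_real u)) \<partial>lborel) = exp (- (z * of_real L)) / z" if z: "0 < Re z" for z :: complex
  proof -
    have "(\<integral>u. indicator {L<..} u *\<^sub>R exp (- (z * of_real u)) \<partial>lborel)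
        = \<bar>1\<bar> *\<^sub>R (\<integral>u. indicator {L<..} (L + 1 * u) *\<^sub>R exp (- (z * of_real (L + 1 * u))) \<partial>lborel)"
      by (rule lborel_integral_real_affine) simp
    also have "\<dots> = exp (- (z * of_real L)) * (1 / z)"
      unfolding shift integral_mult_right_zero val0[OF z] by simp
    finally show ?thesis by simp
  qed
  show "integrable lborel (\<lambda>u. indicator {L<..} u *\<^sub>R exp (- (s * of_real u)))"
    by (rule int[OF s])
  show "(\<integral>u. indicator {L<..} u *\<^sub>R exp (- (s * of_real u)) \<partial>lborel) = exp (- (s * of_real L)) / s"
    by (rule val[OF s])
  have "complex_of_real (\<integral>u. norm (indicator {L<..} u *\<^sub>R exp (- (s * of_real u))) \<partial>lborel)
      = (\<integral>u. of_real (norm (indicator {L<..} u *\<^sub>R exp (- (s * of_real u)))) \<partial>lborel)"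
    by (rule integral_complex_of_real[symmetric])
  also have "\<dots> = (\<integral>u. indicator {L<..} u *\<^sub>R exp (- (of_real (Re s) * of_real u)) \<partial>lborel)"
    by (rule Bochner_Integration.integral_cong) (auto simp: indicator_def exp_of_real[symmetric])
  also have "\<dots> = exp (- (of_real (Re s) * of_real L)) / of_real (Re s)"
    by (rule val) (use s in simp)
  also have "\<dots> = complex_of_real (exp (- (Re s * L)) / Re s)"
    by (simp add: exp_of_real[symmetric])
  finally show "(\<integral>u. norm (indicator {L<..} u *\<^sub>R exp (- (s * of_real u))) \<partial>lborel) = exp (- (Re s * L)) / Re s"
    by (rule of_real_eq_iff[THEN iffD1])
qed

text \<open>With \<open>A(x) = \<Sum>n<x. a(n)\<close>, the function \<open>g(u) = A(e\<^sup>u) e\<^bsup>-u\<^esup>\<close> has the Laplace transform \<open>F(1+z)/(1+z)\<close>, and it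
varies slowly because \<open>A\<close> changes by at most \<open>\<bar>x - y\<bar> + 1\<close> between \<open>x\<close> and \<open>y\<close>.\<close>

theorem mean_tendsto_0_of_dirichlet_series:
  fixes a :: "nat \<Rightarrow> complex" and F :: "complex \<Rightarrow> complex"
  assumes a_le: "\<And>n. norm (a n) \<le> 1"
    and cont: "continuous_on {s. 1 \<le> Re s} F"
    and F: "\<And>s. 1 < Re s \<Longrightarrow> (\<lambda>n. a (Suc n) * of_nat (Suc n) powr (- s)) sums F s"
  shows "(\<lambda>N. (\<Sum>n=1..N. a n) / of_nat N) \<longlonglongrightarrow> 0"
proof -
  \<comment> \<open>The largest \<open>n\<close> strictly below \<open>exp u\<close>; the strict inequality makes \<open>g\<close> vanish for all \<open>u \<le> 0\<close>.\<close>
  define M where "M u = nat (\<lceil>exp u\<rceil> - 1)" for u :: real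
  define S where "S N = (\<Sum>n=1..N. a n)" for N
  define g where "g u = S (M u) * exp (- of_real u)" for u :: real
  define \<Phi> where "\<Phi> z = F (1 + z) / (1 + z)" for z
  have M_less: "n \<le> M u \<longleftrightarrow> real n < exp u" for n u
  proof -
    have "1 \<le> \<lceil>exp u\<rceil>" by simp
    then have "n \<le> M u \<longleftrightarrow> int n < \<lceil>exp u\<rceil>" unfolding M_def by linarith
    also have "\<dots> \<longleftrightarrow> real n < exp u" by (simp add: less_ceiling_iff)
    finally show ?thesis .
  qed
  have M_le: "real (M u) \<le> exp u" for u using M_less[of "M u" u] by simp
  have S_diff: "norm (S m - S n) \<le> \<bar>real m - real n\<bar>" for m n
  proof -
    have "norm (S m - S n) \<le> real m - real n" if "n \<le> m" for m n
    proof -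
      have "S m - S n = (\<Sum>k\<in>{n<..m}. a k)"
        unfolding S_def using that
        by (subst sum_diff[symmetric]) (auto intro!: sum.cong)
      also have "norm \<dots> \<le> of_nat (card {n<..m}) * 1"
        by (rule sum_norm_bound) (rule a_le)
      finally show ?thesis using that by (simp add: of_nat_diff)
    qed
    from this[of n m] this[of m n] show ?thesis
      by (cases "n \<le> m") (auto simp: norm_minus_commute abs_if)
  qed
  have S_le: "norm (S m) \<le> real m" for m using S_diff[of m 0] by (simp add: S_def)
  have "(g \<longlongrightarrow> 0) at_top"
  proof (rule slowly_oscillating_tendsto_0)
    have [measurable]: "S \<in> measurable (count_space UNIV) borel" by simp
    show "g \<in> borel_measurable borel"
      unfolding g_def M_def by measurable
    show "norm (g u) \<le> 1" for u
    proof -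
      have "norm (g u) \<le> exp u * exp (- u)"
        unfolding g_def norm_mult by (intro mult_mono order.trans[OF S_le M_le]) auto
      then show ?thesis by (simp add: exp_minus)
    qed
    show "g u = 0" if "u \<le> 0" for u
    proof -
      have "\<not> 1 \<le> M u" using M_less[of 1 u] that by simp
      then show ?thesis by (simp add: g_def S_def)
    qed
    show "continuous_on {z. 0 \<le> Re z} \<Phi>"
      unfolding \<Phi>_def by (intro continuous_intros continuous_on_compose2[OF cont]) (auto simp: complex_eq_iff)
  next
    fix z :: complex assume z: "0 < Re z"
    define s where "s = 1 + z"
    have s: "1 < Re s" "s \<noteq> 0" using z by (auto simp: s_def complex_eq_iff)
    define f where "f n u = a (Suc n) * (indicator {ln (real (Suc n))<..} u *\<^sub>R exp (- (s * of_real u)))" for n and u :: real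
    have powr_eq: "exp (- (s * of_real (ln (real (Suc n))))) = of_nat (Suc n) powr (- s)" for n
      by (simp add: powr_def Ln_of_nat del: of_nat_Suc)
    have eq: "ln (real (Suc n)) < u \<longleftrightarrow> n < M u" for n u
    proof -
      have "ln (real (Suc n)) < u \<longleftrightarrow> real (Suc n) < exp u"
        by (metis exp_less_cancel_iff exp_ln of_nat_0_less_iff zero_less_Suc)
      then show ?thesis using M_less[of "Suc n" u] by (simp add: Suc_le_eq)
    qed
    have f_sum: "(\<lambda>n. f n u) sums (g u * exp (- (z * of_real u)))" for u
    proof -
      have "(\<lambda>n. f n u) sums (\<Sum>n<M u. f n u)"
        by (rule sums_finite) (auto simp: f_def eq simp del: of_nat_Suc)
      also have "(\<Sum>n<M u. f n u) = (\<Sum>n<M u. a (Suc n)) * exp (- (s * of_real u))"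
        unfolding sum_distrib_right by (rule sum.cong) (auto simp: f_def eq simp del: of_nat_Suc)
      also have "(\<Sum>n<M u. a (Suc n)) = S (M u)"
        unfolding S_def by (simp add: sum.atLeast1_atMost_eq)
      also have "exp (- (s * of_real u)) = exp (- of_real u) * exp (- (z * of_real u))"
        by (simp add: s_def exp_add[symmetric] algebra_simps)
      finally show ?thesis by (simp add: g_def mult.assoc)
    qed
    have f_int: "integrable lborel (f n)" for n
      unfolding f_def by (intro integrable_mult_right integral_exp_half_line) (use s in simp)
    have f_norm: "(\<integral>u. norm (f n u) \<partial>lborel) \<le> real (Suc n) powr (- Re s) / Re s" for n
    proof -
      have "(\<integral>u. norm (f n u) \<partial>lborel) = norm (a (Suc n)) * (exp (- (Re s * ln (real (Suc n)))) / Re s)"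
        unfolding f_def norm_mult integral_mult_right_zero
        using s by (simp add: integral_exp_half_line(3) del: norm_scaleR of_nat_Suc)
      also have "\<dots> \<le> 1 * (exp (- (Re s * ln (real (Suc n)))) / Re s)"
        using s by (intro mult_right_mono a_le) auto
      finally show ?thesis by (simp add: powr_def)
    qed
    have summ: "summable (\<lambda>n. real (Suc n) powr (- Re s) / Re s)"
      using s summable_Suc_iff[of "\<lambda>n. real n powr (- Re s)"]
      by (intro summable_divide) (simp add: summable_real_powr_iff del: of_nat_Suc)
    have "(\<integral>u. (\<Sum>n. f n u) \<partial>lborel) = (\<Sum>n. \<integral>u. f n u \<partial>lborel)"
    proof (rule integral_suminf[OF f_int])
      show "summable (\<lambda>n. \<integral>u. norm (f n u) \<partial>lborel)"
        by (rule summable_comparison_test'[OF summ]) (use f_norm in auto)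
      show "AE u in lborel. summable (\<lambda>n. norm (f n u))"
      proof (rule AE_I2)
        fix u :: real
        have "f n u = 0" if "n \<notin> {..<M u}" for n
          using that by (auto simp: f_def eq simp del: of_nat_Suc)
        then show "summable (\<lambda>n. norm (f n u))"
          by (intro summable_finite[of "{..<M u}"]) auto
      qed
    qed
    moreover have "(\<Sum>n. f n u) = g u * exp (- (z * of_real u))" for u
      using f_sum by (simp add: sums_iff)
    moreover have "(\<integral>u. f n u \<partial>lborel) = a (Suc n) * of_nat (Suc n) powr (- s) / s" for n
      unfolding f_def integral_mult_right_zero
      using s by (simp add: integral_exp_half_line(2) powr_eq del: of_nat_Suc)
    moreover have "(\<Sum>n. a (Suc n) * of_nat (Suc n) powr (- s) / s) = F s / s"
      using sums_divide[OF F[OF s(1)], of s] by (simp add: sums_iff)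
    ultimately show "\<Phi> z = (\<integral>u. g u * exp (- (z * of_real u)) \<partial>lborel)"
      by (simp add: \<Phi>_def s_def)
  next
    fix e :: real assume e: "0 < e"
    have "isCont exp (0::real)" by simp
    then obtain d where d: "d > 0" and dd: "\<And>w::real. \<bar>w\<bar> < d \<Longrightarrow> \<bar>exp w - 1\<bar> < e / 4"
      unfolding continuous_at_eps_delta dist_real_def using e
      by (metis diff_zero divide_pos_pos exp_zero zero_less_numeral)
    have "norm (g u - g v) \<le> e" if v: "ln (2 / e) \<le> v" and u: "\<bar>u - v\<bar> \<le> d / 2" for u v
    proof -
      have "g u - g v = S (M u) * of_real (exp (-u) - exp (-v)) + (S (M u) - S (M v)) * of_real (exp (-v))"
        by (simp add: g_def algebra_simps exp_of_real[symmetric])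
      also have "norm \<dots> \<le> exp u * \<bar>exp (-u) - exp (-v)\<bar> + (\<bar>exp u - exp v\<bar> + 1) * exp (-v)"
      proof (rule order.trans[OF norm_triangle_ineq], unfold norm_mult norm_of_real, intro add_mono mult_mono)
        show "norm (S (M u)) \<le> exp u" by (rule order.trans[OF S_le M_le])
        have "\<bar>real (M u) - real (M v)\<bar> \<le> \<bar>exp u - exp v\<bar> + 1"
          using M_le[of u] M_le[of v] M_less[of "Suc (M u)" u] M_less[of "Suc (M v)" v] by simp
        then show "norm (S (M u) - S (M v)) \<le> \<bar>exp u - exp v\<bar> + 1"
          by (rule order.trans[OF S_diff])
      qed auto
      also have "exp u * \<bar>exp (-u) - exp (-v)\<bar> = \<bar>exp (u - v) - 1\<bar>"
      proof -
        have "exp u * \<bar>exp (-u) - exp (-v)\<bar> = \<bar>exp u * (exp (-u) - exp (-v))\<bar>" by (simp add: abs_mult)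
        also have "exp u * (exp (-u) - exp (-v)) = 1 - exp (u - v)"
          by (simp add: right_diff_distrib flip: exp_add)
        finally show ?thesis by (simp add: abs_minus_commute)
      qed
      also have "(\<bar>exp u - exp v\<bar> + 1) * exp (-v) = \<bar>exp (u - v) - 1\<bar> + exp (-v)"
      proof -
        have "\<bar>exp u - exp v\<bar> * exp (-v) = \<bar>(exp u - exp v) * exp (-v)\<bar>" by (simp add: abs_mult)
        also have "(exp u - exp v) * exp (-v) = exp (u - v) - 1" by (simp add: exp_diff exp_minus field_simps)
        finally show ?thesis by (simp add: distrib_right)
      qed
      also have "\<bar>exp (u - v) - 1\<bar> + (\<bar>exp (u - v) - 1\<bar> + exp (-v)) \<le> e / 4 + (e / 4 + e / 2)"
      proof (intro add_mono)
        show "\<bar>exp (u - v) - 1\<bar> \<le> e / 4" using dd[of "u - v"] u d by simp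
        then show "\<bar>exp (u - v) - 1\<bar> \<le> e / 4" .
        have "exp (ln (2 / e)) \<le> exp v" using v by (simp only: exp_le_cancel_iff)
        then have "2 / e \<le> exp v" using e by simp
        then show "exp (- v) \<le> e / 2" using e by (simp add: exp_minus field_simps)
      qed
      finally show ?thesis by simp
    qed
    then show "\<exists>d>0. \<exists>v0. \<forall>v\<ge>v0. \<forall>u. \<bar>u - v\<bar> \<le> d \<longrightarrow> norm (g u - g v) \<le> e"
      using d by (intro exI[of _ "d/2"]) auto
  qed
  moreover have "filterlim (\<lambda>N. ln (real (Suc N))) at_top sequentially"
    by (rule filterlim_compose[OF ln_at_top]) (rule filterlim_compose[OF filterlim_real_sequentially filterlim_Suc])
  ultimately have "(\<lambda>N. g (ln (real (Suc N)))) \<longlonglongrightarrow> 0"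
    by (rule filterlim_compose)
  moreover have "g (ln (real (Suc N))) = S N / of_nat (Suc N)" for N
    by (simp add: g_def M_def exp_minus exp_of_real del: of_nat_Suc) (simp add: exp_of_real divide_inverse)
  ultimately have "(\<lambda>N. S N / of_nat (Suc N)) \<longlonglongrightarrow> 0" by simp
  moreover have "(\<lambda>N. of_nat (Suc N) / of_nat N :: complex) \<longlonglongrightarrow> 1"
    by (rule LIMSEQ_Suc_n_over_n)
  ultimately have "(\<lambda>N. S N / of_nat (Suc N) * (of_nat (Suc N) / of_nat N)) \<longlonglongrightarrow> 0 * 1"
    by (rule tendsto_mult)
  then show ?thesis by (simp add: S_def del: of_nat_Suc)
qed

section \<open>Dirichlet series\<close>

lemma bij_betw_Suc_pos: "bij_betw Suc UNIV {0<..}"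
  unfolding bij_betw_def greaterThan_0 by simp

text \<open>An absolutely convergent double sum over pairs \<open>(m, n)\<close>, collected by the product \<open>m n\<close>.\<close>

lemma has_sum_divisor_pairs:
  fixes F :: "nat \<times> nat \<Rightarrow> complex"
  assumes "(F has_sum S) ({0<..} \<times> {0<..})"
  shows "(\<lambda>n. \<Sum>d | d dvd Suc n. F (d, Suc n div d)) sums S"
proof -
  have "((\<lambda>(k, d). F (d, k div d)) has_sum S) (SIGMA k:{0<..}. {d. d dvd k})"
    by (rule iffD1[OF has_sum_reindex_bij_witness[where i = "\<lambda>(k, d). (d, k div d)" and j = "\<lambda>(m, n). (m * n, m)"] assms])
       (auto intro: Nat.gr0I)
  then have "((\<lambda>k. \<Sum>d | d dvd k. F (d, k div d)) has_sum S) {0<..}"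
  proof (rule has_sum_SigmaD)
    show "((\<lambda>d. case (k, d) of (k, d) \<Rightarrow> F (d, k div d)) has_sum (\<Sum>d | d dvd k. F (d, k div d))) {d. d dvd k}"
      if "k \<in> {0<..}" for k
      using has_sum_finite[of "{d. d dvd k}" "\<lambda>d. F (d, k div d)"] that by simp
  qed
  then have "((\<lambda>n. \<Sum>d | d dvd Suc n. F (d, Suc n div d)) has_sum S) UNIV"
    by (rule iffD2[OF has_sum_reindex_bij_betw[OF bij_betw_Suc_pos]])
  then show ?thesis by (rule has_sum_imp_sums)
qed

lemma has_sum_prod_pairs:
  fixes x y :: "nat \<Rightarrow> complex"
  assumes "summable (\<lambda>n. norm (x (Suc n)))" "summable (\<lambda>n. norm (y (Suc n)))"
  shows "((\<lambda>(m, n). x m * y n) has_sum ((\<Sum>n. x (Suc n)) * (\<Sum>n. y (Suc n)))) ({0<..} \<times> {0<..})"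
proof -
  have pos: "(f has_sum S) {0<..} \<longleftrightarrow> ((\<lambda>n. f (Suc n)) has_sum S) UNIV" for f :: "nat \<Rightarrow> 'b::{comm_monoid_add,topological_space}" and S
    by (rule has_sum_reindex_bij_betw[OF bij_betw_Suc_pos, symmetric])
  have X: "(x has_sum (\<Sum>n. x (Suc n))) {0<..}" and Y: "(y has_sum (\<Sum>n. y (Suc n))) {0<..}"
    unfolding pos
    by (rule norm_summable_imp_has_sum[OF assms(1) summable_sums[OF summable_norm_cancel[OF assms(1)]]],
        rule norm_summable_imp_has_sum[OF assms(2) summable_sums[OF summable_norm_cancel[OF assms(2)]]])
  have abs_pos: "(\<lambda>n. norm (f n)) summable_on {0<..}" if t: "summable (\<lambda>n. norm (f (Suc n)))" for f :: "nat \<Rightarrow> complex"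
  proof -
    have a: "summable (\<lambda>n. norm (norm (f (Suc n))))" using t by simp
    have b: "((\<lambda>n. norm (f (Suc n))) has_sum (\<Sum>n. norm (f (Suc n)))) UNIV"
      by (rule norm_summable_imp_has_sum[OF a summable_sums[OF t]])
    have "((\<lambda>n. norm (f n)) has_sum (\<Sum>n. norm (f (Suc n)))) {0<..}"
      using b by (simp only: pos)
    then show ?thesis by (rule has_sum_imp_summable)
  qed
  have "(\<lambda>z. norm (case z of (m, n) \<Rightarrow> x m * y n)) summable_on ({0<..} \<times> {0<..})"
    unfolding Infinite_Sum.abs_summable_on_Sigma_iff
  proof (intro conjI ballI)
    show "(\<lambda>n. norm (case (m, n) of (m, n) \<Rightarrow> x m * y n)) summable_on {0<..}" for m
      using summable_on_cmult_right[OF abs_pos[OF assms(2)], of "norm (x m)"] by (simp add: norm_mult)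
    have "(\<lambda>m. norm (x m) * (\<Sum>\<^sub>\<infinity>n\<in>{0<..}. norm (y n))) summable_on {0<..}"
      by (rule summable_on_cmult_left[OF abs_pos[OF assms(1)]])
    moreover have "(\<Sum>\<^sub>\<infinity>n\<in>{0<..}. norm (y n)) \<ge> 0" by (rule infsum_nonneg) auto
    ultimately show "(\<lambda>m. norm (\<Sum>\<^sub>\<infinity>n\<in>{0<..}. norm (case (m, n) of (m, n) \<Rightarrow> x m * y n))) summable_on {0<..}"
      by (simp add: norm_mult infsum_cmult_right')
  qed
  then have "(\<lambda>(m, n). x m * y n) summable_on ({0<..} \<times> {0<..})"
    by (rule abs_summable_summable)
  then obtain S where S: "((\<lambda>(m, n). x m * y n) has_sum S) ({0<..} \<times> {0<..})"
    by (auto simp: summable_on_def)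
  then have "((\<lambda>m. x m * (\<Sum>n. y (Suc n))) has_sum S) {0<..}"
    by (rule has_sum_SigmaD) (simp add: has_sum_cmult_right[OF Y])
  with has_sum_cmult_left[OF X] have "S = (\<Sum>n. x (Suc n)) * (\<Sum>n. y (Suc n))"
    using has_sum_unique by blast
  with S show ?thesis by simp
qed

definition dseries :: "(nat \<Rightarrow> complex) \<Rightarrow> complex \<Rightarrow> complex"
  where "dseries a s = (\<Sum>n. a (Suc n) * of_nat (Suc n) powr (- s))"

lemma norm_nat_powr: "norm (of_nat (Suc n) powr z :: complex) = real (Suc n) powr Re z"
  by (subst norm_powr_real_powr) auto

lemma nat_powr_mult: "(of_nat (m * n) powr z :: complex) = of_nat m powr z * of_nat n powr z"
  using powr_times_real[of "of_nat m" "of_nat n" z] by simp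

text \<open>Absolute convergence of the Dirichlet series; only the real part of \<open>s\<close> matters.\<close>

definition dsummable :: "(nat \<Rightarrow> complex) \<Rightarrow> complex \<Rightarrow> bool"
  where "dsummable a s \<longleftrightarrow> summable (\<lambda>n. norm (a (Suc n)) * real (Suc n) powr (- Re s))"

lemma dsummable_norm: "dsummable a s \<Longrightarrow> summable (\<lambda>n. norm (a (Suc n) * of_nat (Suc n) powr (- s)))"
  by (simp add: dsummable_def norm_mult norm_nat_powr del: of_nat_Suc)

lemma dseries_sums: "dsummable a s \<Longrightarrow> (\<lambda>n. a (Suc n) * of_nat (Suc n) powr (- s)) sums dseries a s"
  unfolding dseries_def by (rule summable_sums[OF summable_norm_cancel[OF dsummable_norm]])

lemma dseries_mult:
  assumes "dsummable a s" "dsummable b s"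
  shows "(\<lambda>n. (\<Sum>d | d dvd Suc n. a d * b (Suc n div d)) * of_nat (Suc n) powr (- s)) sums (dseries a s * dseries b s)"
proof -
  have "(\<lambda>n. \<Sum>d | d dvd Suc n. (a d * of_nat d powr (- s)) * (b (Suc n div d) * of_nat (Suc n div d) powr (- s)))
      sums (dseries a s * dseries b s)"
    using has_sum_divisor_pairs[OF has_sum_prod_pairs[where x = "\<lambda>n. a n * of_nat n powr (- s)" and y = "\<lambda>n. b n * of_nat n powr (- s)",
        OF dsummable_norm[OF assms(1)] dsummable_norm[OF assms(2)]]]
    by (simp add: dseries_def)
  also have "(\<lambda>n. \<Sum>d | d dvd Suc n. (a d * of_nat d powr (- s)) * (b (Suc n div d) * of_nat (Suc n div d) powr (- s)))
      = (\<lambda>n. (\<Sum>d | d dvd Suc n. a d * b (Suc n div d)) * of_nat (Suc n) powr (- s))"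
  proof
    fix n
    have "of_nat d powr (- s) * of_nat (Suc n div d) powr (- s) = (of_nat (Suc n) powr (- s) :: complex)" if "d dvd Suc n" for d
      using that nat_powr_mult[of d "Suc n div d" "- s"] by simp
    then show "(\<Sum>d | d dvd Suc n. (a d * of_nat d powr (- s)) * (b (Suc n div d) * of_nat (Suc n div d) powr (- s)))
        = (\<Sum>d | d dvd Suc n. a d * b (Suc n div d)) * of_nat (Suc n) powr (- s)"
      unfolding sum_distrib_right by (intro sum.cong) (auto simp: mult_ac simp del: of_nat_Suc)
  qed
  finally show ?thesis .
qed

lemma dsummable_bounded:
  fixes a :: "nat \<Rightarrow> complex"
  assumes "\<And>n. norm (a n) \<le> 1" "1 < Re s"
  shows "dsummable a s"
  unfolding dsummable_def
proof (rule summable_comparison_test')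
  show "summable (\<lambda>n. real (Suc n) powr (- Re s))"
    using assms(2) summable_Suc_iff[of "\<lambda>n. real n powr (- Re s)"] by (simp add: summable_real_powr_iff del: of_nat_Suc)
  show "norm (norm (a (Suc n)) * real (Suc n) powr (- Re s)) \<le> real (Suc n) powr (- Re s)" for n
    using assms(1) by (simp add: mult_left_le_one_le del: of_nat_Suc)
qed

lemma dseries_has_derivative:
  fixes a :: "nat \<Rightarrow> complex"
  assumes a: "\<And>n. norm (a n) \<le> 1" and s: "1 < Re s"
  shows "(dseries a has_field_derivative (- dseries (\<lambda>n. ln (real n) * a n) s)) (at s)"
    and "dsummable (\<lambda>n. ln (real n) * a n) s"
proof -
  have key: "\<exists>D. (\<lambda>n. - (of_real (ln (real (Suc n))) * a (Suc n)) * of_nat (Suc n) powr (- s)) sums D \<and> (dseries a has_field_derivative D) (at s)"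
    if a: "\<And>n. norm (a n) \<le> 1" and s: "1 < Re s" for a :: "nat \<Rightarrow> complex" and s
  proof -
    define r where "r = (1 + Re s) / 2"
    have r: "1 < r" "r < Re s" using s by (auto simp: r_def)
    have op: "open {s. r < Re s}" by (rule open_halfspace_Re_gt)
    have summ: "summable (\<lambda>n. real (Suc n) powr (- r))"
      using r summable_Suc_iff[of "\<lambda>n. real n powr (- r)"] by (simp add: summable_real_powr_iff del: of_nat_Suc)
    have der: "((\<lambda>s. a (Suc n) * of_nat (Suc n) powr (- s)) has_field_derivative
        - (of_real (ln (real (Suc n))) * a (Suc n)) * of_nat (Suc n) powr (- z)) (at z)" for n z
    proof -
      have "((\<lambda>s. of_nat (Suc n) powr (- s) :: complex) has_field_derivative
          (Ln (of_nat (Suc n)) * of_nat (Suc n) powr (- z)) * (- 1)) (at z)"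
        by (rule DERIV_chain2[OF has_field_derivative_powr_right])
           (auto intro!: derivative_eq_intros simp del: of_nat_Suc)
      from DERIV_cmult[OF this, of "a (Suc n)"] show ?thesis
        by (simp add: Ln_of_nat mult_ac del: of_nat_Suc)
    qed
    have bnd: "\<forall>\<^sub>F n in sequentially. \<forall>z\<in>{s. r < Re s}. norm (a (Suc n) * of_nat (Suc n) powr (- z)) \<le> real (Suc n) powr (- r)"
    proof (intro always_eventually allI ballI)
      fix n z assume "z \<in> {s. r < Re s}"
      then have "norm (a (Suc n)) * real (Suc n) powr (- Re z) \<le> 1 * real (Suc n) powr (- r)"
        by (intro mult_mono a powr_mono) auto
      then show "norm (a (Suc n) * of_nat (Suc n) powr (- z)) \<le> real (Suc n) powr (- r)"
        by (simp add: norm_mult norm_nat_powr del: of_nat_Suc)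
    qed
    obtain g g' where g: "\<forall>x\<in>{s. r < Re s}. (\<lambda>n. a (Suc n) * of_nat (Suc n) powr (- x)) sums g x \<and>
        (\<lambda>n. - (of_real (ln (real (Suc n))) * a (Suc n)) * of_nat (Suc n) powr (- x)) sums g' x \<and> (g has_field_derivative g' x) (at x)"
      by (rule series_and_derivative_comparison[OF op summ der bnd])
    have "(dseries a has_field_derivative g' s) (at s)"
    proof (rule has_field_derivative_transform_within_open[of g _ _ "{s. r < Re s}"])
      show "g x = dseries a x" if "x \<in> {s. r < Re s}" for x
        using g that by (simp add: dseries_def sums_iff)
    qed (use g r op in auto)
    then show ?thesis using g r by blast
  qed
  have "summable (\<lambda>n. ln (real (Suc n)) * real (Suc n) powr (- Re s))"
  proof -
    from key[of "\<lambda>_. 1" "of_real (Re s)"] s obtain D where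
      "(\<lambda>n. - (of_real (ln (real (Suc n)))) * of_nat (Suc n) powr (- of_real (Re s))) sums (D :: complex)" by auto
    from sums_Re[OF sums_minus[OF this]]
    have "(\<lambda>n. Re (of_real (ln (real (Suc n))) * of_nat (Suc n) powr (- of_real (Re s)))) sums Re (- D)" by simp
    moreover have "of_real (ln (real (Suc n))) * of_nat (Suc n) powr (- of_real (Re s)) = (of_real (ln (real (Suc n)) * real (Suc n) powr (- Re s)) :: complex)" for n
      using powr_of_real[of "real (Suc n)" "- Re s"] by simp
    ultimately show ?thesis by (simp add: sums_iff del: of_nat_Suc)
  qed
  note S = this
  have bnd: "norm (norm (of_real (ln (real (Suc n))) * a (Suc n)) * real (Suc n) powr (- Re s)) \<le> ln (real (Suc n)) * real (Suc n) powr (- Re s)" for n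
  proof -
    have ln0: "0 \<le> ln (real (Suc n))" by simp
    have "ln (real (Suc n)) * norm (a (Suc n)) * real (Suc n) powr (- Re s) \<le> ln (real (Suc n)) * 1 * real (Suc n) powr (- Re s)"
      by (intro mult_right_mono mult_left_mono a) auto
    then show ?thesis
      by (simp add: norm_mult abs_mult abs_of_nonneg[OF ln0] del: of_nat_Suc)
  qed
  have ln_summ: "dsummable (\<lambda>n. of_real (ln (real n)) * a n) s"
    unfolding dsummable_def by (rule summable_comparison_test'[OF S, of 0]) (rule bnd)
  then show "dsummable (\<lambda>n. ln (real n) * a n) s" .
  from sums_minus[OF dseries_sums[OF ln_summ]]
  have "(\<lambda>n. - (of_real (ln (real (Suc n))) * a (Suc n)) * of_nat (Suc n) powr (- s)) sums (- dseries (\<lambda>n. ln (real n) * a n) s)"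
    by (simp only: mult_minus_left)
  note 1 = this
  obtain D where 2: "(\<lambda>n. - (of_real (ln (real (Suc n))) * a (Suc n)) * of_nat (Suc n) powr (- s)) sums D"
    and D: "(dseries a has_field_derivative D) (at s)"
    using key[of a s, OF a s] by (elim exE conjE)
  have "D = - dseries (\<lambda>n. ln (real n) * a n) s" by (rule sums_unique2[OF 2 1])
  with D show "(dseries a has_field_derivative (- dseries (\<lambda>n. ln (real n) * a n) s)) (at s)" by simp
qed

section \<open>Continuation to the right half-plane\<close>

text \<open>The form of the Weierstrass test that fits series whose terms are differences of powers \<open>n\<^bsup>-s\<^esup>\<close>: such a difference gains
a factor \<open>1/n\<close> at the cost of a factor that is bounded on bounded sets.\<close>

lemma holomorphic_series_halfplane:
  fixes f :: "nat \<Rightarrow> complex \<Rightarrow> complex"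
  assumes holo: "\<And>n. f n holomorphic_on {s. 0 < Re s}"
    and bnd: "\<And>n s. 0 < Re s \<Longrightarrow> norm (f n s) \<le> C s * real (Suc n) powr (- Re s - 1)"
    and C: "\<And>s R. norm s \<le> R \<Longrightarrow> C s \<le> C' R" and C': "\<And>R. 0 \<le> C' R"
  shows "\<And>s. 0 < Re s \<Longrightarrow> (\<lambda>n. f n s) sums (\<Sum>n. f n s)"
    and "(\<lambda>s. \<Sum>n. f n s) holomorphic_on {s. 0 < Re s}"
proof -
  have op0: "open {s. 0 < Re s}" by (rule open_halfspace_Re_gt)
  have key: "\<exists>D. (\<lambda>n. f n s) sums (\<Sum>n. f n s) \<and> ((\<lambda>s. \<Sum>n. f n s) has_field_derivative D) (at s)" if s: "0 < Re s" for s
  proof -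
    define e where "e = Re s / 2"
    define R where "R = norm s + 1"
    define S where "S = {z. e < Re z} \<inter> ball 0 R"
    have e: "0 < e" "e < Re s" using s by (auto simp: e_def)
    have S: "open S" "s \<in> S" "S \<subseteq> {s. 0 < Re s}"
      unfolding S_def using e by (auto intro: open_halfspace_Re_gt simp: R_def)
    have "summable (\<lambda>n. real (Suc n) powr (- e - 1))"
      using e summable_Suc_iff[of "\<lambda>n. real n powr (- e - 1)"] by (simp add: summable_real_powr_iff del: of_nat_Suc)
    then have summ: "summable (\<lambda>n. C' R * real (Suc n) powr (- e - 1))" by (rule summable_mult)
    have der: "(f n has_field_derivative deriv (f n) z) (at z)" if "z \<in> S" for n z
      using holomorphic_derivI[OF holo op0] S that by blast
    have bd: "\<forall>\<^sub>F n in sequentially. \<forall>z\<in>S. norm (f n z) \<le> C' R * real (Suc n) powr (- e - 1)"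
    proof (intro always_eventually allI ballI)
      fix n z assume z: "z \<in> S"
      then have "0 < Re z" using S by auto
      from bnd[OF this, of n] have "norm (f n z) \<le> C z * real (Suc n) powr (- Re z - 1)" .
      also have "\<dots> \<le> C' R * real (Suc n) powr (- Re z - 1)"
        using z by (intro mult_right_mono C) (auto simp: S_def)
      also have "\<dots> \<le> C' R * real (Suc n) powr (- e - 1)"
        using z by (intro mult_left_mono powr_mono C') (auto simp: S_def)
      finally show "norm (f n z) \<le> C' R * real (Suc n) powr (- e - 1)" .
    qed
    obtain g g' where g: "\<forall>x\<in>S. (\<lambda>n. f n x) sums g x \<and> (\<lambda>n. deriv (f n) x) sums g' x \<and> (g has_field_derivative g' x) (at x)"
      by (rule series_and_derivative_comparison[OF S(1) summ der bd])
    have eq: "g x = (\<Sum>n. f n x)" if "x \<in> S" for x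
      using g that by (simp add: sums_iff)
    have "((\<lambda>s. \<Sum>n. f n s) has_field_derivative g' s) (at s)"
      by (rule has_field_derivative_transform_within_open[of g _ _ S]) (use g S eq in auto)
    then show ?thesis using g S eq by metis
  qed
  show "(\<lambda>n. f n s) sums (\<Sum>n. f n s)" if "0 < Re s" for s using key[OF that] by blast
  show "(\<lambda>s. \<Sum>n. f n s) holomorphic_on {s. 0 < Re s}"
    unfolding holomorphic_on_open[OF op0] using key by blast
qed

lemma convex_segment_nat:
  fixes n :: nat
  assumes "z \<in> closed_segment (complex_of_real (real (Suc n))) (of_real (real (Suc (Suc n))))"
  shows "z \<in> \<real>" "real (Suc n) \<le> Re z" "z \<notin> \<real>\<^sub>\<le>\<^sub>0"
proof -
  have "z \<in> of_real ` closed_segment (real (Suc n)) (real (Suc (Suc n)))"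
    using assms unfolding closed_segment_of_real .
  then obtain x where "z = of_real x" "real (Suc n) \<le> x"
    by (auto simp: closed_segment_eq_real_ivl simp del: of_nat_Suc)
  then show "z \<in> \<real>" "real (Suc n) \<le> Re z" "z \<notin> \<real>\<^sub>\<le>\<^sub>0"
    by (auto simp: complex_nonpos_Reals_iff)
qed

lemma norm_powr_segment_le:
  assumes "z \<in> closed_segment (complex_of_real (real (Suc n))) (of_real (real (Suc (Suc n))))" "0 < Re s"
  shows "norm (z powr (- s - 1)) \<le> real (Suc n) powr (- Re s - 1)"
proof -
  have "norm (z powr (- s - 1)) = Re z powr (- Re s - 1)"
    using convex_segment_nat[OF assms(1)] by (subst norm_powr_real_powr) auto
  also have "\<dots> \<le> real (Suc n) powr (- Re s - 1)"
    using convex_segment_nat[OF assms(1)] assms(2) by (intro powr_mono2') auto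
  finally show ?thesis .
qed

lemma powr_diff_bound:
  assumes s: "0 < Re s" and z: "z \<in> closed_segment (complex_of_real (real (Suc n))) (of_real (real (Suc (Suc n))))"
  shows "norm (z powr (- s) - of_nat (Suc n) powr (- s)) \<le> norm s * real (Suc n) powr (- Re s - 1)"
proof -
  let ?S = "closed_segment (complex_of_real (real (Suc n))) (of_real (real (Suc (Suc n))))"
  have "norm (z powr (- s) - complex_of_real (real (Suc n)) powr (- s))
      \<le> norm s * real (Suc n) powr (- Re s - 1) * norm (z - complex_of_real (real (Suc n)))"
  proof (rule field_differentiable_bound[where S = ?S and f' = "\<lambda>z. - s * z powr (- s - 1)"])
    show "((\<lambda>z. z powr - s) has_field_derivative - s * w powr (- s - 1)) (at w within ?S)" if "w \<in> ?S" for w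
      using convex_segment_nat(3)[OF that] by (rule has_field_derivative_at_within[OF has_field_derivative_powr])
    show "norm (- s * w powr (- s - 1)) \<le> norm s * real (Suc n) powr (- Re s - 1)" if "w \<in> ?S" for w
      unfolding norm_mult norm_minus_cancel by (intro mult_left_mono norm_powr_segment_le[OF that s]) simp
  qed (use z in auto)
  also have "\<dots> \<le> norm s * real (Suc n) powr (- Re s - 1) * 1"
  proof (intro mult_left_mono)
    have "norm (z - complex_of_real (real (Suc n))) \<le> norm (complex_of_real (real (Suc (Suc n))) - complex_of_real (real (Suc n)))"
      using segment_bound1[OF z] .
    then show "norm (z - complex_of_real (real (Suc n))) \<le> 1"
      unfolding of_real_diff[symmetric] by simp
  qed simp
  finally show ?thesis by simp
qed

definition zeta_term :: "nat \<Rightarrow> complex \<Rightarrow> complex"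
  where "zeta_term n s = (s - 1) * of_nat (Suc n) powr (- s) + of_nat (Suc (Suc n)) powr (1 - s) - of_nat (Suc n) powr (1 - s)"

text \<open>The entire factor \<open>(s - 1) \<zeta>(s)\<close>, restricted to \<open>Re s > 0\<close>.  The factor \<open>s - 1\<close> is built into the terms, so that no
removable singularity at \<open>s = 1\<close> occurs; for \<open>Re s > 1\<close> the second and third part of the terms telescope to \<open>-1\<close>.\<close>

definition zeta_num :: "complex \<Rightarrow> complex"
  where "zeta_num s = 1 + (\<Sum>n. zeta_term n s)"

text \<open>The term is the error of the linear approximation of \<open>x\<^bsup>1-s\<^esup>\<close> at \<open>n + 1\<close> over a unit interval, so it is controlled by
the second derivative.\<close>

lemma zeta_term_bound:
  assumes s: "0 < Re s"
  shows "norm (zeta_term n s) \<le> norm (s - 1) * norm s * real (Suc n) powr (- Re s - 1)"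
proof -
  let ?S = "closed_segment (complex_of_real (real (Suc n))) (of_real (real (Suc (Suc n))))"
  define F where "F z = z powr (1 - s) - (1 - s) * of_nat (Suc n) powr (- s) * z" for z
  have "norm (F (of_real (real (Suc (Suc n)))) - F (of_real (real (Suc n))))
     \<le> norm (s - 1) * norm s * real (Suc n) powr (- Re s - 1) * norm (complex_of_real (real (Suc (Suc n))) - of_real (real (Suc n)))"
  proof (rule field_differentiable_bound[where S = ?S and f' = "\<lambda>z. (1 - s) * (z powr (- s) - of_nat (Suc n) powr (- s))"])
    fix w assume w: "w \<in> ?S"
    have "((\<lambda>z. z powr (1 - s)) has_field_derivative (1 - s) * w powr (1 - s - 1)) (at w within ?S)"
      using convex_segment_nat(3)[OF w] by (rule has_field_derivative_at_within[OF has_field_derivative_powr])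
    then have "(F has_field_derivative (1 - s) * w powr (1 - s - 1) - (1 - s) * of_nat (Suc n) powr (- s) * 1) (at w within ?S)"
      unfolding F_def by (intro DERIV_diff DERIV_cmult DERIV_ident)
    then show "(F has_field_derivative (1 - s) * (w powr (- s) - of_nat (Suc n) powr (- s))) (at w within ?S)"
      by (simp add: right_diff_distrib del: of_nat_Suc)
    have "norm ((1 - s) * (w powr (- s) - of_nat (Suc n) powr (- s))) \<le> norm (1 - s) * (norm s * real (Suc n) powr (- Re s - 1))"
      unfolding norm_mult by (intro mult_left_mono powr_diff_bound[OF s w]) simp
    then show "norm ((1 - s) * (w powr (- s) - of_nat (Suc n) powr (- s))) \<le> norm (s - 1) * norm s * real (Suc n) powr (- Re s - 1)"
      by (simp add: norm_minus_commute mult.assoc del: of_nat_Suc)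
  qed auto
  moreover have "norm (complex_of_real (real (Suc (Suc n))) - of_real (real (Suc n))) = 1" by simp
  moreover have "F (of_real (real (Suc (Suc n)))) - F (of_real (real (Suc n))) = zeta_term n s"
    by (simp add: F_def zeta_term_def algebra_simps)
  ultimately show ?thesis by simp
qed

lemma holomorphic_nat_powr: "(\<lambda>s. of_nat (Suc n) powr (f s)) holomorphic_on A" if "f holomorphic_on A"
proof -
  have "(of_nat (Suc n) :: complex) \<noteq> 0" by (rule of_nat_neq_0)
  then have "(\<lambda>s. (of_nat (Suc n) :: complex) powr (f s)) = (\<lambda>s. exp (f s * Ln (of_nat (Suc n))))"
    by (simp add: powr_def del: of_nat_Suc)
  then show ?thesis by (simp only:) (intro holomorphic_intros that)
qed

lemma zeta_term_series:
  shows zeta_term_sums: "0 < Re s \<Longrightarrow> (\<lambda>n. zeta_term n s) sums (\<Sum>n. zeta_term n s)"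
    and zeta_num_holomorphic: "zeta_num holomorphic_on {s. 0 < Re s}"
proof -
  have h: "zeta_term n holomorphic_on {s. 0 < Re s}" for n
    unfolding zeta_term_def by (intro holomorphic_intros holomorphic_nat_powr)
  have C: "norm (s - 1) * norm s \<le> (R + 1) * R" if "norm s \<le> R" for s :: complex and R
    using that norm_ge_zero[of s] norm_triangle_ineq4[of s 1, unfolded norm_one] by (intro mult_mono; linarith)
  have C': "0 \<le> (\<bar>R\<bar> + 1) * \<bar>R\<bar>" for R :: real by simp
  have C2: "norm (s - 1) * norm s \<le> (\<bar>R\<bar> + 1) * \<bar>R\<bar>" if "norm s \<le> R" for s :: complex and R
    using C[OF that] order.trans[OF norm_ge_zero that] by simp
  note * = holomorphic_series_halfplane[where f = zeta_term and C = "\<lambda>s. norm (s - 1) * norm s" and C' = "\<lambda>R. (\<bar>R\<bar> + 1) * \<bar>R\<bar>", OF h zeta_term_bound C2 C']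
  show "0 < Re s \<Longrightarrow> (\<lambda>n. zeta_term n s) sums (\<Sum>n. zeta_term n s)" by (rule *(1))
  show "zeta_num holomorphic_on {s. 0 < Re s}"
    unfolding zeta_num_def by (intro holomorphic_intros *(2))
qed

lemma zeta_num_1: "zeta_num 1 = 1"
  by (simp add: zeta_num_def zeta_term_def del: of_nat_Suc)

lemma nat_powr_tendsto_0:
  assumes "Re z < 0"
  shows "(\<lambda>n. of_nat (Suc n) powr z :: complex) \<longlonglongrightarrow> 0"
proof (rule tendsto_norm_zero_cancel)
  have "(\<lambda>n. real n powr Re z) \<longlonglongrightarrow> 0"
    using assms tendsto_neg_powr[of "Re z" real sequentially] filterlim_real_sequentially by auto
  then show "(\<lambda>n. norm (of_nat (Suc n) powr z :: complex)) \<longlonglongrightarrow> 0"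
    unfolding norm_nat_powr by (rule LIMSEQ_Suc)
qed

lemma zeta_num_eq:
  assumes s: "1 < Re s"
  shows "zeta_num s = (s - 1) * dseries (\<lambda>_. 1) s"
proof -
  have "(\<lambda>n. of_nat (Suc n) powr (1 - s) :: complex) \<longlonglongrightarrow> 0"
    using s by (intro nat_powr_tendsto_0) simp
  from telescope_sums[OF this]
  have 1: "(\<lambda>n. of_nat (Suc (Suc n)) powr (1 - s) - of_nat (Suc n) powr (1 - s)) sums (0 - 1 :: complex)"
    by simp
  have "(\<lambda>n. 1 * of_nat (Suc n) powr (- s)) sums dseries (\<lambda>_. 1) s"
    by (rule dseries_sums) (use s in \<open>auto intro: dsummable_bounded\<close>)
  from sums_add[OF sums_mult[OF this, of "s - 1"] 1]
  have "(\<lambda>n. zeta_term n s) sums ((s - 1) * dseries (\<lambda>_. 1) s + (0 - 1))"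
    by (simp add: zeta_term_def add_diff_eq del: of_nat_Suc)
  then show ?thesis by (simp add: zeta_num_def sums_iff)
qed

lemma abel_partial_summation:
  fixes x u :: "nat \<Rightarrow> 'a::comm_ring_1"
  shows "(\<Sum>n<N. x n * u n) = (\<Sum>k<N. x k) * u N + (\<Sum>n<N. (\<Sum>k\<le>n. x k) * (u n - u (Suc n)))"
proof (induction N)
  case (Suc N)
  have "(\<Sum>k\<le>N. x k) = (\<Sum>k<N. x k) + x N" by (simp add: lessThan_Suc_atMost[symmetric])
  with Suc show ?case by (simp add: algebra_simps)
qed simp

text \<open>Summation by parts with bounded partial sums: the transformed series converges absolutely for \<open>Re s > 0\<close>, and there
it is the sum of the original series, which in general converges only conditionally.\<close>

definition abel_series :: "(nat \<Rightarrow> complex) \<Rightarrow> complex \<Rightarrow> complex"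
  where "abel_series x s = (\<Sum>n. (\<Sum>k\<le>n. x (Suc k)) * (of_nat (Suc n) powr (- s) - of_nat (Suc (Suc n)) powr (- s)))"

lemma abel_series:
  fixes x :: "nat \<Rightarrow> complex"
  assumes B: "\<And>n. norm (\<Sum>k\<le>n. x (Suc k)) \<le> B"
  shows abel_series_sums: "0 < Re s \<Longrightarrow> (\<lambda>n. x (Suc n) * of_nat (Suc n) powr (- s)) sums abel_series x s"
    and abel_series_holomorphic: "abel_series x holomorphic_on {s. 0 < Re s}"
proof -
  have B0: "0 \<le> B" using B[of 0] norm_ge_zero order.trans by blast
  define f where "f n s = (\<Sum>k\<le>n. x (Suc k)) * (of_nat (Suc n) powr (- s) - of_nat (Suc (Suc n)) powr (- s))" for n s
  have h: "f n holomorphic_on {s. 0 < Re s}" for n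
    unfolding f_def by (intro holomorphic_intros holomorphic_nat_powr)
  have b: "norm (f n s) \<le> (B * norm s) * real (Suc n) powr (- Re s - 1)" if "0 < Re s" for n s
  proof -
    have "norm (of_nat (Suc (Suc n)) powr (- s) - of_nat (Suc n) powr (- s) :: complex) \<le> norm s * real (Suc n) powr (- Re s - 1)"
      using powr_diff_bound[OF that, of "of_real (real (Suc (Suc n)))" n] by simp
    then have "norm (f n s) \<le> B * (norm s * real (Suc n) powr (- Re s - 1))"
      unfolding f_def norm_mult by (intro mult_mono B B0) (simp_all add: norm_minus_commute del: of_nat_Suc)
    then show ?thesis by (simp add: mult.assoc)
  qed
  have C: "B * norm s \<le> B * \<bar>R\<bar>" if "norm s \<le> R" for s :: complex and R
    using that B0 by (intro mult_left_mono) auto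
  have C': "0 \<le> B * \<bar>R\<bar>" for R using B0 by simp
  note * = holomorphic_series_halfplane[where f = f and C = "\<lambda>s. B * norm s" and C' = "\<lambda>R. B * \<bar>R\<bar>", OF h b C C']
  show "abel_series x holomorphic_on {s. 0 < Re s}"
    unfolding abel_series_def f_def[symmetric] by (rule *(2))
  assume s: "0 < Re s"
  define u where "u n = (of_nat (Suc n) powr (- s) :: complex)" for n
  have u: "u \<longlonglongrightarrow> 0"
    unfolding u_def using s by (intro nat_powr_tendsto_0) simp
  have bdd: "norm (\<Sum>k<N. x (Suc k)) \<le> B" for N
    using B[of "N - 1"] B0 by (cases N) (auto simp: lessThan_Suc_atMost)
  have "(\<lambda>N. (\<Sum>k<N. x (Suc k)) * u N) \<longlonglongrightarrow> 0"
  proof (rule Lim_null_comparison)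
    show "\<forall>\<^sub>F N in sequentially. norm ((\<Sum>k<N. x (Suc k)) * u N) \<le> B * norm (u N)"
      by (intro always_eventually allI) (simp add: norm_mult mult_right_mono bdd)
    show "(\<lambda>N. B * norm (u N)) \<longlonglongrightarrow> 0"
      using tendsto_mult_right_zero[OF tendsto_norm_zero[OF u]] .
  qed
  moreover have "(\<lambda>N. \<Sum>n<N. f n s) \<longlonglongrightarrow> abel_series x s"
    unfolding abel_series_def f_def[symmetric] sums_def[symmetric] by (rule *(1)) (use s in auto)
  ultimately have "(\<lambda>N. (\<Sum>k<N. x (Suc k)) * u N + (\<Sum>n<N. f n s)) \<longlonglongrightarrow> 0 + abel_series x s"
    by (rule tendsto_add)
  moreover have "(\<Sum>k<N. x (Suc k)) * u N + (\<Sum>n<N. f n s) = (\<Sum>n<N. x (Suc n) * u n)" for N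
    using abel_partial_summation[of "\<lambda>n. x (Suc n)" u N] by (simp add: f_def u_def del: of_nat_Suc)
  ultimately show "(\<lambda>n. x (Suc n) * of_nat (Suc n) powr (- s)) sums abel_series x s"
    by (simp add: sums_def u_def del: of_nat_Suc)
qed

text \<open>Complete periods contribute nothing.\<close>

lemma periodic_partial_sum_bound:
  fixes x :: "nat \<Rightarrow> complex"
  assumes per: "\<And>n. x (n + d) = x n" and d: "0 < d" and zero: "(\<Sum>n<d. x n) = 0"
  shows "norm (\<Sum>n<N. x n) \<le> (\<Sum>n<d. norm (x n))"
proof -
  have "(\<Sum>n<N. x n) = (\<Sum>n<N mod d. x n)"
  proof (induction N rule: less_induct)
    case (less N)
    show ?case
    proof (cases "N < d")
      case False
      then have N: "N = d + (N - d)" by simp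
      have "(\<Sum>n<N. x n) = (\<Sum>n<d. x n) + (\<Sum>n<N - d. x (n + d))"
      proof -
        have "(\<Sum>n<N. x n) = (\<Sum>n\<in>{..<d} \<union> {d..<d + (N - d)}. x n)"
          using N by (intro sum.cong) auto
        also have "\<dots> = (\<Sum>n<d. x n) + (\<Sum>n\<in>{d..<d + (N - d)}. x n)"
          by (intro sum.union_disjoint) auto
        also have "(\<Sum>n\<in>{d..<d + (N - d)}. x n) = (\<Sum>n<N - d. x (n + d))"
          using sum.shift_bounds_nat_ivl[of x 0 d "N - d"] by (simp add: atLeast0LessThan add.commute)
        finally show ?thesis .
      qed
      also have "\<dots> = (\<Sum>n<N - d. x n)" using per zero by simp
      also have "\<dots> = (\<Sum>n<(N - d) mod d. x n)" using less[of "N - d"] False d by simp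
      also have "(N - d) mod d = N mod d" using False by (metis le_mod_geq leI)
      finally show ?thesis .
    qed simp
  qed
  also have "norm \<dots> \<le> (\<Sum>n<N mod d. norm (x n))" by (rule norm_sum)
  also have "\<dots> \<le> (\<Sum>n<d. norm (x n))"
    using d by (intro sum_mono2) (auto intro: less_trans[OF _ mod_less_divisor])
  finally show ?thesis .
qed

section \<open>Real characters at the point 1\<close>

lemma sum_divisors_prime_power_mult:
  fixes g :: "nat \<Rightarrow> 'a::comm_semiring_1"
  assumes mult: "\<And>m n. g (m * n) = g m * g n" and p: "prime p" "\<not> p dvd m" and m: "0 < m"
    and g1: "g (Suc 0) = 1"
  shows "(\<Sum>e | e dvd p ^ k * m. g e) = (\<Sum>i\<le>k. g p ^ i) * (\<Sum>e | e dvd m. g e)"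
proof -
  have pw: "g (p ^ i) = g p ^ i" for i by (induction i) (simp_all add: g1 mult)
  have cop: "coprime p e" if "e dvd m" for e
    using p that by (meson dvd_trans prime_imp_coprime)
  have p0: "0 < p" using p(1) by (rule prime_gt_0_nat)
  have inj: "inj_on (\<lambda>(i, e). p ^ i * e) ({..k} \<times> {e. e dvd m})"
  proof (rule inj_onI, clarify)
    fix i e j f assume e: "e dvd m" and f: "f dvd m" and eq: "p ^ i * e = p ^ j * f"
    have "p ^ i dvd p ^ j * f" "p ^ j dvd p ^ i * e" using eq by (metis dvd_triv_left)+
    moreover have "coprime (p ^ i) f" "coprime (p ^ j) e" using cop e f by auto
    ultimately have "p ^ i dvd p ^ j" "p ^ j dvd p ^ i"
      by (simp_all add: coprime_dvd_mult_left_iff)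
    then have "p ^ i = p ^ j" by (rule dvd_antisym)
    then have "i = j" using prime_gt_1_nat[OF p(1)] by simp
    with eq p0 show "i = j \<and> e = f" by simp
  qed
  have img: "{e. e dvd p ^ k * m} = (\<lambda>(i, e). p ^ i * e) ` ({..k} \<times> {e. e dvd m})"
  proof
    show "{e. e dvd p ^ k * m} \<subseteq> (\<lambda>(i, e). p ^ i * e) ` ({..k} \<times> {e. e dvd m})"
    proof
      fix d assume "d \<in> {e. e dvd p ^ k * m}"
      then obtain b c where d: "d = b * c" "b dvd p ^ k" "c dvd m" using division_decomp[of d "p ^ k" m] by auto
      then obtain i where "i \<le> k" "b = p ^ i" using divides_primepow_nat[OF p(1)] by auto
      with d show "d \<in> (\<lambda>(i, e). p ^ i * e) ` ({..k} \<times> {e. e dvd m})" by (intro image_eqI[of _ _ "(i, c)"]) auto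
    qed
  qed (auto intro!: mult_dvd_mono le_imp_power_dvd)
  have "(\<Sum>e | e dvd p ^ k * m. g e) = (\<Sum>(i, e)\<in>{..k} \<times> {e. e dvd m}. g (p ^ i * e))"
    unfolding img by (subst sum.reindex[OF inj]) (simp add: case_prod_unfold)
  also have "\<dots> = (\<Sum>(i, e)\<in>{..k} \<times> {e. e dvd m}. g p ^ i * g e)"
    by (simp add: mult pw)
  also have "\<dots> = (\<Sum>i\<le>k. g p ^ i) * (\<Sum>e | e dvd m. g e)"
    by (simp add: sum_product sum.cartesian_product)
  finally show ?thesis .
qed

text \<open>The divisor sum is multiplicative, and at \<open>p\<^sup>k\<close> it is \<open>\<Sum>i\<le>k. g(p)\<^sup>i\<close>, which is nonnegative for \<open>g(p) \<in> {-1, 0, 1}\<close>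
and at least 1 for even \<open>k\<close>.\<close>

lemma real_character_divisor_sum:
  fixes g :: "nat \<Rightarrow> real"
  assumes mult: "\<And>m n. g (m * n) = g m * g n" and g1: "g (Suc 0) = 1" and vals: "\<And>n. g n \<in> {-1, 0, 1}" and l: "0 < l"
  shows "0 \<le> (\<Sum>e | e dvd l. g e) \<and> 1 \<le> (\<Sum>e | e dvd l\<^sup>2. g e)"
  using l
proof (induction l rule: less_induct)
  case (less l)
  show ?case
  proof (cases "l = 1")
    case False
    with less.prems obtain p where p: "prime p" "p dvd l" using prime_factor_nat by blast
    have "l \<noteq> 0" "\<not> is_unit p" using less.prems p by auto
    then obtain m where m: "l = p ^ multiplicity p l * m" "\<not> p dvd m"
      using multiplicity_decompose' by blast
    define k where "k = multiplicity p l"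
    have k: "0 < k" using p less.prems by (simp add: k_def prime_multiplicity_gt_zero_iff)
    have l_eq: "l = p ^ k * m" using m by (simp add: k_def)
    have m0: "0 < m" using less.prems l_eq by (auto intro: Nat.gr0I)
    have "1 < p ^ k" by (rule one_less_power[OF prime_gt_1_nat[OF p(1)] k])
    then have "m < l" using m0 l_eq by simp
    note IH = less.IH[OF this m0]
    have G: "0 \<le> (\<Sum>i\<le>j. g p ^ i)" for j
    proof -
      consider "g p = -1" | "g p = 0" | "g p = 1" using vals[of p] by auto
      then show ?thesis
      proof cases
        case 1
        have "(\<Sum>i\<le>j. (-1::real) ^ i) = (if even j then 1 else 0)" by (induction j) auto
        with 1 show ?thesis by simp
      next
        case 2
        then show ?thesis by (simp add: sum_nonneg)
      qed (simp add: sum_nonneg)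
    qed
    have G2: "1 \<le> (\<Sum>i\<le>2 * j. g p ^ i)" for j
    proof -
      consider "g p = -1" | "g p = 0" | "g p = 1" using vals[of p] by auto
      then show ?thesis
      proof cases
        case 1
        have "(\<Sum>i\<le>j. (-1::real) ^ i) = (if even j then 1 else 0)" for j by (induction j) auto
        with 1 show ?thesis by simp
      next
        case 2
        have "(\<Sum>i\<le>n. (0::real) ^ i) = 1" for n by (induction n) auto
        with 2 show ?thesis by simp
      qed simp
    qed
    have "l\<^sup>2 = p ^ (2 * k) * m\<^sup>2" by (simp add: l_eq power_mult_distrib power_mult[symmetric] mult.commute)
    then have "(\<Sum>e | e dvd l\<^sup>2. g e) = (\<Sum>i\<le>2 * k. g p ^ i) * (\<Sum>e | e dvd m\<^sup>2. g e)"
      using sum_divisors_prime_power_mult[of g p "m\<^sup>2" "2 * k", OF mult p(1) _ _ g1] m(2) m0 p(1)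
      by (simp add: prime_dvd_power_iff)
    moreover have "(\<Sum>e | e dvd l. g e) = (\<Sum>i\<le>k. g p ^ i) * (\<Sum>e | e dvd m. g e)"
      unfolding l_eq by (rule sum_divisors_prime_power_mult[of g p m k, OF mult p(1) m(2) m0 g1])
    moreover have "1 * 1 \<le> (\<Sum>i\<le>2 * k. g p ^ i) * (\<Sum>e | e dvd m\<^sup>2. g e)"
      using IH G2[of k] by (intro mult_mono) auto
    ultimately show ?thesis using IH G[of k] by simp
  qed (simp add: g1)
qed

text \<open>The weights compare a Lambert series with \<open>\<Sum>\<psi>(n)/n\<close>.  Their monotonicity is an instance of the inequality of the
arithmetic and geometric means: with \<open>S\<^sub>m = \<Sum>i<m. x\<^sup>i\<close> it says that \<open>m (m+1) x\<^sup>m \<le> S\<^sub>m S\<^bsub>m+1\<^esub>\<close>, and pairing \<open>x\<^sup>i\<close> with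
\<open>x\<^bsup>m-1-i\<^esup>\<close> gives \<open>S\<^sub>m \<ge> m x\<^bsup>(m-1)/2\<^esup>\<close>.\<close>

lemma lambert_weight_decreasing:
  fixes x :: real
  assumes x: "0 < x" "x < 1"
  defines "b \<equiv> \<lambda>n. 1 / (real (Suc n) * (1 - x)) - x ^ Suc n / (1 - x ^ Suc n)"
  shows "b (Suc n) \<le> b n" and "b \<longlonglongrightarrow> 0"
proof -
  define S where "S n = (\<Sum>i<n. x ^ i)" for n
  have S: "1 - x ^ n = (1 - x) * S n" for n
    using one_diff_power_eq[of x n] by (simp add: S_def)
  have S_pos: "0 < S (Suc n)" for n
    unfolding S_def using x by (intro sum_pos) auto
  have S_Suc: "S (Suc n) = S n + x ^ n" for n by (simp add: S_def)
  have amgm: "(real n * real (Suc n)) * x ^ n \<le> S n * S (Suc n)" for n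
  proof -
      define y where "y = sqrt x"
      have y: "0 < y" "y\<^sup>2 = x" using x by (auto simp: y_def)
      have am: "2 * y ^ (a + b) \<le> x ^ a + x ^ b" for a b
      proof -
        have "0 \<le> (y ^ a - y ^ b)\<^sup>2" by simp
        then show ?thesis
          by (simp add: power2_diff y(2)[symmetric] power_mult[symmetric] power_add mult_ac)
      qed
      have s1: "real m * y ^ (m - 1) \<le> S m" for m
      proof -
        have "(\<Sum>i<m. x ^ (m - Suc i)) = S m"
          unfolding S_def by (rule sum.nat_diff_reindex)
        then have "2 * S m = (\<Sum>i<m. x ^ i + x ^ (m - Suc i))" by (simp add: sum.distrib S_def)
        also have "\<dots> \<ge> (\<Sum>i<m. 2 * y ^ (m - 1))"
        proof (rule sum_mono)
          fix i assume "i \<in> {..<m}"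
          then have "i + (m - Suc i) = m - 1" by auto
          then show "2 * y ^ (m - 1) \<le> x ^ i + x ^ (m - Suc i)" using am[of i "m - Suc i"] by simp
        qed
        finally show ?thesis by simp
      qed
      show ?thesis
      proof (cases n)
        case (Suc k)
        have "(real n * y ^ (n - 1)) * (real (Suc n) * y ^ n) \<le> S n * S (Suc n)"
          using s1[of n] s1[of "Suc n"] y S_pos[of k] Suc by (intro mult_mono) auto
        moreover have "y ^ (n - 1) * y ^ n \<ge> x ^ n"
        proof -
          have "y \<le> 1" using x by (simp add: y_def)
          then have "y ^ (2 * n) \<le> y ^ (n - 1 + n)" using y by (intro power_decreasing) auto
          then show ?thesis using y by (simp add: power_mult power_add)
        qed
        then have "(real n * real (Suc n)) * x ^ n \<le> (real n * real (Suc n)) * (y ^ (n - 1) * y ^ n)"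
          by (intro mult_left_mono) auto
        ultimately show ?thesis by (simp add: mult_ac)
      qed (simp add: S_def)
  qed
  show "b (Suc n) \<le> b n"
  proof -
    define m where "m = Suc n"
    have Sp: "0 < S m" "0 < S (Suc m)" using S_pos by (auto simp: m_def)
    have m0: "0 < real m" by (simp add: m_def)
    have "x ^ m / S m - x ^ Suc m / S (Suc m) = x ^ m / (S m * S (Suc m))"
    proof -
      have "x ^ m * S (Suc m) - x ^ Suc m * S m = x ^ m * (S m - x * S m + x ^ m)"
        by (simp add: S_Suc algebra_simps)
      also have "S m - x * S m = 1 - x ^ m" by (simp add: S algebra_simps)
      finally have "x ^ m * S (Suc m) - x ^ Suc m * S m = x ^ m" by simp
      then show ?thesis using Sp by (simp add: diff_frac_eq mult.commute)
    qed
    also have "\<dots> \<le> 1 / (real m * real (Suc m))"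
      using amgm[of m] Sp m0 by (simp add: divide_simps mult.commute)
    also have "\<dots> = 1 / real m - 1 / real (Suc m)" using m0 by (simp add: field_simps)
    finally have "1 / real (Suc m) - x ^ Suc m / S (Suc m) \<le> 1 / real m - x ^ m / S m" by simp
    then have "(1 / real (Suc m) - x ^ Suc m / S (Suc m)) / (1 - x) \<le> (1 / real m - x ^ m / S m) / (1 - x)"
      using x by (intro divide_right_mono) auto
    moreover have "b n = (1 / real m - x ^ m / S m) / (1 - x)" "b (Suc n) = (1 / real (Suc m) - x ^ Suc m / S (Suc m)) / (1 - x)"
      unfolding b_def S m_def by (simp_all add: diff_divide_distrib mult.commute)
    ultimately show ?thesis by simp
  qed
  have "(\<lambda>n. 1 / real (Suc n) * (1 / (1 - x)) - x ^ Suc n / (1 - x ^ Suc n)) \<longlonglongrightarrow> 0 * (1 / (1 - x)) - 0 / (1 - 0)"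
    using x by (intro tendsto_intros LIMSEQ_Suc[OF lim_1_over_n] LIMSEQ_Suc[OF LIMSEQ_realpow_zero]) auto
  then show "b \<longlonglongrightarrow> 0" by (simp add: b_def)
qed

text \<open>The geometric series turns a Lambert series into the power series of the divisor sums.\<close>

lemma lambert_series_has_sum:
  fixes a :: "nat \<Rightarrow> complex" and x :: real
  assumes a: "\<And>n. norm (a n) \<le> 1" and x: "0 < x" "x < 1"
  shows "(\<lambda>n. a (Suc n) * of_real (x ^ Suc n / (1 - x ^ Suc n))) sums (\<Sum>n. a (Suc n) * of_real (x ^ Suc n / (1 - x ^ Suc n)))"
    and "(\<lambda>n. (\<Sum>d | d dvd Suc n. a d) * of_real (x ^ Suc n)) sums (\<Sum>n. a (Suc n) * of_real (x ^ Suc n / (1 - x ^ Suc n)))"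
proof -
  have pos: "(f has_sum S) {0<..} \<longleftrightarrow> ((\<lambda>n. f (Suc n)) has_sum S) UNIV" for f :: "nat \<Rightarrow> 'b::{comm_monoid_add,topological_space}" and S
    by (rule has_sum_reindex_bij_betw[OF bij_betw_Suc_pos, symmetric])
  have xm: "x ^ Suc m \<le> x" "0 < x ^ Suc m" "x ^ Suc m < 1" for m
    using x power_decreasing[of 1 "Suc m" x] power_Suc_less_one[of x m] by auto
  have geom: "((\<lambda>n. x ^ (Suc m * n)) has_sum (x ^ Suc m / (1 - x ^ Suc m))) {0<..}" for m
  proof -
    have "(\<lambda>n. (x ^ Suc m) ^ n) sums (1 / (1 - x ^ Suc m))"
      using xm[of m] x by (intro geometric_sums) (simp del: power_Suc)
    from sums_mult[OF this, of "x ^ Suc m"]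
    have "(\<lambda>n. x ^ (Suc m * Suc n)) sums (x ^ Suc m / (1 - x ^ Suc m))"
      by (simp only: times_divide_eq_right mult_1_right power_mult power_Suc)
    moreover from this have "summable (\<lambda>n. norm (x ^ (Suc m * Suc n)))"
      using x by (simp add: sums_iff power_abs[symmetric] abs_of_pos del: power_Suc mult_Suc mult_Suc_right)
    ultimately show ?thesis
      unfolding pos by (rule norm_summable_imp_has_sum[rotated])
  qed
  have wle: "x ^ Suc m / (1 - x ^ Suc m) \<le> x ^ Suc m / (1 - x)" for m
    using xm[of m] x by (intro divide_left_mono mult_pos_pos) (simp_all del: power_Suc)
  have wpos: "0 \<le> x ^ Suc m / (1 - x ^ Suc m)" for m
    using xm[of m] x by (intro divide_nonneg_nonneg) (simp_all del: power_Suc)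
  have "summable (\<lambda>m. x ^ m)" using x by (intro summable_geometric) auto
  then have "summable (\<lambda>m. x ^ Suc m)" by (subst summable_Suc_iff)
  then have wsum0: "summable (\<lambda>m. x ^ Suc m / (1 - x))" by (rule summable_divide)
  have wsum: "summable (\<lambda>m. x ^ Suc m / (1 - x ^ Suc m))"
    by (rule summable_comparison_test'[OF wsum0, of 0]) (simp only: real_norm_def abs_of_nonneg[OF wpos] wle)
  have nsum: "summable (\<lambda>n. norm (a (Suc n) * of_real (x ^ Suc n / (1 - x ^ Suc n))))"
  proof (rule summable_comparison_test'[OF wsum, of 0])
    fix n
    have "norm (a (Suc n)) * (x ^ Suc n / (1 - x ^ Suc n)) \<le> 1 * (x ^ Suc n / (1 - x ^ Suc n))"
      by (intro mult_right_mono a wpos)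
    then show "norm (norm (a (Suc n) * of_real (x ^ Suc n / (1 - x ^ Suc n)))) \<le> x ^ Suc n / (1 - x ^ Suc n)"
      by (simp only: norm_mult norm_of_real real_norm_def abs_mult abs_norm_cancel abs_of_nonneg[OF wpos] mult_1_left)
  qed
  show 1: "(\<lambda>n. a (Suc n) * of_real (x ^ Suc n / (1 - x ^ Suc n))) sums (\<Sum>n. a (Suc n) * of_real (x ^ Suc n / (1 - x ^ Suc n)))"
    by (rule summable_sums[OF summable_norm_cancel[OF nsum]])
  define F where "F = (\<lambda>(m, n). a m * of_real (x ^ (m * n)))"
  have inner: "((\<lambda>n. norm (F (m, n))) has_sum (norm (a m) * (x ^ m / (1 - x ^ m)))) {0<..}" if m: "m \<in> {0<..}" for m
  proof -
    obtain k where k: "m = Suc k" using m by (auto simp: gr0_conv_Suc)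
    show ?thesis
      unfolding F_def k using has_sum_cmult_right[OF geom[of k], of "norm (a (Suc k))"] x
      by (simp add: norm_mult norm_power abs_of_pos del: power_Suc mult_Suc)
  qed
  have "(\<lambda>z. norm (F z)) summable_on ({0<..} \<times> {0<..})"
    unfolding Infinite_Sum.abs_summable_on_Sigma_iff
  proof (intro conjI ballI)
    show "(\<lambda>n. norm (F (m, n))) summable_on {0<..}" if "m \<in> {0<..}" for m
      using inner[OF that] by (rule has_sum_imp_summable)
    have "((\<lambda>m. norm (a m) * (x ^ m / (1 - x ^ m))) has_sum (\<Sum>n. norm (a (Suc n)) * (x ^ Suc n / (1 - x ^ Suc n)))) {0<..}"
    proof (rule iffD2[OF pos])
      have s: "summable (\<lambda>n. norm (a (Suc n)) * (x ^ Suc n / (1 - x ^ Suc n)))"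
        using nsum by (simp only: norm_mult norm_of_real abs_of_nonneg[OF wpos])
      have "summable (\<lambda>n. norm (norm (a (Suc n)) * (x ^ Suc n / (1 - x ^ Suc n))))"
        using s by (simp only: real_norm_def abs_mult abs_norm_cancel abs_of_nonneg[OF wpos])
      then show "((\<lambda>n. norm (a (Suc n)) * (x ^ Suc n / (1 - x ^ Suc n))) has_sum (\<Sum>n. norm (a (Suc n)) * (x ^ Suc n / (1 - x ^ Suc n)))) UNIV"
        by (rule norm_summable_imp_has_sum[OF _ summable_sums[OF s]])
    qed
    then have summ: "(\<lambda>m. norm (a m) * (x ^ m / (1 - x ^ m))) summable_on {0<..}" by (rule has_sum_imp_summable)
    have eq: "norm (\<Sum>\<^sub>\<infinity>n\<in>{0<..}. norm (F (m, n))) = norm (a m) * (x ^ m / (1 - x ^ m))" if m: "m \<in> {0<..}" for m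
    proof -
      have "(\<Sum>\<^sub>\<infinity>n\<in>{0<..}. norm (F (m, n))) = norm (a m) * (x ^ m / (1 - x ^ m))"
        by (rule infsumI[OF inner[OF m]])
      moreover have "0 \<le> norm (a m) * (x ^ m / (1 - x ^ m))"
        using wpos[of "m - 1"] m by (intro mult_nonneg_nonneg) (simp_all del: power_Suc)
      ultimately show ?thesis by (simp only: real_norm_def abs_of_nonneg)
    qed
    show "(\<lambda>m. norm (\<Sum>\<^sub>\<infinity>n\<in>{0<..}. norm (F (m, n)))) summable_on {0<..}"
      by (rule iffD2[OF summable_on_cong[OF eq] summ])
  qed
  then have "F summable_on ({0<..} \<times> {0<..})" by (rule abs_summable_summable)
  then obtain S where S: "(F has_sum S) ({0<..} \<times> {0<..})" by (auto simp: summable_on_def)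
  have "((\<lambda>m. a m * of_real (x ^ m / (1 - x ^ m))) has_sum S) {0<..}"
  proof (rule has_sum_SigmaD[OF S])
    fix m :: nat assume "m \<in> {0<..}"
    then obtain k where k: "m = Suc k" by (auto simp: gr0_conv_Suc)
    have "((\<lambda>n. complex_of_real (x ^ (Suc k * n))) has_sum of_real (x ^ Suc k / (1 - x ^ Suc k))) {0<..}"
      by (rule has_sum_of_real[OF geom])
    from has_sum_cmult_right[OF this, of "a m"]
    show "((\<lambda>n. F (m, n)) has_sum (a m * of_real (x ^ m / (1 - x ^ m)))) {0<..}"
      by (simp add: F_def k del: power_Suc mult_Suc of_real_power of_real_divide)
  qed
  then have "(\<lambda>n. a (Suc n) * of_real (x ^ Suc n / (1 - x ^ Suc n))) sums S"
    unfolding pos by (rule has_sum_imp_sums)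
  with 1 have S_eq: "S = (\<Sum>n. a (Suc n) * of_real (x ^ Suc n / (1 - x ^ Suc n)))"
    by (rule sums_unique2[symmetric])
  have "(\<lambda>n. \<Sum>d | d dvd Suc n. F (d, Suc n div d)) sums S"
    by (rule has_sum_divisor_pairs[OF S])
  moreover have "(\<Sum>d | d dvd Suc n. F (d, Suc n div d)) = (\<Sum>d | d dvd Suc n. a d) * of_real (x ^ Suc n)" for n
    unfolding sum_distrib_right F_def
    by (intro sum.cong) (auto simp del: power_Suc)
  ultimately show "(\<lambda>n. (\<Sum>d | d dvd Suc n. a d) * of_real (x ^ Suc n)) sums (\<Sum>n. a (Suc n) * of_real (x ^ Suc n / (1 - x ^ Suc n)))"
    by (simp only: S_eq)
qed

lemma nat_powr_minus_1: "of_nat (Suc n) powr (- 1) = (1 / of_nat (Suc n) :: complex)"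
  using powr_minus[of "of_nat (Suc n) :: complex" 1] by (simp add: divide_inverse del: of_nat_Suc)

lemma abel_bounded_sum:
  fixes b :: "nat \<Rightarrow> real" and y :: "nat \<Rightarrow> complex"
  assumes B: "\<And>n. norm (\<Sum>k\<le>n. y k) \<le> B" and dec: "\<And>n. b (Suc n) \<le> b n" and nn: "\<And>n. 0 \<le> b n"
  shows "norm (\<Sum>n<N. y n * of_real (b n)) \<le> B * b 0"
proof -
  have B0: "0 \<le> B" using B[of 0] norm_ge_zero order.trans by blast
  have X: "norm (\<Sum>k<N. y k) \<le> B" for N
    using B[of "N - 1"] B0 by (cases N) (auto simp: lessThan_Suc_atMost)
  have tele: "(\<Sum>n<N. b n - b (Suc n)) = b 0 - b N" by (induction N) auto
  have "norm (\<Sum>n<N. y n * of_real (b n))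
      = norm ((\<Sum>k<N. y k) * of_real (b N) + (\<Sum>n<N. (\<Sum>k\<le>n. y k) * (of_real (b n) - of_real (b (Suc n)))))"
    by (subst abel_partial_summation) simp
  also have "\<dots> \<le> norm ((\<Sum>k<N. y k) * of_real (b N)) + (\<Sum>n<N. norm ((\<Sum>k\<le>n. y k) * (of_real (b n) - of_real (b (Suc n)))))"
    by (intro order.trans[OF norm_triangle_ineq] add_mono order_refl norm_sum)
  also have "\<dots> \<le> B * b N + (\<Sum>n<N. B * (b n - b (Suc n)))"
  proof (intro add_mono sum_mono)
    show "norm ((\<Sum>k<N. y k) * of_real (b N)) \<le> B * b N"
      using mult_right_mono[OF X nn] by (simp add: norm_mult nn)
    fix n
    have "norm (of_real (b n) - of_real (b (Suc n)) :: complex) = b n - b (Suc n)"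
      using dec[of n] by (simp add: of_real_diff[symmetric] del: of_real_diff)
    then show "norm ((\<Sum>k\<le>n. y k) * (of_real (b n) - of_real (b (Suc n)))) \<le> B * (b n - b (Suc n))"
      using mult_right_mono[OF B[of n], of "b n - b (Suc n)"] dec[of n] by (simp add: norm_mult)
  qed
  also have "\<dots> = B * b 0" by (simp only: sum_distrib_left[symmetric] tele) (simp add: right_diff_distrib)
  finally show ?thesis .
qed

text \<open>Monsky's proof that \<open>L(1,\<psi>) \<noteq> 0\<close> for a real character.  Let \<open>f(x) = \<Sum>n. \<psi>(n) x\<^sup>n/(1 - x\<^sup>n)\<close>.  If \<open>L(1,\<psi>)\<close> vanished,
then subtracting \<open>L(1,\<psi>)/(1 - x)\<close> would change nothing, and summation by parts against the decreasing weights would bound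
\<open>f\<close> on \<open>(0, 1)\<close>.  But \<open>f(x)\<close> is the power series of the divisor sums of \<open>\<psi>\<close>, so it is at least \<open>\<Sum>j\<ge>1. x\<^bsup>j*j\<^esup>\<close>, which is
unbounded as \<open>x\<close> tends to 1.\<close>

lemma real_character_series_at_1:
  assumes \<psi>: "dchar d \<psi>" and B: "\<And>n. norm (\<Sum>k\<le>n. \<psi> (Suc k)) \<le> B" and sq: "\<And>n. coprime n d \<Longrightarrow> \<psi> n ^ 2 = 1"
  shows "abel_series \<psi> 1 \<noteq> 0"
proof
  assume zero: "abel_series \<psi> 1 = 0"
  have B0: "0 \<le> B" using B[of 0] norm_ge_zero order.trans by blast
  define g where "g n = Re (\<psi> n)" for n
  have vals: "g n \<in> {-1, 0, 1} \<and> \<psi> n = of_real (g n)" for n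
  proof (cases "coprime n d")
    case True
    then have "\<psi> n = 1 \<or> \<psi> n = -1" using sq[of n] by (simp add: power2_eq_1_iff)
    then show ?thesis by (auto simp: g_def)
  next
    case False
    then have "\<psi> n = 0" using dchar_nonzero_iff[OF \<psi>] by auto
    then show ?thesis by (simp add: g_def)
  qed
  have g_mult: "g (m * n) = g m * g n" for m n
    using dchar_mult[OF \<psi>, of m n] vals[of m] vals[of n] by (simp add: g_def[of "m * n"])
  have g1: "g (Suc 0) = 1" using dchar_1[OF \<psi>] by (simp add: g_def)
  define r where "r n = (\<Sum>e | e dvd n. g e)" for n
  have r: "0 < l \<Longrightarrow> 0 \<le> r l" "0 < l \<Longrightarrow> 1 \<le> r (l\<^sup>2)" for l
    using real_character_divisor_sum[of g l] g_mult g1 vals by (auto simp: r_def)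
  have lim1: "(\<lambda>N. \<Sum>n<N. \<psi> (Suc n) / of_nat (Suc n)) \<longlonglongrightarrow> 0"
    using abel_series_sums[of \<psi> B 1, OF B] zero unfolding sums_def nat_powr_minus_1 by simp
  have bound: "norm (\<Sum>n. \<psi> (Suc n) * of_real (x ^ Suc n / (1 - x ^ Suc n))) \<le> B" if x: "0 < x" "x < 1" for x :: real
  proof -
    define b where "b n = 1 / (real (Suc n) * (1 - x)) - x ^ Suc n / (1 - x ^ Suc n)" for n
    have dec: "b (Suc n) \<le> b n" for n unfolding b_def by (rule lambert_weight_decreasing(1)[OF x])
    have "b \<longlonglongrightarrow> 0" unfolding b_def by (rule lambert_weight_decreasing(2)[OF x])
    then have nn: "0 \<le> b n" for n
      using decseq_ge[of b 0 n] dec by (simp add: decseq_Suc_iff)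
    have b0: "b 0 = 1" using x by (simp add: b_def diff_divide_distrib[symmetric])
    define P where "P N = (\<Sum>n<N. \<psi> (Suc n) * of_real (x ^ Suc n / (1 - x ^ Suc n)))" for N
    define R where "R N = (\<Sum>n<N. \<psi> (Suc n) / of_nat (Suc n)) / of_real (1 - x)" for N
    have "norm (R N - P N) \<le> B" for N
    proof -
      have "R N - P N = (\<Sum>n<N. \<psi> (Suc n) * of_real (b n))"
        unfolding R_def P_def b_def sum_divide_distrib sum_subtractf[symmetric]
        by (intro sum.cong) (simp_all add: right_diff_distrib del: of_nat_Suc power_Suc)
      then show ?thesis using abel_bounded_sum[of "\<lambda>n. \<psi> (Suc n)" B b N, OF B dec nn] b0 by simp
    qed
    moreover have "(\<lambda>N. norm (R N - P N)) \<longlonglongrightarrow> norm (0 / of_real (1 - x) - (\<Sum>n. \<psi> (Suc n) * of_real (x ^ Suc n / (1 - x ^ Suc n))))"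
      unfolding R_def P_def
      using x lim1 lambert_series_has_sum(1)[of \<psi> x, OF dchar_norm_le[OF \<psi>] x, unfolded sums_def]
      by (intro tendsto_intros) auto
    ultimately have "norm (0 / of_real (1 - x) - (\<Sum>n. \<psi> (Suc n) * of_real (x ^ Suc n / (1 - x ^ Suc n)))) \<le> B"
      by (intro tendsto_upperbound[of _ _ sequentially]) auto
    then show ?thesis by simp
  qed
  obtain J :: nat where J: "real J > 2 * B" using reals_Archimedean2 by blast
  then have J0: "0 < J" using B0 by (intro Nat.gr0I) auto
  \<comment> \<open>Then the first \<open>J\<close> squares contribute at least 1/2 each.\<close>
  define x where "x = root (J\<^sup>2) (1/2)"
  have x: "0 < x" "x < 1" "x ^ (J\<^sup>2) = 1/2"
    using J0 by (auto simp: x_def real_root_lt_1_iff)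
  have ser: "(\<lambda>n. \<Sum>d | d dvd Suc n. \<psi> d) = (\<lambda>n. of_real (r (Suc n)))"
    unfolding r_def of_real_sum using vals by auto
  have sums: "(\<lambda>n. r (Suc n) * x ^ Suc n) sums Re (\<Sum>n. \<psi> (Suc n) * of_real (x ^ Suc n / (1 - x ^ Suc n)))"
    using sums_Re[OF lambert_series_has_sum(2)[of \<psi> x, OF dchar_norm_le[OF \<psi>] x(1,2)]]
    unfolding fun_cong[OF ser] of_real_mult[symmetric] Re_complex_of_real .
  have terms: "0 \<le> r (Suc n) * x ^ Suc n" for n using r(1)[of "Suc n"] x by simp
  have "real J * (1/2) \<le> (\<Sum>j\<in>{1..J}. r (j\<^sup>2) * x ^ (j\<^sup>2))"
  proof -
    have "(\<Sum>j\<in>{1..J}. 1/2) \<le> (\<Sum>j\<in>{1..J}. r (j\<^sup>2) * x ^ (j\<^sup>2))"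
    proof (rule sum_mono)
      fix j assume j: "j \<in> {1..J}"
      have "x ^ (J\<^sup>2) \<le> x ^ (j\<^sup>2)" using j x by (intro power_decreasing) (auto intro: power_mono)
      then have "1 * (1/2) \<le> r (j\<^sup>2) * x ^ (j\<^sup>2)" using r(2)[of j] j x by (intro mult_mono) auto
      then show "1/2 \<le> r (j\<^sup>2) * x ^ (j\<^sup>2)" by simp
    qed
    then show ?thesis by simp
  qed
  also have "\<dots> = (\<Sum>n\<in>(\<lambda>j. j\<^sup>2 - 1) ` {1..J}. r (Suc n) * x ^ Suc n)"
  proof (subst sum.reindex)
    show "inj_on (\<lambda>j. j\<^sup>2 - 1) {1..J}"
    proof (rule inj_onI)
      fix i j :: nat assume "i \<in> {1..J}" "j \<in> {1..J}" "i\<^sup>2 - 1 = j\<^sup>2 - 1"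
      then have "i\<^sup>2 = j\<^sup>2" by (metis Suc_diff_1 atLeastAtMost_iff one_le_power less_le_trans zero_less_one)
      then show "i = j" by simp
    qed
    show "(\<Sum>j\<in>{1..J}. r (j\<^sup>2) * x ^ (j\<^sup>2)) = (\<Sum>j\<in>{1..J}. ((\<lambda>n. r (Suc n) * x ^ Suc n) \<circ> (\<lambda>j. j\<^sup>2 - 1)) j)"
    proof (rule sum.cong[OF refl])
      fix j assume "j \<in> {1..J}"
      then have "Suc (j\<^sup>2 - 1) = j\<^sup>2" by simp
      then show "r (j\<^sup>2) * x ^ (j\<^sup>2) = ((\<lambda>n. r (Suc n) * x ^ Suc n) \<circ> (\<lambda>j. j\<^sup>2 - 1)) j"
        by (simp only: o_def)
    qed
  qed
  also have "\<dots> \<le> (\<Sum>n. r (Suc n) * x ^ Suc n)"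
    by (rule sum_le_suminf) (use sums terms in \<open>auto simp: sums_iff\<close>)
  also have "\<dots> \<le> norm (\<Sum>n. \<psi> (Suc n) * of_real (x ^ Suc n / (1 - x ^ Suc n)))"
    unfolding sums_unique[OF sums, symmetric] by (rule complex_Re_le_cmod)
  also have "\<dots> \<le> B" by (rule bound[OF x(1,2)])
  finally show False using J by simp
qed

section \<open>Nonvanishing on the line of real part 1\<close>

text \<open>The logarithmic derivative sees the order of vanishing \<open>m\<close> from the right.\<close>

lemma log_derivative_order:
  assumes f: "f holomorphic_on {s. 0 < Re s}" and nz: "\<And>s. 1 < Re s \<Longrightarrow> f s \<noteq> 0" and z: "Re z = 1"
  obtains m :: nat where "m = 0 \<longleftrightarrow> f z \<noteq> 0"
    "((\<lambda>\<delta>::real. of_real \<delta> * (deriv f (z + of_real \<delta>) / f (z + of_real \<delta>))) \<longlongrightarrow> of_nat m) (at_right 0)"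
proof -
  let ?S = "{s. 0 < Re s}"
  have op: "open ?S" and conn: "connected ?S" and zS: "z \<in> ?S"
    using z by (auto intro: open_halfspace_Re_gt convex_connected convex_halfspace_Re_gt)
  have add_lim: "((\<lambda>\<delta>. z + complex_of_real \<delta>) \<longlongrightarrow> z + of_real 0) (at_right 0)"
    by (intro tendsto_intros)
  have comp: "((\<lambda>\<delta>. h (z + complex_of_real \<delta>)) \<longlongrightarrow> h z) (at_right 0)" if "h holomorphic_on T" "open T" "z \<in> T" for h T
  proof -
    have "isCont h z"
      using holomorphic_on_imp_continuous_on[OF that(1)] that(2,3) by (simp add: continuous_on_eq_continuous_at)
    from isCont_tendsto_compose[OF this, of "\<lambda>\<delta>. z + complex_of_real \<delta>" "at_right 0"] add_lim
    show ?thesis by simp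
  qed
  show ?thesis
  proof (cases "f z = 0")
    case False
    have "((\<lambda>\<delta>. of_real \<delta> * (deriv f (z + of_real \<delta>) / f (z + of_real \<delta>))) \<longlongrightarrow> of_real 0 * (deriv f z / f z)) (at_right 0)"
      using comp[OF f op zS] comp[OF holomorphic_deriv[OF f op] op zS] False by (intro tendsto_intros) auto
    then show ?thesis using that[of 0] False by simp
  next
    case True
    have nc: "\<not> f constant_on ?S"
    proof
      assume "f constant_on ?S"
      then obtain c where "\<forall>s\<in>?S. f s = c" unfolding constant_on_def by blast
      then have "f 2 = f z" using z by simp
      then show False using True nz[of 2] by simp
    qed
    obtain g r n where n: "0 < n" and r: "0 < r" "ball z r \<subseteq> ?S" and g: "g holomorphic_on ball z r"
      and fg: "\<And>w. w \<in> ball z r \<Longrightarrow> f w = (w - z) ^ n * g w" and gnz: "\<And>w. w \<in> ball z r \<Longrightarrow> g w \<noteq> 0"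
      by (rule holomorphic_factor_zero_nonconstant[OF f op conn zS True nc]) blast
    have zr: "z \<in> ball z r" using r by simp
    have eq: "of_real \<delta> * (deriv f (z + of_real \<delta>) / f (z + of_real \<delta>))
        = of_nat n + of_real \<delta> * (deriv g (z + of_real \<delta>) / g (z + of_real \<delta>))" if \<delta>: "0 < \<delta>" "\<delta> < r" for \<delta> :: real
    proof -
      define w where "w = z + of_real \<delta>"
      have w: "w \<in> ball z r" using \<delta> by (simp add: w_def dist_norm)
      have dg: "(g has_field_derivative deriv g w) (at w)" by (rule holomorphic_derivI[OF g open_ball w])
      have "((\<lambda>w. (w - z) ^ n * g w) has_field_derivative (of_nat n * (w - z) ^ (n - 1) * g w + deriv g w * (w - z) ^ n)) (at w)"
        by (auto intro!: derivative_eq_intros dg)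
      then have "(f has_field_derivative (of_nat n * (w - z) ^ (n - 1) * g w + deriv g w * (w - z) ^ n)) (at w)"
        by (rule has_field_derivative_transform_within_open[OF _ open_ball w]) (simp add: fg)
      then have "deriv f w = of_nat n * (w - z) ^ (n - 1) * g w + deriv g w * (w - z) ^ n" by (rule DERIV_imp_deriv)
      moreover have "(w - z) ^ n = of_real \<delta> * (w - z) ^ (n - 1)" using n by (cases n) (auto simp: w_def)
      moreover have "(w - z) ^ (n - 1) \<noteq> 0" "complex_of_real \<delta> \<noteq> 0" using \<delta> by (auto simp: w_def)
      ultimately show ?thesis using gnz[OF w] fg[OF w] unfolding w_def[symmetric]
        by (simp add: field_simps)
    qed
    have "((\<lambda>\<delta>. of_nat n + of_real \<delta> * (deriv g (z + of_real \<delta>) / g (z + of_real \<delta>))) \<longlongrightarrow> of_nat n + of_real 0 * (deriv g z / g z)) (at_right 0)"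
      using comp[OF g open_ball zr] comp[OF holomorphic_deriv[OF g open_ball] open_ball zr] gnz[OF zr]
      by (intro tendsto_intros) auto
    then have "((\<lambda>\<delta>. of_nat n + of_real \<delta> * (deriv g (z + of_real \<delta>) / g (z + of_real \<delta>))) \<longlongrightarrow> of_nat n) (at_right 0)" by simp
    moreover have "\<forall>\<^sub>F \<delta> in at_right 0. of_nat n + of_real \<delta> * (deriv g (z + of_real \<delta>) / g (z + of_real \<delta>))
      = of_real \<delta> * (deriv f (z + of_real \<delta>) / f (z + of_real \<delta>))"
      using eventually_at_right[of 0 r] r eq by (auto simp: eventually_at_right_field intro!: exI[of _ r])
    ultimately have "((\<lambda>\<delta>::real. of_real \<delta> * (deriv f (z + of_real \<delta>) / f (z + of_real \<delta>))) \<longlongrightarrow> of_nat n) (at_right 0)"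
      by (rule Lim_transform_eventually)
    with that[of n] n True show ?thesis by simp
  qed
qed

definition char_mean :: "nat \<Rightarrow> (nat \<Rightarrow> complex) \<Rightarrow> complex"
  where "char_mean d \<psi> = (\<Sum>n<d. \<psi> n) / of_nat d"

text \<open>The numerator of \<open>L(s,\<psi>)\<close>: the L-function itself if it has no pole at \<open>s = 1\<close>, that is, if the mean of \<open>\<psi>\<close> over a
period is 0, and \<open>(s - 1) L(s,\<psi>)\<close> otherwise.  In both cases this is holomorphic for \<open>Re s > 0\<close>.\<close>

definition L_num :: "nat \<Rightarrow> (nat \<Rightarrow> complex) \<Rightarrow> complex \<Rightarrow> complex"
  where "L_num d \<psi> s = (if char_mean d \<psi> = 0 then abel_series \<psi> s
     else (s - 1) * abel_series (\<lambda>n. \<psi> n - char_mean d \<psi>) s + char_mean d \<psi> * zeta_num s)"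

lemma char_mean_partial_sums:
  assumes \<psi>: "dchar d \<psi>"
  obtains B where "\<And>n. norm (\<Sum>k\<le>n. \<psi> (Suc k) - char_mean d \<psi>) \<le> B"
proof -
  define x where "x n = \<psi> n - char_mean d \<psi>" for n
  have d: "0 < d" by (rule dchar_pos[OF \<psi>])
  have zero: "(\<Sum>n<d. x n) = 0" using d by (simp add: x_def sum_subtractf char_mean_def)
  have "norm (\<Sum>k\<le>n. x (Suc k)) \<le> (\<Sum>n<d. norm (x n)) + norm (x 0)" for n
  proof -
    have "(\<Sum>k<Suc (Suc n). x k) = x 0 + (\<Sum>k\<le>n. x (Suc k))"
      unfolding lessThan_Suc_atMost by (rule sum.atMost_Suc_shift)
    then have "(\<Sum>k\<le>n. x (Suc k)) = (\<Sum>k<Suc (Suc n). x k) - x 0" by simp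
    also have "norm \<dots> \<le> norm (\<Sum>k<Suc (Suc n). x k) + norm (x 0)" by (rule norm_triangle_ineq4)
    also have "norm (\<Sum>k<Suc (Suc n). x k) \<le> (\<Sum>n<d. norm (x n))"
      by (rule periodic_partial_sum_bound[OF _ d zero]) (simp add: x_def dchar_periodic[OF \<psi>])
    finally show ?thesis by simp
  qed
  then show ?thesis unfolding x_def by (rule that)
qed

lemma L_num_holomorphic:
  assumes "dchar d \<psi>"
  shows "L_num d \<psi> holomorphic_on {s. 0 < Re s}"
proof -
  obtain B where B: "\<And>n. norm (\<Sum>k\<le>n. \<psi> (Suc k) - char_mean d \<psi>) \<le> B" by (rule char_mean_partial_sums[OF assms]) blast
  have 1: "abel_series (\<lambda>n. \<psi> n - char_mean d \<psi>) holomorphic_on {s. 0 < Re s}"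
    by (rule abel_series_holomorphic[OF B])
  show ?thesis
  proof (cases "char_mean d \<psi> = 0")
    case True
    then show ?thesis using 1 by (simp add: L_num_def[abs_def])
  next
    case False
    then show ?thesis using 1 zeta_num_holomorphic
      by (simp add: L_num_def[abs_def]) (intro holomorphic_intros)
  qed
qed

lemma L_num_eq:
  assumes \<psi>: "dchar d \<psi>" and s: "1 < Re s"
  shows "L_num d \<psi> s = (if char_mean d \<psi> = 0 then 1 else s - 1) * dseries \<psi> s"
proof -
  obtain B where B: "\<And>n. norm (\<Sum>k\<le>n. \<psi> (Suc k) - char_mean d \<psi>) \<le> B" by (rule char_mean_partial_sums[OF \<psi>]) blast
  have 1: "(\<lambda>n. (\<psi> (Suc n) - char_mean d \<psi>) * of_nat (Suc n) powr (- s)) sums abel_series (\<lambda>n. \<psi> n - char_mean d \<psi>) s"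
    using s by (intro abel_series_sums[OF B]) simp
  have 2: "(\<lambda>n. 1 * of_nat (Suc n) powr (- s)) sums dseries (\<lambda>_. 1) s"
    by (rule dseries_sums) (use s in \<open>auto intro: dsummable_bounded\<close>)
  have 3: "(\<lambda>n. \<psi> (Suc n) * of_nat (Suc n) powr (- s)) sums dseries \<psi> s"
    by (rule dseries_sums[OF dsummable_bounded[OF dchar_norm_le[OF \<psi>] s]])
  have "(\<lambda>n. \<psi> (Suc n) * of_nat (Suc n) powr (- s)) sums
      (abel_series (\<lambda>n. \<psi> n - char_mean d \<psi>) s + char_mean d \<psi> * dseries (\<lambda>_. 1) s)"
    using sums_add[OF 1 sums_mult[OF 2, of "char_mean d \<psi>"]]
    by (simp add: left_diff_distrib del: of_nat_Suc)
  with 3 have eq: "dseries \<psi> s = abel_series (\<lambda>n. \<psi> n - char_mean d \<psi>) s + char_mean d \<psi> * dseries (\<lambda>_. 1) s"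
    by (rule sums_unique2)
  show ?thesis
  proof (cases "char_mean d \<psi> = 0")
    case True
    then show ?thesis using eq by (simp add: L_num_def)
  next
    case False
    then show ?thesis by (simp add: L_num_def eq zeta_num_eq[OF s] algebra_simps)
  qed
qed

lemma L_num_1: "char_mean d \<psi> \<noteq> 0 \<Longrightarrow> L_num d \<psi> 1 = char_mean d \<psi>"
  by (simp add: L_num_def zeta_num_1)

lemma dchar_divisor_sum:
  assumes \<psi>: "dchar d \<psi>"
  shows "(\<Sum>e | e dvd n. (a e * \<psi> e) * \<psi> (n div e)) = (\<Sum>e | e dvd n. a e) * \<psi> n"
  unfolding sum_distrib_right
proof (rule sum.cong[OF refl])
  fix e assume "e \<in> {e. e dvd n}"
  then have "\<psi> n = \<psi> e * \<psi> (n div e)" using dchar_mult[OF \<psi>, of e "n div e"] by simp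
  then show "(a e * \<psi> e) * \<psi> (n div e) = a e * \<psi> n" by simp
qed

lemma dseries_moebius:
  assumes \<psi>: "dchar d \<psi>" and s: "1 < Re s"
  shows "dseries (\<lambda>n. of_int (moebius_mu n) * \<psi> n) s * dseries \<psi> s = 1"
proof -
  have le: "norm (of_int (moebius_mu n) * \<psi> n) \<le> 1" for n
    using mult_mono[OF norm_moebius_mu_le dchar_norm_le[OF \<psi>]] by (simp add: norm_mult)
  have "(\<lambda>n. (\<Sum>e | e dvd Suc n. (of_int (moebius_mu e) * \<psi> e) * \<psi> (Suc n div e)) * of_nat (Suc n) powr (- s))
    sums (dseries (\<lambda>n. of_int (moebius_mu n) * \<psi> n) s * dseries \<psi> s)"
    by (intro dseries_mult dsummable_bounded le dchar_norm_le[OF \<psi>] s)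
  moreover have "(\<Sum>e | e dvd Suc n. (of_int (moebius_mu e) * \<psi> e) * \<psi> (Suc n div e)) * of_nat (Suc n) powr (- s)
      = (if n = 0 then 1 else 0)" for n
  proof -
    have "(\<Sum>e | e dvd Suc n. complex_of_int (moebius_mu e)) = (if n = 0 then 1 else 0)"
      using sum_moebius_mu_divisors[of "Suc n"] by (simp flip: of_int_sum)
    then show ?thesis
      using dchar_1[OF \<psi>] by (simp add: dchar_divisor_sum[OF \<psi>] del: of_nat_Suc) simp
  qed
  moreover have "(\<lambda>n. if n = 0 then 1 else 0) sums (1::complex)" using sums_single[of 0 "\<lambda>_. 1::complex"] by simp
  ultimately show ?thesis using sums_unique2 by simp
qed

lemma dseries_char_nonzero: "dchar d \<psi> \<Longrightarrow> 1 < Re s \<Longrightarrow> dseries \<psi> s \<noteq> 0"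
  using dseries_moebius by fastforce

lemma dsummable_mangoldt:
  assumes \<psi>: "dchar d \<psi>" and s: "1 < Re s"
  shows "dsummable (\<lambda>n. mangoldt n * \<psi> n) s"
proof -
  have S: "summable (\<lambda>n. norm (complex_of_real (ln (real (Suc n))) * 1) * real (Suc n) powr (- Re s))"
    using dseries_has_derivative(2)[of "\<lambda>_. 1" s] s by (simp add: dsummable_def)
  show ?thesis
    unfolding dsummable_def
  proof (rule summable_comparison_test'[OF S, of 0])
    fix n :: nat
    have ln0: "0 \<le> ln (real (Suc n))" by simp
    have "norm (mangoldt (Suc n) * \<psi> (Suc n)) \<le> ln (real (Suc n)) * 1"
      unfolding norm_mult norm_mangoldt
      by (intro mult_mono mangoldt_le dchar_norm_le[OF \<psi>]) auto
    then have "norm (mangoldt (Suc n) * \<psi> (Suc n)) * real (Suc n) powr (- Re s) \<le> ln (real (Suc n)) * real (Suc n) powr (- Re s)"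
      by (intro mult_right_mono) auto
    then show "norm (norm (mangoldt (Suc n) * \<psi> (Suc n)) * real (Suc n) powr (- Re s)) \<le> norm (complex_of_real (ln (real (Suc n))) * 1) * real (Suc n) powr (- Re s)"
      by (simp add: abs_mult abs_of_nonneg[OF ln0] del: of_nat_Suc)
  qed
qed

text \<open>The identity \<open>\<Lambda>\<psi> * \<psi> = \<psi> log\<close> of Dirichlet convolution.\<close>

lemma dseries_log_derivative:
  assumes \<psi>: "dchar d \<psi>" and s: "1 < Re s"
  shows "deriv (dseries \<psi>) s / dseries \<psi> s = - dseries (\<lambda>n. mangoldt n * \<psi> n) s"
proof -
  have "(\<lambda>n. (\<Sum>e | e dvd Suc n. (mangoldt e * \<psi> e) * \<psi> (Suc n div e)) * of_nat (Suc n) powr (- s))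
    sums (dseries (\<lambda>n. mangoldt n * \<psi> n) s * dseries \<psi> s)"
    by (intro dseries_mult dsummable_bounded dsummable_mangoldt[OF \<psi>] dchar_norm_le[OF \<psi>] s)
  moreover have "(\<Sum>e | e dvd Suc n. (mangoldt e * \<psi> e) * \<psi> (Suc n div e)) = complex_of_real (ln (real (Suc n))) * \<psi> (Suc n)" for n
    using mangoldt_sum[of "Suc n", where 'a = complex] by (simp add: dchar_divisor_sum[OF \<psi>] del: of_nat_Suc)
  ultimately have "(\<lambda>n. complex_of_real (ln (real (Suc n))) * \<psi> (Suc n) * of_nat (Suc n) powr (- s))
    sums (dseries (\<lambda>n. mangoldt n * \<psi> n) s * dseries \<psi> s)" by (simp only:)
  moreover note der = dseries_has_derivative[of \<psi> s, OF dchar_norm_le[OF \<psi>] s]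
  ultimately have "dseries (\<lambda>n. complex_of_real (ln (real n)) * \<psi> n) s = dseries (\<lambda>n. mangoldt n * \<psi> n) s * dseries \<psi> s"
    using sums_unique2[OF dseries_sums[OF der(2)]] by blast
  then have "deriv (dseries \<psi>) s = - (dseries (\<lambda>n. mangoldt n * \<psi> n) s * dseries \<psi> s)"
    using DERIV_imp_deriv[OF der(1)] by simp
  then show ?thesis using dseries_char_nonzero[OF \<psi> s] by simp
qed

lemma dchar_square: "dchar d \<psi> \<Longrightarrow> dchar d (\<lambda>n. \<psi> n ^ 2)"
  by (auto simp: dchar_def power_mult_distrib)

lemma dchar_principal: "0 < d \<Longrightarrow> dchar d (\<lambda>n. if coprime n d then 1 else 0)"
proof -
  assume d: "0 < d"
  have "coprime (n + d) d \<longleftrightarrow> coprime n d" for n by (metis coprime_iff_gcd_eq_1 gcd_add1)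
  then show ?thesis using d by (simp add: dchar_def)
qed

lemma char_mean_principal:
  assumes d: "0 < d"
  shows "char_mean d (\<lambda>n. if coprime n d then 1 else 0) \<noteq> 0"
proof -
  have "(\<Sum>n<d. if coprime n d then 1 else 0 :: complex) = of_nat (card {n\<in>{..<d}. coprime n d})"
    by (simp add: sum.If_cases Int_def)
  moreover have "1 mod d \<in> {n\<in>{..<d}. coprime n d}" using d by (cases "d = 1") auto
  then have "card {n\<in>{..<d}. coprime n d} \<noteq> 0" by auto
  ultimately show ?thesis using d by (simp add: char_mean_def)
qed

text \<open>Multiplication by a unit permutes the residues, so the sum over a period is multiplied by \<open>\<psi>(a)\<close>.\<close>

lemma char_mean_nonzero_imp_trivial:
  assumes \<psi>: "dchar d \<psi>" and c: "char_mean d \<psi> \<noteq> 0" and a: "coprime a d"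
  shows "\<psi> a = 1"
proof -
  have d: "0 < d" by (rule dchar_pos[OF \<psi>])
  have inj: "inj_on (\<lambda>n. a * n mod d) {..<d}"
  proof (rule inj_onI)
    fix m n assume mn: "m \<in> {..<d}" "n \<in> {..<d}" "a * m mod d = a * n mod d"
    then have "[a * m = a * n] (mod d)" by (simp add: cong_def)
    then have "[m = n] (mod d)" using a by (simp add: cong_mult_lcancel_nat)
    with mn show "m = n" by (simp add: cong_def)
  qed
  have "(\<lambda>n. a * n mod d) ` {..<d} = {..<d}"
    by (rule endo_inj_surj[OF _ _ inj]) (use d in auto)
  then have "(\<Sum>n<d. \<psi> n) = (\<Sum>n\<in>(\<lambda>n. a * n mod d) ` {..<d}. \<psi> n)" by simp
  also have "\<dots> = (\<Sum>n<d. \<psi> (a * n mod d))" by (simp add: sum.reindex[OF inj])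
  also have "\<dots> = \<psi> a * (\<Sum>n<d. \<psi> n)"
    using periodic_mod[of \<psi> d, OF dchar_periodic[OF \<psi>]] by (simp add: dchar_mult[OF \<psi>] sum_distrib_left)
  finally show ?thesis using c d by (simp add: char_mean_def)
qed

text \<open>The residue at \<open>1 + it\<close> of \<open>-L'/L\<close>: the order of the pole of \<open>L\<close> minus the order of the zero.\<close>

lemma mangoldt_series_residue:
  assumes \<psi>: "dchar d \<psi>"
  shows "\<exists>m::nat. (m = 0 \<longleftrightarrow> L_num d \<psi> (Complex 1 t) \<noteq> 0) \<and>
    ((\<lambda>\<delta>::real. of_real \<delta> * dseries (\<lambda>n. mangoldt n * \<psi> n) (Complex 1 t + of_real \<delta>)) \<longlongrightarrow>
      (if char_mean d \<psi> \<noteq> 0 \<and> t = 0 then 1 else 0) - of_nat m) (at_right 0)"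
proof -
  define z where "z = Complex 1 t"
  define k where "k s = (if char_mean d \<psi> = 0 then 1 else s - 1)" for s :: complex
  define k' where "k' s = (if char_mean d \<psi> = 0 then 0 else 1 / (s - 1))" for s :: complex
  have nz: "L_num d \<psi> s \<noteq> 0" if "1 < Re s" for s
  proof -
    have "s \<noteq> 1" using that by auto
    then show ?thesis using L_num_eq[OF \<psi> that] dseries_char_nonzero[OF \<psi> that] by auto
  qed
  obtain m where m: "m = 0 \<longleftrightarrow> L_num d \<psi> z \<noteq> 0"
    and lim: "((\<lambda>\<delta>::real. of_real \<delta> * (deriv (L_num d \<psi>) (z + of_real \<delta>) / L_num d \<psi> (z + of_real \<delta>))) \<longlongrightarrow> of_nat m) (at_right 0)"
    by (rule log_derivative_order[OF L_num_holomorphic[OF \<psi>] nz, of z]) (auto simp: z_def)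
  have logd: "dseries (\<lambda>n. mangoldt n * \<psi> n) s = k' s - deriv (L_num d \<psi>) s / L_num d \<psi> s" if s: "1 < Re s" for s
  proof -
    have s1: "s \<noteq> 1" using s by auto
    have dD: "(dseries \<psi> has_field_derivative deriv (dseries \<psi>) s) (at s)"
      using dseries_has_derivative(1)[of \<psi> s, OF dchar_norm_le[OF \<psi>] s] DERIV_imp_deriv by metis
    have dk: "(k has_field_derivative (if char_mean d \<psi> = 0 then 0 else 1)) (at s)"
      unfolding k_def[abs_def] by (cases "char_mean d \<psi> = 0") (auto intro!: derivative_eq_intros)
    have "((\<lambda>s. k s * dseries \<psi> s) has_field_derivative
        ((if char_mean d \<psi> = 0 then 0 else 1) * dseries \<psi> s + deriv (dseries \<psi>) s * k s)) (at s)"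
      by (rule DERIV_mult[OF dk dD])
    then have "(L_num d \<psi> has_field_derivative
        ((if char_mean d \<psi> = 0 then 0 else 1) * dseries \<psi> s + deriv (dseries \<psi>) s * k s)) (at s)"
      by (rule has_field_derivative_transform_within_open[of _ _ _ "{s. 1 < Re s}"])
         (use s in \<open>auto simp: L_num_eq[OF \<psi>] k_def open_halfspace_Re_gt\<close>)
    then have "deriv (L_num d \<psi>) s = (if char_mean d \<psi> = 0 then 0 else 1) * dseries \<psi> s + deriv (dseries \<psi>) s * k s"
      by (rule DERIV_imp_deriv)
    moreover have "L_num d \<psi> s = k s * dseries \<psi> s" using L_num_eq[OF \<psi> s] by (simp add: k_def)
    moreover have "k s \<noteq> 0" "dseries \<psi> s \<noteq> 0" using s1 dseries_char_nonzero[OF \<psi> s] by (auto simp: k_def)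
    ultimately have "deriv (L_num d \<psi>) s / L_num d \<psi> s = k' s + deriv (dseries \<psi>) s / dseries \<psi> s"
      by (simp add: k_def k'_def add_divide_distrib)
    then show ?thesis by (simp add: dseries_log_derivative[OF \<psi> s])
  qed
  have k'_lim: "((\<lambda>\<delta>::real. of_real \<delta> * k' (z + of_real \<delta>)) \<longlongrightarrow> (if char_mean d \<psi> \<noteq> 0 \<and> t = 0 then 1 else 0)) (at_right 0)"
  proof (cases "char_mean d \<psi> = 0")
    case True
    then show ?thesis by (simp add: k'_def)
  next
    case c: False
    show ?thesis
    proof (cases "t = 0")
      case True
      have "\<forall>\<^sub>F \<delta>::real in at_right 0. 1 = of_real \<delta> * k' (z + of_real \<delta>)"
        using eventually_at_right_less[of "0::real"]
      proof eventually_elim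
        case (elim \<delta>)
        have "z = 1" by (simp add: z_def True complex_eq_iff)
        then show ?case using c elim by (simp add: k'_def)
      qed
      from Lim_transform_eventually[OF tendsto_const this] show ?thesis using c True by simp
    next
      case False
      then have "z \<noteq> 1" by (auto simp: z_def complex_eq_iff)
      then have "((\<lambda>\<delta>::real. of_real \<delta> * (1 / (z + of_real \<delta> - 1))) \<longlongrightarrow> of_real 0 * (1 / (z + of_real 0 - 1))) (at_right 0)"
        by (intro tendsto_intros) auto
      then show ?thesis using c False by (simp add: k'_def)
    qed
  qed
  have "((\<lambda>\<delta>::real. of_real \<delta> * k' (z + of_real \<delta>) - of_real \<delta> * (deriv (L_num d \<psi>) (z + of_real \<delta>) / L_num d \<psi> (z + of_real \<delta>)))
      \<longlongrightarrow> (if char_mean d \<psi> \<noteq> 0 \<and> t = 0 then 1 else 0) - of_nat m) (at_right 0)"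
    by (rule tendsto_diff[OF k'_lim lim])
  moreover have "\<forall>\<^sub>F \<delta>::real in at_right 0. of_real \<delta> * k' (z + of_real \<delta>) - of_real \<delta> * (deriv (L_num d \<psi>) (z + of_real \<delta>) / L_num d \<psi> (z + of_real \<delta>))
      = of_real \<delta> * dseries (\<lambda>n. mangoldt n * \<psi> n) (z + of_real \<delta>)"
    using eventually_at_right_less[of "0::real"]
  proof eventually_elim
    case (elim \<delta>)
    then have "1 < Re (z + of_real \<delta>)" by (simp add: z_def)
    from logd[OF this] show ?case by (simp add: right_diff_distrib)
  qed
  ultimately have "((\<lambda>\<delta>::real. of_real \<delta> * dseries (\<lambda>n. mangoldt n * \<psi> n) (z + of_real \<delta>))
      \<longlongrightarrow> (if char_mean d \<psi> \<noteq> 0 \<and> t = 0 then 1 else 0) - of_nat m) (at_right 0)"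
    by (rule Lim_transform_eventually)
  with m show ?thesis unfolding z_def by (intro exI conjI)
qed

text \<open>With \<open>w = \<psi>(n) n\<^bsup>-it\<^esup>\<close> of modulus 1, the coefficient at \<open>n\<close> is a nonnegative multiple of
\<open>3 + 4 Re w + Re w\<^sup>2 = 2 (1 + Re w)\<^sup>2\<close>.\<close>

lemma three_four_one:
  assumes \<psi>: "dchar d \<psi>" and \<delta>: "0 < \<delta>"
  defines "\<psi>\<^sub>0 \<equiv> \<lambda>n. if coprime n d then 1 else 0"
  shows "0 \<le> 3 * Re (dseries (\<lambda>n. mangoldt n * \<psi>\<^sub>0 n) (Complex 1 0 + of_real \<delta>))
    + 4 * Re (dseries (\<lambda>n. mangoldt n * \<psi> n) (Complex 1 t + of_real \<delta>))
    + Re (dseries (\<lambda>n. mangoldt n * \<psi> n ^ 2) (Complex 1 (2 * t) + of_real \<delta>))"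
proof -
  have d: "0 < d" by (rule dchar_pos[OF \<psi>])
  have \<psi>0: "dchar d \<psi>\<^sub>0" unfolding \<psi>\<^sub>0_def by (rule dchar_principal[OF d])
  let ?s0 = "Complex 1 0 + of_real \<delta>" and ?s1 = "Complex 1 t + of_real \<delta>" and ?s2 = "Complex 1 (2 * t) + of_real \<delta>"
  have re: "1 < Re ?s0" "1 < Re ?s1" "1 < Re ?s2" using \<delta> by auto
  let ?A = "\<lambda>n. mangoldt (Suc n) * \<psi>\<^sub>0 (Suc n) * of_nat (Suc n) powr (- ?s0)"
  let ?B = "\<lambda>n. mangoldt (Suc n) * \<psi> (Suc n) * of_nat (Suc n) powr (- ?s1)"
  let ?C = "\<lambda>n. mangoldt (Suc n) * \<psi> (Suc n) ^ 2 * of_nat (Suc n) powr (- ?s2)"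
  have "(\<lambda>n. 3 * Re (?A n) + 4 * Re (?B n) + Re (?C n)) sums
     (3 * Re (dseries (\<lambda>n. mangoldt n * \<psi>\<^sub>0 n) ?s0) + 4 * Re (dseries (\<lambda>n. mangoldt n * \<psi> n) ?s1) + Re (dseries (\<lambda>n. mangoldt n * \<psi> n ^ 2) ?s2))"
    by (intro sums_add sums_mult sums_Re dseries_sums dsummable_mangoldt[OF \<psi>0 re(1)] dsummable_mangoldt[OF \<psi> re(2)]
          dsummable_mangoldt[OF dchar_square[OF \<psi>] re(3)])
  moreover have "0 \<le> 3 * Re (?A n) + 4 * Re (?B n) + Re (?C n)" for n
  proof -
    define y where "y = real (Suc n) powr (- 1 - \<delta>)"
    define z where "z = cis (- (t * ln (real (Suc n))))"
    have pw: "of_nat (Suc n) powr (- (Complex 1 u + of_real \<delta>)) = of_real y * cis (- (u * ln (real (Suc n))))" for u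
    proof -
      have nz: "(of_nat (Suc n) :: complex) \<noteq> 0" by (rule of_nat_neq_0)
      have "of_nat (Suc n) powr (- (Complex 1 u + of_real \<delta>)) = exp (- (Complex 1 u + of_real \<delta>) * of_real (ln (real (Suc n))))"
        using nz Ln_of_nat[of "Suc n"] by (simp add: powr_def del: of_nat_Suc)
      also have "- (Complex 1 u + of_real \<delta>) * of_real (ln (real (Suc n))) = of_real ((- 1 - \<delta>) * ln (real (Suc n))) + \<i> * of_real (- (u * ln (real (Suc n))))"
        by (simp add: complex_eq_iff del: of_nat_Suc)
      also have "exp \<dots> = of_real (exp ((- 1 - \<delta>) * ln (real (Suc n)))) * cis (- (u * ln (real (Suc n))))"
        by (simp only: exp_add exp_of_real cis_conv_exp)
      finally show ?thesis by (simp add: y_def powr_def)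
    qed
    have z2: "cis (- (2 * t * ln (real (Suc n)))) = z ^ 2"
      by (simp add: z_def Complex.DeMoivre mult.assoc)
    define w where "w = \<psi> (Suc n) * z"
    have A: "?A n = of_real (mangoldt (Suc n) * y) * \<psi>\<^sub>0 (Suc n)"
      using pw[of 0] by (simp add: mult_ac del: of_nat_Suc)
    have B: "?B n = of_real (mangoldt (Suc n) * y) * w"
      using pw[of t] by (simp add: w_def z_def mult_ac del: of_nat_Suc)
    have C: "?C n = of_real (mangoldt (Suc n) * y) * w ^ 2"
      using pw[of "2 * t"] z2 by (simp add: w_def power_mult_distrib mult_ac del: of_nat_Suc)
    have "0 \<le> 3 * Re (\<psi>\<^sub>0 (Suc n)) + 4 * Re w + Re (w ^ 2)"
    proof (cases "coprime (Suc n) d")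
      case True
      then have "norm w = 1" by (simp add: w_def z_def norm_mult dchar_norm[OF \<psi>])
      then have "(Re w)\<^sup>2 + (Im w)\<^sup>2 = 1" by (simp add: cmod_power2[symmetric])
      then have "3 * Re (\<psi>\<^sub>0 (Suc n)) + 4 * Re w + Re (w ^ 2) = 2 * (Re w + 1)\<^sup>2"
        using True by (simp add: \<psi>\<^sub>0_def power2_eq_square algebra_simps)
      then show ?thesis by simp
    next
      case False
      then have "\<psi> (Suc n) = 0" using dchar_nonzero_iff[OF \<psi>] by blast
      then show ?thesis using False by (simp add: w_def \<psi>\<^sub>0_def)
    qed
    moreover have "0 \<le> mangoldt (Suc n) * y" by (simp add: mangoldt_nonneg y_def)
    ultimately have "0 \<le> (mangoldt (Suc n) * y) * (3 * Re (\<psi>\<^sub>0 (Suc n)) + 4 * Re w + Re (w ^ 2))"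
      by (rule mult_nonneg_nonneg[rotated])
    also have "\<dots> = 3 * Re (?A n) + 4 * Re (?B n) + Re (?C n)"
      unfolding A B C by (simp only: times_complex.sel Re_complex_of_real Im_complex_of_real) (simp add: algebra_simps)
    finally show ?thesis .
  qed
  ultimately show ?thesis
    by (metis (no_types, lifting) sums_unique suminf_nonneg sums_iff)
qed

text \<open>Multiply the inequality by \<open>\<delta>\<close> and let \<open>\<delta>\<close> tend to 0.  The principal character contributes its pole at \<open>s = 1\<close>, a zero
of order \<open>m\<close> of \<open>L(s,\<psi>)\<close> at \<open>1 + it\<close> contributes \<open>-4m\<close>, and the last summand is not positive unless
\<open>L(s,\<psi>\<^sup>2)\<close> has a pole at \<open>1 + 2it\<close>.  So \<open>3 - 4m \<ge> 0\<close>, which forces \<open>m = 0\<close>.  The exceptional pole requires \<open>t = 0\<close>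
and \<open>\<psi>\<^sup>2\<close> principal, which is the case of a real character at \<open>s = 1\<close>.\<close>

theorem L_num_nonzero:
  assumes \<psi>: "dchar d \<psi>"
  shows "L_num d \<psi> (Complex 1 t) \<noteq> 0"
proof (cases "t = 0 \<and> (char_mean d \<psi> \<noteq> 0 \<or> char_mean d (\<lambda>n. \<psi> n ^ 2) \<noteq> 0)")
  case True
  show ?thesis
  proof (cases "char_mean d \<psi> = 0")
    case c: False
    have "Complex 1 t = 1" using True by (simp add: complex_eq_iff)
    then show ?thesis using L_num_1[OF c] c by simp
  next
    case c: True
    with True have c2: "char_mean d (\<lambda>n. \<psi> n ^ 2) \<noteq> 0" and z: "Complex 1 t = 1" by (auto simp: complex_eq_iff)
    obtain B where B: "\<And>n. norm (\<Sum>k\<le>n. \<psi> (Suc k) - char_mean d \<psi>) \<le> B" by (rule char_mean_partial_sums[OF \<psi>]) blast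
    have "abel_series \<psi> 1 \<noteq> 0"
    proof (rule real_character_series_at_1[OF \<psi>])
      show "norm (\<Sum>k\<le>n. \<psi> (Suc k)) \<le> B" for n using B[of n] c by simp
      show "\<psi> n ^ 2 = 1" if "coprime n d" for n
        by (rule char_mean_nonzero_imp_trivial[OF dchar_square[OF \<psi>] c2 that])
    qed
    then show ?thesis by (simp add: L_num_def c z)
  qed
next
  case False
  define \<psi>\<^sub>0 where "\<psi>\<^sub>0 = (\<lambda>n. if coprime n d then 1 else 0 :: complex)"
  have d: "0 < d" by (rule dchar_pos[OF \<psi>])
  have \<psi>0: "dchar d \<psi>\<^sub>0" unfolding \<psi>\<^sub>0_def by (rule dchar_principal[OF d])
  have c0: "char_mean d \<psi>\<^sub>0 \<noteq> 0" unfolding \<psi>\<^sub>0_def by (rule char_mean_principal[OF d])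
  have one: "Complex 1 0 = 1" by (simp add: complex_eq_iff)
  obtain m0 :: nat where m0: "m0 = 0 \<longleftrightarrow> L_num d \<psi>\<^sub>0 (Complex 1 0) \<noteq> 0"
    and l0: "((\<lambda>\<delta>::real. of_real \<delta> * dseries (\<lambda>n. mangoldt n * \<psi>\<^sub>0 n) (Complex 1 0 + of_real \<delta>)) \<longlongrightarrow>
      (if char_mean d \<psi>\<^sub>0 \<noteq> 0 \<and> (0::real) = 0 then 1 else 0) - of_nat m0) (at_right 0)"
    using mangoldt_series_residue[OF \<psi>0, of 0] by (elim exE conjE)
  obtain m1 :: nat where m1: "m1 = 0 \<longleftrightarrow> L_num d \<psi> (Complex 1 t) \<noteq> 0"
    and l1: "((\<lambda>\<delta>::real. of_real \<delta> * dseries (\<lambda>n. mangoldt n * \<psi> n) (Complex 1 t + of_real \<delta>)) \<longlongrightarrow>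
      (if char_mean d \<psi> \<noteq> 0 \<and> t = 0 then 1 else 0) - of_nat m1) (at_right 0)"
    using mangoldt_series_residue[OF \<psi>, of t] by (elim exE conjE)
  obtain m2 :: nat where
    l2: "((\<lambda>\<delta>::real. of_real \<delta> * dseries (\<lambda>n. mangoldt n * \<psi> n ^ 2) (Complex 1 (2 * t) + of_real \<delta>)) \<longlongrightarrow>
      (if char_mean d (\<lambda>n. \<psi> n ^ 2) \<noteq> 0 \<and> 2 * t = 0 then 1 else 0) - of_nat m2) (at_right 0)"
    using mangoldt_series_residue[OF dchar_square[OF \<psi>], of "2 * t"] by (elim exE conjE)
  have m0z: "m0 = 0" using m0 c0 L_num_1[OF c0] one by simp
  from False have z1: "(if char_mean d \<psi> \<noteq> 0 \<and> t = 0 then 1 else 0 :: complex) = 0"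
    and z2: "(if char_mean d (\<lambda>n. \<psi> n ^ 2) \<noteq> 0 \<and> 2 * t = 0 then 1 else 0 :: complex) = 0" by auto
  have r0: "((\<lambda>\<delta>::real. \<delta> * Re (dseries (\<lambda>n. mangoldt n * \<psi>\<^sub>0 n) (Complex 1 0 + of_real \<delta>))) \<longlongrightarrow> 1) (at_right 0)"
    using tendsto_Re[OF l0] c0 m0z by simp
  have r1: "((\<lambda>\<delta>::real. \<delta> * Re (dseries (\<lambda>n. mangoldt n * \<psi> n) (Complex 1 t + of_real \<delta>))) \<longlongrightarrow> - real m1) (at_right 0)"
    using tendsto_Re[OF l1[unfolded z1]] by simp
  have r2: "((\<lambda>\<delta>::real. \<delta> * Re (dseries (\<lambda>n. mangoldt n * \<psi> n ^ 2) (Complex 1 (2 * t) + of_real \<delta>))) \<longlongrightarrow> - real m2) (at_right 0)"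
    using tendsto_Re[OF l2[unfolded z2]] by simp
  have lim: "((\<lambda>\<delta>::real. 3 * (\<delta> * Re (dseries (\<lambda>n. mangoldt n * \<psi>\<^sub>0 n) (Complex 1 0 + of_real \<delta>)))
     + 4 * (\<delta> * Re (dseries (\<lambda>n. mangoldt n * \<psi> n) (Complex 1 t + of_real \<delta>)))
     + \<delta> * Re (dseries (\<lambda>n. mangoldt n * \<psi> n ^ 2) (Complex 1 (2 * t) + of_real \<delta>))) \<longlongrightarrow> 3 * 1 + 4 * (- real m1) + - real m2) (at_right 0)"
    by (intro tendsto_add tendsto_mult tendsto_const r0 r1 r2)
  have "0 \<le> 3 * 1 + 4 * (- real m1) + - real m2"
  proof (rule tendsto_lowerbound[OF lim])
    show "\<forall>\<^sub>F \<delta> in at_right 0. 0 \<le> 3 * (\<delta> * Re (dseries (\<lambda>n. mangoldt n * \<psi>\<^sub>0 n) (Complex 1 0 + of_real \<delta>)))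
     + 4 * (\<delta> * Re (dseries (\<lambda>n. mangoldt n * \<psi> n) (Complex 1 t + of_real \<delta>)))
     + \<delta> * Re (dseries (\<lambda>n. mangoldt n * \<psi> n ^ 2) (Complex 1 (2 * t) + of_real \<delta>))"
      using eventually_at_right_less[of "0::real"]
    proof eventually_elim
      case (elim \<delta>)
      from mult_nonneg_nonneg[OF less_imp_le[OF elim] three_four_one[OF \<psi> elim, of t]]
      show ?case unfolding \<psi>\<^sub>0_def by (simp only: distrib_left mult.left_commute)
    qed
  qed simp
  then have "m1 = 0" by linarith
  with m1 show ?thesis by simp
qed

lemma moebius_character_mean:
  assumes \<psi>: "dchar d \<psi>"
  shows "(\<lambda>N. (\<Sum>n=1..N. of_int (moebius_mu n) * \<psi> n) / of_nat N) \<longlonglongrightarrow> 0"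
proof (rule mean_tendsto_0_of_dirichlet_series)
  show le: "norm (of_int (moebius_mu n) * \<psi> n) \<le> 1" for n
    using mult_mono[OF norm_moebius_mu_le dchar_norm_le[OF \<psi>]] by (simp add: norm_mult)
  define F where "F s = (if char_mean d \<psi> = 0 then 1 else s - 1) / L_num d \<psi> s" for s
  have nz: "L_num d \<psi> s \<noteq> 0" if "1 \<le> Re s" for s
  proof (cases "Re s = 1")
    case True
    then have "s = Complex 1 (Im s)" by (simp add: complex_eq_iff)
    then show ?thesis using L_num_nonzero[OF \<psi>] by metis
  next
    case False
    with that have s: "1 < Re s" "s \<noteq> 1" by auto
    then show ?thesis using L_num_eq[OF \<psi> s(1)] dseries_char_nonzero[OF \<psi> s(1)] by auto
  qed
  have "continuous_on {s. 1 \<le> Re s} (L_num d \<psi>)"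
    by (rule continuous_on_subset[OF holomorphic_on_imp_continuous_on[OF L_num_holomorphic[OF \<psi>]]]) auto
  then show "continuous_on {s. 1 \<le> Re s} F"
    unfolding F_def using nz by (cases "char_mean d \<psi> = 0") (auto intro!: continuous_intros)
  fix s :: complex assume s: "1 < Re s"
  then have s1: "s \<noteq> 1" by auto
  have "dseries (\<lambda>n. of_int (moebius_mu n) * \<psi> n) s = F s"
    using dseries_moebius[OF \<psi> s] dseries_char_nonzero[OF \<psi> s] s1 unfolding F_def L_num_eq[OF \<psi> s]
    by (auto simp: field_simps)
  then show "(\<lambda>n. of_int (moebius_mu (Suc n)) * \<psi> (Suc n) * of_nat (Suc n) powr - s) sums F s"
    using dseries_sums[OF dsummable_bounded[of "\<lambda>n. of_int (moebius_mu n) * \<psi> n", OF le s]] by (simp only:)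
qed

text \<open>The prime number theorem in arithmetic progressions, in terms of the Moebius function.\<close>

theorem moebius_periodic_mean:
  fixes f :: "nat \<Rightarrow> complex"
  assumes "0 < d" "\<And>n. f (n + d) = f n"
  shows "(\<lambda>N. (\<Sum>n=1..N. of_int (moebius_mu n) * f n) / of_nat N) \<longlonglongrightarrow> 0"
  using assms by (rule moebius_mean_periodic) (rule moebius_character_mean)

section \<open>Multiples by many primes\<close>

lemma real_nat_div_le: "real (n div k) \<le> real n / real k"
proof (cases "k = 0")
  case False
  have "n div k * k \<le> n" by (rule div_times_less_eq_dividend)
  then have "real (n div k) * real k \<le> real n" unfolding of_nat_mult[symmetric] of_nat_le_iff .
  then show ?thesis using False by (simp add: pos_le_divide_eq)
qed simp

lemma real_nat_div_ge: "0 < k \<Longrightarrow> real n / real k - 1 \<le> real (n div k)"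
proof -
  assume k: "0 < k"
  have "n < (n div k + 1) * k" using k dividend_less_times_div[of k n] by (simp add: mult.commute)
  then have "real n < real ((n div k + 1) * k)" unfolding of_nat_less_iff .
  then have "real n < (real (n div k) + 1) * real k" by (simp add: algebra_simps)
  then show ?thesis using k by (simp add: pos_divide_less_eq[symmetric])
qed

text \<open>Erdos's proof.  If the series converged, then a finite set \<open>P\<^sub>0\<close> of \<open>k\<close> primes could be chosen such that the other
primes contribute less than 1/2.  Up to \<open>N\<close>, fewer than \<open>N/2\<close> numbers are divisible by one of the other primes, and at most
\<open>2\<^sup>k \<surd>N\<close> numbers have all their prime factors in \<open>P\<^sub>0\<close>: each is a square times a squarefree product of such primes.
For \<open>N = 4\<^bsup>k+1\<^esup>\<close> these are too few.\<close>

lemma prime_reciprocals_unbounded: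
  "\<exists>P. finite P \<and> (\<forall>p\<in>P. prime p) \<and> C < (\<Sum>p\<in>P. 1 / real p)"
proof (rule ccontr)
  assume "\<not> ?thesis"
  then have le: "(\<Sum>p\<in>P. 1 / real p) \<le> C" if "finite P" "\<forall>p\<in>P. prime p" for P
    using that by (auto simp: not_less)
  define A where "A = {\<Sum>p\<in>P. 1 / real p | P. finite P \<and> (\<forall>p\<in>P. prime p)}"
  have A: "A \<noteq> {}" "bdd_above A"
    using le by (auto simp: A_def intro!: bdd_aboveI[of _ C] exI[of _ "{}"])
  have "Sup A - 1/2 < Sup A" by simp
  then obtain a where "a \<in> A" "Sup A - 1/2 < a" using less_cSupE[OF _ A(1)] by blast
  then obtain P\<^sub>0 where P0: "finite P\<^sub>0" "\<forall>p\<in>P\<^sub>0. prime p" "Sup A - 1/2 < (\<Sum>p\<in>P\<^sub>0. 1 / real p)"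
    by (auto simp: A_def)
  define k where "k = card P\<^sub>0"
  define M where "M = (2::nat) ^ (k + 1)"
  define N where "N = M ^ 2"
  define P where "P = {p. prime p \<and> p \<le> N} - P\<^sub>0"
  have P: "finite P" "\<forall>p\<in>P. prime p" by (auto simp: P_def)
  have "(\<Sum>p\<in>P\<^sub>0 \<union> P. 1 / real p) \<le> Sup A"
    using P0 P by (intro cSup_upper A) (auto simp: A_def)
  moreover have "(\<Sum>p\<in>P\<^sub>0 \<union> P. 1 / real p) = (\<Sum>p\<in>P\<^sub>0. 1 / real p) + (\<Sum>p\<in>P. 1 / real p)"
    by (rule sum.union_disjoint[OF P0(1) P(1)]) (simp add: P_def)
  ultimately have tail: "(\<Sum>p\<in>P. 1 / real p) < 1/2" using P0(3) by linarith
  define U where "U = {n\<in>{1..N}. \<exists>p\<in>P. p dvd n}"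
  define V where "V = {n\<in>{1..N}. \<forall>p. prime p \<longrightarrow> p dvd n \<longrightarrow> p \<in> P\<^sub>0}"
  have "{1..N} \<subseteq> U \<union> V"
  proof
    fix n assume n: "n \<in> {1..N}"
    show "n \<in> U \<union> V"
    proof (cases "n \<in> V")
      case False
      then obtain p where "prime p" "p dvd n" "p \<notin> P\<^sub>0" using n by (auto simp: V_def)
      moreover from this n have "p \<le> N" using dvd_imp_le[of p n] by auto
      ultimately show ?thesis using n by (auto simp: U_def P_def)
    qed simp
  qed
  moreover have "finite U" "finite V" by (auto simp: U_def V_def)
  ultimately have "N \<le> card (U \<union> V)" using card_mono[of "U \<union> V" "{1..N}"] by simp
  also have "\<dots> \<le> card U + card V" by (rule card_Un_le)
  finally have NUV: "real N \<le> real (card U) + real (card V)" by linarith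
  have N0: "0 < N" by (simp add: N_def M_def)
  have "real (card U) \<le> (\<Sum>p\<in>P. real N / real p)"
  proof -
    have "U \<subseteq> (\<Union>p\<in>P. (\<lambda>m. p * m) ` {1..N div p})"
    proof
      fix n assume "n \<in> U"
      then obtain p where p: "p \<in> P" "p dvd n" "n \<in> {1..N}" by (auto simp: U_def)
      then obtain m where m: "n = p * m" by (elim dvdE)
      have p0: "0 < p" using p P prime_gt_0_nat by blast
      have mm: "m \<in> {1..N div p}" using p m p0 by (auto simp: less_eq_div_iff_mult_less_eq mult.commute intro: Nat.gr0I)
      show "n \<in> (\<Union>p\<in>P. (\<lambda>m. p * m) ` {1..N div p})"
        by (rule UN_I[OF p(1)]) (rule image_eqI[where f = "\<lambda>m. p * m", OF m mm])
    qed
    then have "card U \<le> card (\<Union>p\<in>P. (\<lambda>m. p * m) ` {1..N div p})"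
      by (intro card_mono) (use P in auto)
    also have "\<dots> \<le> (\<Sum>p\<in>P. card ((\<lambda>m. p * m) ` {1..N div p}))" using P by (intro card_UN_le) auto
    also have "\<dots> \<le> (\<Sum>p\<in>P. N div p)" by (intro sum_mono order.trans[OF card_image_le]) auto
    finally have "real (card U) \<le> (\<Sum>p\<in>P. real (N div p))" by (simp flip: of_nat_sum)
    also have "\<dots> \<le> (\<Sum>p\<in>P. real N / real p)" by (intro sum_mono real_nat_div_le)
    finally show ?thesis .
  qed
  also have "\<dots> = real N * (\<Sum>p\<in>P. 1 / real p)" by (simp add: sum_distrib_left)
  also have "\<dots> < real N * (1/2)" using tail N0 by (intro mult_strict_left_mono) auto
  finally have U: "real (card U) < real N / 2" by simp
  have "card V \<le> card (Pow P\<^sub>0 \<times> {1..M})"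
  proof (rule card_inj_on_le)
    let ?f = "\<lambda>n. ({p\<in>P\<^sub>0. odd (multiplicity p n)}, square_part n)"
    show "inj_on ?f V"
    proof (rule inj_onI)
      fix m n assume mn: "m \<in> V" "n \<in> V" "?f m = ?f n"
      have mult: "multiplicity p (squarefree_part m) = multiplicity p (squarefree_part n)" if p: "prime p" for p
      proof (cases "p \<in> P\<^sub>0")
        case True
        with mn have "odd (multiplicity p m) \<longleftrightarrow> odd (multiplicity p n)" by blast
        then show ?thesis using p by (simp add: prime_multiplicity_squarefree_part mod_2_eq_odd)
      next
        case False
        with mn p have "\<not> p dvd m" "\<not> p dvd n" by (auto simp: V_def)
        then show ?thesis using p by (simp add: prime_multiplicity_squarefree_part not_dvd_imp_multiplicity_0)
      qed
      have "0 < squarefree_part m" "0 < squarefree_part n"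
        by (metis neq0_conv squarefree_part_nonzero)+
      then have eq: "squarefree_part m = squarefree_part n"
        by (rule multiplicity_eq_nat) (rule mult)
      have "square_part m = square_part n" using mn(3) by simp
      then show "m = n" using eq by (rule squarefree_decomposition_unique)
    qed
    show "?f ` V \<subseteq> Pow P\<^sub>0 \<times> {1..M}"
    proof
      fix y assume "y \<in> ?f ` V"
      then obtain n where n: "n \<in> V" "y = ?f n" by auto
      then have n0: "1 \<le> n" "n \<le> N" by (auto simp: V_def)
      have dec: "n = squarefree_part n * square_part n ^ 2" by (rule squarefree_decompose)
      have "squarefree_part n \<noteq> 0" by simp
      then have "square_part n ^ 2 \<le> n" using dec by (metis mult_le_mono1 mult_1 One_nat_def Suc_leI neq0_conv)
      then have "square_part n ^ 2 \<le> M ^ 2" using n0 unfolding N_def by linarith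
      then have "square_part n \<le> M" by (simp add: power2_nat_le_eq_le)
      moreover have "square_part n \<noteq> 0" using dec n0 by (metis not_one_le_zero mult_0_right power_zero_numeral)
      then have "square_part n \<in> {1..M}" using \<open>square_part n \<le> M\<close> by (metis One_nat_def Suc_leI atLeastAtMost_iff neq0_conv)
      ultimately show "y \<in> Pow P\<^sub>0 \<times> {1..M}" using n by auto
    qed
  qed (use P0 in auto)
  also have "\<dots> = 2 ^ k * M" using P0 by (simp add: card_cartesian_product card_Pow k_def)
  finally have "real (card V) \<le> real (2 ^ k * M)" by linarith
  also have "\<dots> = real N / 2" by (simp add: N_def M_def power2_eq_square)
  finally show False using NUV U by linarith
qed

lemma sum_inverse_squares_le:
  assumes "finite P" "\<And>p. p \<in> P \<Longrightarrow> 2 \<le> p"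
  shows "(\<Sum>p\<in>P. 1 / (real p)\<^sup>2) \<le> 1"
proof -
  have tele: "(\<Sum>p\<in>{2..M}. 1 / (real p)\<^sup>2) \<le> 1 - 1 / real (Suc M) + 1 / real (Suc M)" for M
  proof -
    have "(\<Sum>p\<in>{2..Suc M}. 1 / (real p)\<^sup>2) \<le> 1 - 1 / real (Suc M)" for M
    proof (induction M)
      case (Suc M)
      have "1 / (real (Suc (Suc M)))\<^sup>2 \<le> 1 / (real (Suc M) * real (Suc (Suc M)))"
        by (intro divide_left_mono) (auto simp: power2_eq_square)
      also have "\<dots> = 1 / real (Suc M) - 1 / real (Suc (Suc M))" by (simp add: field_simps)
      finally show ?case using Suc by (simp add: sum.atLeast_Suc_atMost_Suc_shift[symmetric])
    qed simp
    moreover have "(\<Sum>p\<in>{2..M}. 1 / (real p)\<^sup>2) \<le> (\<Sum>p\<in>{2..Suc M}. 1 / (real p)\<^sup>2)"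
      by (intro sum_mono2) auto
    ultimately show ?thesis
      by (smt (verit) divide_nonneg_nonneg of_nat_0_le_iff)
  qed
  have "(\<Sum>p\<in>P. 1 / (real p)\<^sup>2) \<le> (\<Sum>p\<in>{2..Max (insert 2 P)}. 1 / (real p)\<^sup>2)"
    using assms by (intro sum_mono2) (auto intro: Max_ge)
  then show ?thesis using tele[of "Max (insert 2 P)"] by simp
qed

lemma card_multiples:
  assumes "0 < k"
  shows "card {n\<in>{1..N}. k dvd n} = N div k"
proof -
  have "{n\<in>{1..N}. k dvd n} = (\<lambda>m. k * m) ` {1..N div k}"
  proof (intro equalityI subsetI)
    fix n assume "n \<in> {n\<in>{1..N}. k dvd n}"
    then obtain m where m: "n = k * m" "1 \<le> n" "n \<le> N" by auto
    then have "m \<in> {1..N div k}" using assms by (auto simp: less_eq_div_iff_mult_less_eq mult.commute intro: Nat.gr0I)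
    with m show "n \<in> (\<lambda>m. k * m) ` {1..N div k}" by auto
  qed (use assms in \<open>auto simp: less_eq_div_iff_mult_less_eq mult.commute\<close>)
  then show ?thesis using assms by (simp add: card_image inj_on_def)
qed

text \<open>The variance of the number of prime factors in \<open>P\<close>: it is of the order of the mean \<open>S\<close> and not of \<open>S\<^sup>2\<close>, because
divisibility by different primes is almost independent.\<close>

lemma turan_kubilius:
  fixes P :: "nat set"
  assumes P: "finite P" "\<And>p. p \<in> P \<Longrightarrow> prime p"
  defines "S \<equiv> \<Sum>p\<in>P. 1 / real p"
  shows "(\<Sum>n=1..N. (S - (\<Sum>p\<in>P. of_bool (p dvd n)))\<^sup>2) \<le> real N * S + 2 * S * real (card P)"
proof -
  define w where "w n = (\<Sum>p\<in>P. of_bool (p dvd n) :: real)" for n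
  have cnt: "(\<Sum>n=1..N. of_bool (k dvd n) :: real) = real (N div k)" if "0 < k" for k
    using card_multiples[OF that, of N] by (simp add: of_bool_def sum.If_cases Int_def)
  have p0: "p \<in> P \<Longrightarrow> 0 < p" for p using P(2) prime_gt_0_nat by blast
  have S0: "0 \<le> S" by (simp add: S_def sum_nonneg)
  have w1: "real N * S - real (card P) \<le> (\<Sum>n=1..N. w n)"
  proof -
    have "real N * S - real (card P) = (\<Sum>p\<in>P. real N / real p - 1)"
      by (simp add: S_def sum_distrib_left sum_subtractf)
    also have "\<dots> \<le> (\<Sum>p\<in>P. real (N div p))"
      using p0 by (intro sum_mono real_nat_div_ge) auto
    also have "\<dots> = (\<Sum>p\<in>P. \<Sum>n=1..N. of_bool (p dvd n))" using cnt p0 by simp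
    also have "\<dots> = (\<Sum>n=1..N. w n)" unfolding w_def by (rule sum.swap)
    finally show ?thesis .
  qed
  have w2: "(\<Sum>n=1..N. (w n)\<^sup>2) \<le> real N * S\<^sup>2 + real N * S"
  proof -
    have "(\<Sum>n=1..N. (w n)\<^sup>2) = (\<Sum>n=1..N. \<Sum>p\<in>P. \<Sum>q\<in>P. of_bool (p dvd n) * of_bool (q dvd n))"
      by (simp add: w_def power2_eq_square sum_product)
    also have "\<dots> = (\<Sum>p\<in>P. \<Sum>q\<in>P. \<Sum>n=1..N. of_bool (p dvd n) * of_bool (q dvd n))"
      by (subst sum.swap) (intro sum.cong refl sum.swap)
    also have "\<dots> \<le> (\<Sum>p\<in>P. \<Sum>q\<in>P. real N * (1 / real p * (1 / real q)) + (if p = q then real N / real p else 0))"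
    proof (intro sum_mono)
      fix p q assume pq: "p \<in> P" "q \<in> P"
      show "(\<Sum>n=1..N. of_bool (p dvd n) * of_bool (q dvd n)) \<le> real N * (1 / real p * (1 / real q)) + (if p = q then real N / real p else 0)"
      proof (cases "p = q")
        case True
        have "(\<Sum>n=1..N. of_bool (p dvd n) * of_bool (q dvd n)) = real (N div p)"
          using True cnt[of p] p0 pq by (simp flip: of_bool_conj)
        also have "\<dots> \<le> real N / real p" by (rule real_nat_div_le)
        finally show ?thesis using True by (simp add: add_increasing)
      next
        case False
        then have "coprime p q" using P pq primes_coprime by blast
        then have "p dvd n \<and> q dvd n \<longleftrightarrow> p * q dvd n" for n
          by (meson divides_mult dvd_mult_left dvd_mult_right)
        then have "(\<Sum>n=1..N. of_bool (p dvd n) * of_bool (q dvd n)) = (\<Sum>n=1..N. of_bool (p * q dvd n) :: real)"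
          by (intro sum.cong) (auto simp flip: of_bool_conj)
        also have "\<dots> = real (N div (p * q))" using p0 pq by (intro cnt) auto
        also have "\<dots> \<le> real N / real (p * q)" by (rule real_nat_div_le)
        finally show ?thesis using False by simp
      qed
    qed
    also have "\<dots> = (\<Sum>p\<in>P. (real N * (1 / real p)) * S + real N * (1 / real p))"
      using P(1) by (intro sum.cong) (auto simp: sum.distrib S_def sum_distrib_left mult.assoc sum.delta)
    also have "\<dots> = (\<Sum>p\<in>P. real N * (1 / real p)) * S + (\<Sum>p\<in>P. real N * (1 / real p))"
      by (simp only: sum.distrib sum_distrib_right[symmetric])
    also have "(\<Sum>p\<in>P. real N * (1 / real p)) = real N * S"
      by (simp only: S_def sum_distrib_left)
    finally show ?thesis by (simp add: power2_eq_square mult.assoc)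
  qed
  have "(\<Sum>n=1..N. (S - w n)\<^sup>2) = real N * S\<^sup>2 - 2 * S * (\<Sum>n=1..N. w n) + (\<Sum>n=1..N. (w n)\<^sup>2)"
    by (simp add: power2_diff sum.distrib sum_subtractf sum_distrib_left)
  also have "\<dots> \<le> real N * S\<^sup>2 - 2 * S * (real N * S - real (card P)) + (real N * S\<^sup>2 + real N * S)"
    using w2 mult_left_mono[OF w1, of "2 * S"] S0 by simp
  also have "\<dots> = real N * S + 2 * S * real (card P)"
    by (simp add: algebra_simps power2_eq_square)
  finally show ?thesis by (simp add: w_def)
qed

lemma sum_le_sqrt_sum_squares:
  fixes a :: "nat \<Rightarrow> real"
  shows "(\<Sum>n=1..N. a n) \<le> sqrt (real N * (\<Sum>n=1..N. (a n)\<^sup>2))"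
proof -
  have "(\<Sum>n=1..N. 1 * a n)\<^sup>2 \<le> (\<Sum>n=1..N. 1\<^sup>2) * (\<Sum>n=1..N. (a n)\<^sup>2)"
    by (rule Cauchy_Schwarz_ineq_sum)
  then show ?thesis by (intro real_le_rsqrt) simp
qed

text \<open>Katai's criterion for the Moebius function.  Most \<open>n\<close> have about \<open>S\<close> prime factors in \<open>P\<close>, so \<open>S\<close> times the sum is close to the
sum weighted by the number of these prime factors, which runs over multiples \<open>n = p m\<close> with \<open>p \<in> P\<close>.  There \<open>\<mu>(p m) = -\<mu>(m)\<close> unless \<open>p\<close>
divides \<open>m\<close>.  After an exchange of the summations, the Cauchy-Schwarz inequality removes \<open>\<mu>(m)\<close>, and what remains are the
correlations of \<open>z\<^bsup>pm\<^esup>\<close> and \<open>z\<^bsup>qm\<^esup>\<close>.  The diagonal terms contribute \<open>N \<surd>S\<close>, a saving of \<open>\<surd>S\<close> over the trivial bound.\<close>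

lemma katai_bound:
  fixes P :: "nat set" and z :: complex
  assumes P: "finite P" "\<And>p. p \<in> P \<Longrightarrow> prime p" and z: "norm z = 1"
  defines "S \<equiv> \<Sum>p\<in>P. 1 / real p"
  assumes S1: "1 \<le> S" and N: "2 * card P \<le> N" and D: "0 \<le> D"
    and corr: "\<And>p q M. p \<in> P \<Longrightarrow> q \<in> P \<Longrightarrow> p \<noteq> q \<Longrightarrow> norm (\<Sum>m=1..M. z ^ (p * m) * cnj (z ^ (q * m))) \<le> D"
  shows "norm (\<Sum>n=1..N. of_int (moebius_mu n) * z ^ n) \<le> 4 * real N / sqrt S + real (card P) * sqrt (real N * D)"
proof -
  let ?\<mu> = "\<lambda>n. of_int (moebius_mu n) :: complex"
  have p0: "p \<in> P \<Longrightarrow> 0 < p" for p using P(2) prime_gt_0_nat by blast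
  have zn: "norm (z ^ k) = 1" for k by (simp add: norm_power z)
  define w where "w n = (\<Sum>p\<in>P. of_bool (p dvd n) :: real)" for n
  define A where "A = (\<Sum>n=1..N. ?\<mu> n * z ^ n)"
  define T where "T = (\<Sum>p\<in>P. \<Sum>m=1..N div p. ?\<mu> m * z ^ (p * m))"
  \<comment> \<open>The Turan-Kubilius inequality replaces the constant weight \<open>S\<close> by the number of prime factors in \<open>P\<close>.\<close>
  have step1: "norm (of_real S * A - (\<Sum>n=1..N. ?\<mu> n * z ^ n * of_real (w n))) \<le> sqrt (real N * (real N * S + 2 * S * real (card P)))"
  proof -
    have "of_real S * A - (\<Sum>n=1..N. ?\<mu> n * z ^ n * of_real (w n)) = (\<Sum>n=1..N. ?\<mu> n * z ^ n * of_real (S - w n))"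
      by (simp add: A_def sum_distrib_left sum_subtractf[symmetric] algebra_simps)
    also have "norm \<dots> \<le> (\<Sum>n=1..N. \<bar>S - w n\<bar>)"
    proof (rule sum_norm_le)
      fix n
      show "norm (?\<mu> n * z ^ n * of_real (S - w n)) \<le> \<bar>S - w n\<bar>"
        using norm_moebius_mu_le[of n, where 'a = complex]
        by (simp add: norm_mult zn mult_left_le_one_le del: of_real_diff)
    qed
    also have "\<dots> \<le> sqrt (real N * (\<Sum>n=1..N. \<bar>S - w n\<bar>\<^sup>2))" by (rule sum_le_sqrt_sum_squares)
    also have "\<dots> \<le> sqrt (real N * (real N * S + 2 * S * real (card P)))"
      using turan_kubilius[OF P, of N] by (intro real_sqrt_le_mono mult_left_mono) (simp_all add: w_def S_def)
    finally show ?thesis .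
  qed
  \<comment> \<open>The error comes from the \<open>m\<close> that are divisible by \<open>p\<close>; there are at most \<open>N \<Sum>1/p\<^sup>2 \<le> N\<close> of them.\<close>
  have step2: "norm ((\<Sum>n=1..N. ?\<mu> n * z ^ n * of_real (w n)) + T) \<le> real N"
  proof -
    have "(\<Sum>n=1..N. ?\<mu> n * z ^ n * of_real (w n)) = (\<Sum>p\<in>P. \<Sum>n=1..N. ?\<mu> n * z ^ n * of_bool (p dvd n))"
      unfolding w_def of_real_sum sum_distrib_left
      by (subst sum.swap) (intro sum.cong refl, simp add: of_bool_def)
    also have "\<dots> = (\<Sum>p\<in>P. \<Sum>m=1..N div p. ?\<mu> (p * m) * z ^ (p * m))"
    proof (rule sum.cong[OF refl])
      fix p assume p: "p \<in> P"
      have img: "{n\<in>{1..N}. p dvd n} = (\<lambda>m. p * m) ` {1..N div p}"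
      proof (intro equalityI subsetI)
        fix n assume "n \<in> {n\<in>{1..N}. p dvd n}"
        then obtain m where m: "n = p * m" "1 \<le> n" "n \<le> N" by auto
        then have "m \<in> {1..N div p}" using p0[OF p] by (auto simp: less_eq_div_iff_mult_less_eq mult.commute intro: Nat.gr0I)
        with m show "n \<in> (\<lambda>m. p * m) ` {1..N div p}" by auto
      qed (use p0[OF p] in \<open>auto simp: less_eq_div_iff_mult_less_eq mult.commute\<close>)
      have "(\<Sum>n=1..N. ?\<mu> n * z ^ n * of_bool (p dvd n)) = (\<Sum>n\<in>{n\<in>{1..N}. p dvd n}. ?\<mu> n * z ^ n)"
        by (rule sum.mono_neutral_cong_right) auto
      also have "\<dots> = (\<Sum>m=1..N div p. ?\<mu> (p * m) * z ^ (p * m))"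
        unfolding img using p0[OF p] by (subst sum.reindex) (auto simp: inj_on_def)
      finally show "(\<Sum>n=1..N. ?\<mu> n * z ^ n * of_bool (p dvd n)) = (\<Sum>m=1..N div p. ?\<mu> (p * m) * z ^ (p * m))" .
    qed
    finally have "(\<Sum>n=1..N. ?\<mu> n * z ^ n * of_real (w n)) + T = (\<Sum>p\<in>P. \<Sum>m=1..N div p. (?\<mu> (p * m) + ?\<mu> m) * z ^ (p * m))"
      by (simp add: T_def sum.distrib[symmetric] distrib_right)
    also have "norm \<dots> \<le> (\<Sum>p\<in>P. \<Sum>m=1..N div p. of_bool (p dvd m))"
    proof (rule sum_norm_le, rule sum_norm_le)
      fix p m assume p: "p \<in> P"
      show "norm ((?\<mu> (p * m) + ?\<mu> m) * z ^ (p * m)) \<le> of_bool (p dvd m)"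
      proof (cases "p dvd m")
        case True
        then have "\<not> coprime p m" using P(2)[OF p] by (metis coprime_absorb_left not_prime_unit)
        then have "moebius_mu (p * m) = 0" by (rule moebius_mu_not_coprime)
        then show ?thesis using True norm_moebius_mu_le[of m, where 'a = complex] by (simp add: norm_mult zn)
      next
        case False
        then show ?thesis using moebius_mu_prime_mult[OF P(2)[OF p] False] by simp
      qed
    qed
    also have "\<dots> = (\<Sum>p\<in>P. real ((N div p) div p))"
      using card_multiples[OF p0] by (intro sum.cong) (auto simp: of_bool_def sum.If_cases Int_def)
    also have "\<dots> \<le> (\<Sum>p\<in>P. real N * (1 / (real p)\<^sup>2))"
    proof (rule sum_mono)
      fix p assume "p \<in> P"
      have "real (N div p div p) \<le> real (N div p) / real p" by (rule real_nat_div_le)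
      also have "\<dots> \<le> real N / real p / real p" by (intro divide_right_mono real_nat_div_le) auto
      finally show "real (N div p div p) \<le> real N * (1 / (real p)\<^sup>2)" by (simp add: power2_eq_square)
    qed
    also have "\<dots> = real N * (\<Sum>p\<in>P. 1 / (real p)\<^sup>2)" by (simp add: sum_distrib_left)
    also have "\<dots> \<le> real N * 1"
      by (intro mult_left_mono sum_inverse_squares_le P prime_ge_2_nat) auto
    finally show ?thesis by simp
  qed
  \<comment> \<open>The Cauchy-Schwarz inequality uses only that \<open>\<mu>\<close> is bounded by 1.\<close>
  have step3: "norm T \<le> sqrt (real N * (real N * S + (real (card P))\<^sup>2 * D))"
  proof -
    define G where "G m = (\<Sum>p\<in>P. of_bool (m \<le> N div p) * z ^ (p * m))" for m
    have Npos: "N div p \<le> N" for p by simp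
    have "T = (\<Sum>p\<in>P. \<Sum>m=1..N. ?\<mu> m * (of_bool (m \<le> N div p) * z ^ (p * m)))"
      unfolding T_def
    proof (rule sum.cong[OF refl])
      fix p
      show "(\<Sum>m=1..N div p. ?\<mu> m * z ^ (p * m)) = (\<Sum>m=1..N. ?\<mu> m * (of_bool (m \<le> N div p) * z ^ (p * m)))"
        using Npos[of p] by (intro sum.mono_neutral_cong_left) auto
    qed
    also have "\<dots> = (\<Sum>m=1..N. ?\<mu> m * G m)"
      unfolding G_def sum_distrib_left by (rule sum.swap)
    finally have "norm T \<le> (\<Sum>m=1..N. norm (G m))"
      using norm_moebius_mu_le[where 'a = complex] by (auto simp: norm_mult intro!: sum_norm_le mult_left_le_one_le)
    also have "\<dots> \<le> sqrt (real N * (\<Sum>m=1..N. (norm (G m))\<^sup>2))" by (rule sum_le_sqrt_sum_squares)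
    also have "\<dots> \<le> sqrt (real N * (real N * S + (real (card P))\<^sup>2 * D))"
    proof (intro real_sqrt_le_mono mult_left_mono)
      have "complex_of_real (\<Sum>m=1..N. (norm (G m))\<^sup>2) = (\<Sum>m=1..N. G m * cnj (G m))"
        by (simp only: of_real_sum complex_norm_square)
      also have "\<dots> = (\<Sum>m=1..N. \<Sum>p\<in>P. \<Sum>q\<in>P. (of_bool (m \<le> N div p) * z ^ (p * m)) * cnj (of_bool (m \<le> N div q) * z ^ (q * m)))"
        by (simp add: G_def sum_product cnj_sum)
      also have "\<dots> = (\<Sum>p\<in>P. \<Sum>q\<in>P. \<Sum>m=1..N. (of_bool (m \<le> N div p) * z ^ (p * m)) * cnj (of_bool (m \<le> N div q) * z ^ (q * m)))"
        by (subst sum.swap) (intro sum.cong refl sum.swap)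
      also have "\<dots> = (\<Sum>p\<in>P. \<Sum>q\<in>P. \<Sum>m=1..min (N div p) (N div q). z ^ (p * m) * cnj (z ^ (q * m)))"
      proof (rule sum.cong[OF refl], rule sum.cong[OF refl])
        fix p q
        show "(\<Sum>m=1..N. (of_bool (m \<le> N div p) * z ^ (p * m)) * cnj (of_bool (m \<le> N div q) * z ^ (q * m)))
          = (\<Sum>m=1..min (N div p) (N div q). z ^ (p * m) * cnj (z ^ (q * m)))"
        proof (rule sum.mono_neutral_cong_right)
          have "min (N div p) (N div q) \<le> N" by (rule min.coboundedI1[OF Npos])
          then show "{1..min (N div p) (N div q)} \<subseteq> {1..N}" by auto
          show "\<forall>m\<in>{1..N} - {1..min (N div p) (N div q)}.
              (of_bool (m \<le> N div p) * z ^ (p * m)) * cnj (of_bool (m \<le> N div q) * z ^ (q * m)) = 0"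
            by (auto simp: of_bool_def)
          show "(of_bool (m \<le> N div p) * z ^ (p * m)) * cnj (of_bool (m \<le> N div q) * z ^ (q * m)) = z ^ (p * m) * cnj (z ^ (q * m))"
            if "m \<in> {1..min (N div p) (N div q)}" for m
            using that by (simp add: of_bool_def)
        qed simp
      qed
      finally have eq: "complex_of_real (\<Sum>m=1..N. (norm (G m))\<^sup>2) = (\<Sum>p\<in>P. \<Sum>q\<in>P. \<Sum>m=1..min (N div p) (N div q). z ^ (p * m) * cnj (z ^ (q * m)))" .
      have "(\<Sum>m=1..N. (norm (G m))\<^sup>2) = norm (complex_of_real (\<Sum>m=1..N. (norm (G m))\<^sup>2))"
        unfolding norm_of_real by (simp add: sum_nonneg)
      also have "\<dots> \<le> (\<Sum>p\<in>P. \<Sum>q\<in>P. (if p = q then real N / real p else 0) + D)"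
        unfolding eq
      proof (rule sum_norm_le, rule sum_norm_le)
        fix p q assume pq: "p \<in> P" "q \<in> P"
        show "norm (\<Sum>m=1..min (N div p) (N div q). z ^ (p * m) * cnj (z ^ (q * m))) \<le> (if p = q then real N / real p else 0) + D"
        proof (cases "p = q")
          case True
          have "norm (\<Sum>m=1..N div p. z ^ (p * m) * cnj (z ^ (p * m))) \<le> (\<Sum>m=1..N div p. 1)"
            by (rule sum_norm_le) (simp add: norm_mult norm_power z)
          also have "\<dots> \<le> real N / real p" by (simp add: real_nat_div_le)
          finally show ?thesis using True D by simp
        next
          case False
          then show ?thesis using corr[OF pq False] by simp
        qed
      qed
      also have "\<dots> = real N * S + (real (card P))\<^sup>2 * D"
        using P(1) by (simp add: sum.distrib S_def sum_distrib_left power2_eq_square sum.delta)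
      finally show "(\<Sum>m=1..N. (norm (G m))\<^sup>2) \<le> real N * S + (real (card P))\<^sup>2 * D" .
    qed simp
    finally show ?thesis .
  qed
  have sS: "1 \<le> sqrt S" using S1 by simp
  have SS: "sqrt S * sqrt S = S" using S1 by simp
  have b3: "sqrt (real N * (real N * S + (real (card P))\<^sup>2 * D)) \<le> real N * sqrt S + real (card P) * sqrt (real N * D)"
  proof -
    have "sqrt (real N * (real N * S + (real (card P))\<^sup>2 * D)) = sqrt ((real N)\<^sup>2 * S + (real (card P))\<^sup>2 * (real N * D))"
      by (simp add: algebra_simps power2_eq_square)
    also have "\<dots> \<le> sqrt ((real N)\<^sup>2 * S) + sqrt ((real (card P))\<^sup>2 * (real N * D))"
      using S1 D by (intro sqrt_add_le_add_sqrt) auto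
    finally show ?thesis by (simp add: real_sqrt_mult)
  qed
  have b1: "sqrt (real N * (real N * S + 2 * S * real (card P))) \<le> 2 * real N * sqrt S"
  proof -
    have "2 * real (card P) \<le> real N" using N by linarith
    then have "S * (2 * real (card P)) \<le> S * real N" using S1 by (intro mult_left_mono) auto
    then have "real N * (real N * S + 2 * S * real (card P)) \<le> real N * (4 * real N * S)"
      using S1 by (intro mult_left_mono) (auto simp: mult_ac)
    then have "sqrt (real N * (real N * S + 2 * S * real (card P))) \<le> sqrt ((2 * real N)\<^sup>2 * S)"
      by (intro real_sqrt_le_mono) (simp add: power2_eq_square mult_ac)
    then show ?thesis by (simp add: real_sqrt_mult)
  qed
  have b2: "real N \<le> real N * sqrt S" using sS by (simp add: mult_le_cancel_left1)
  have "norm (of_real S * A) \<le> norm (of_real S * A - (\<Sum>n=1..N. ?\<mu> n * z ^ n * of_real (w n)))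
      + norm ((\<Sum>n=1..N. ?\<mu> n * z ^ n * of_real (w n)) + T) + norm T"
    using norm_triangle_ineq[of "of_real S * A - (\<Sum>n=1..N. ?\<mu> n * z ^ n * of_real (w n))" "(\<Sum>n=1..N. ?\<mu> n * z ^ n * of_real (w n)) + T - T"]
      norm_triangle_ineq4[of "(\<Sum>n=1..N. ?\<mu> n * z ^ n * of_real (w n)) + T" T] by simp
  then have "S * norm A \<le> 2 * real N * sqrt S + real N * sqrt S + (real N * sqrt S + real (card P) * sqrt (real N * D))"
    using step1 step2 step3 b1 b2 b3 S1 by (simp add: norm_mult)
  also have "\<dots> \<le> S * (4 * real N / sqrt S + real (card P) * sqrt (real N * D))"
  proof -
    have 1: "S / sqrt S = sqrt S" using S1 by (simp add: real_div_sqrt)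
    have "S * (4 * real N / sqrt S) = 4 * real N * (S / sqrt S)" by simp
    then have "S * (4 * real N / sqrt S) = 4 * real N * sqrt S" by (simp only: 1)
    moreover have "1 * (real (card P) * sqrt (real N * D)) \<le> S * (real (card P) * sqrt (real N * D))"
      using S1 D by (intro mult_right_mono) auto
    ultimately show ?thesis by (simp add: distrib_left)
  qed
  finally show ?thesis using S1 by (simp add: A_def)
qed

section \<open>Uniform cancellation in exponential sums\<close>

lemma geometric_sum_bound:
  fixes w :: complex
  assumes w: "norm w = 1" and c: "0 < c" "c \<le> norm (1 - w)"
  shows "norm (\<Sum>m=1..M. w ^ m) \<le> 2 / c"
proof -
  have "w \<noteq> 1" using c by auto
  have "(\<Sum>m=1..M. w ^ m) = w * (\<Sum>m<M. w ^ m)"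
    by (simp add: sum.atLeast1_atMost_eq sum_distrib_left)
  also have "\<dots> = w * ((w ^ M - 1) / (w - 1))"
    by (simp only: geometric_sum[OF \<open>w \<noteq> 1\<close>])
  also have "norm \<dots> = norm (w ^ M - 1) / norm (1 - w)"
    by (simp add: norm_mult norm_divide w norm_minus_commute)
  also have "\<dots> \<le> 2 / c"
  proof (rule frac_le)
    show "norm (w ^ M - 1) \<le> 2"
      using norm_triangle_ineq4[of "w ^ M" 1] by (simp add: norm_power w)
  qed (use c in auto)
  finally show ?thesis .
qed

text \<open>Here \<open>u\<close> is the \<open>k\<close>-th root of \<open>y = z\<^sup>k\<close> with the smallest argument.  As \<open>\<bar>arg y\<bar> < \<pi>/2\<close>, the powers \<open>u\<^sup>j\<close> with \<open>j < k\<close> have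
nonnegative real part, so that \<open>1 - y = (1 - u) (1 + u + \<dots> + u\<^bsup>k-1\<^esup>)\<close> has a second factor of modulus at least 1.\<close>

lemma near_root_of_unity:
  fixes z :: complex
  assumes z: "norm z = 1" and k: "0 < k" and near: "norm (1 - z ^ k) < 1"
  obtains w u where "z = w * u" "w ^ k = 1" "norm u = 1" "norm (1 - u) \<le> norm (1 - z ^ k)"
proof -
  define y where "y = z ^ k"
  define \<phi> where "\<phi> = Arg y"
  define u where "u = cis (\<phi> / k)"
  have ny: "norm y = 1" by (simp add: y_def norm_power z)
  have "Re (1 - y) < 1" using near complex_Re_le_cmod[of "1 - y"] unfolding y_def by linarith
  then have "\<bar>\<phi>\<bar> < pi / 2" unfolding \<phi>_def Arg_Re_pos by simp
  have "y \<noteq> 0" using ny by auto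
  then have y: "y = cis \<phi>" using ny cis_Arg[of y] by (simp add: \<phi>_def sgn_eq)
  have uk: "u ^ k = y" using k by (simp add: u_def y Complex.DeMoivre)
  have "0 \<le> Re (u ^ j)" if "j < k" for j
  proof -
    have "\<bar>real j * (\<phi> / k)\<bar> = \<bar>\<phi>\<bar> * (real j / real k)" by (simp add: abs_mult)
    also have "\<dots> \<le> \<bar>\<phi>\<bar> * 1" using that by (intro mult_left_mono) auto
    finally have "\<bar>real j * (\<phi> / k)\<bar> \<le> \<bar>\<phi>\<bar> * 1" .
    then have "- (pi / 2) \<le> real j * (\<phi> / k)" "real j * (\<phi> / k) \<le> pi / 2"
      using \<open>\<bar>\<phi>\<bar> < pi / 2\<close> by linarith+
    then have "0 \<le> cos (real j * (\<phi> / k))" by (rule cos_ge_zero)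
    then show ?thesis by (simp add: u_def Complex.DeMoivre)
  qed
  then have "Re (u ^ 0) \<le> (\<Sum>j<k. Re (u ^ j))"
    using k by (intro member_le_sum) auto
  then have "1 \<le> Re (\<Sum>j<k. u ^ j)" by simp
  then have "1 \<le> norm (\<Sum>j<k. u ^ j)" using complex_Re_le_cmod order.trans by blast
  then have "norm (1 - u) * 1 \<le> norm (1 - u) * norm (\<Sum>j<k. u ^ j)" by (intro mult_left_mono) auto
  also have "\<dots> = norm (1 - y)" using one_diff_power_eq[of u k] by (simp add: norm_mult uk)
  finally have le: "norm (1 - u) \<le> norm (1 - z ^ k)" by (simp add: y_def)
  have "u \<noteq> 0" by (simp add: u_def)
  then have "z = (z / u) * u" by simp
  moreover have "(z / u) ^ k = 1" using ny by (simp add: power_divide uk y_def[symmetric]) auto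
  moreover have "norm u = 1" by (simp add: u_def)
  ultimately show ?thesis using that le by blast
qed

text \<open>Small \<open>n\<close> are covered by the trivial bound once \<open>N\<close> is large.\<close>

lemma running_max_mean_tendsto_0:
  fixes B :: "nat \<Rightarrow> complex"
  assumes lim: "(\<lambda>n. B n / of_nat n) \<longlonglongrightarrow> 0" and le: "\<And>n. norm (B n) \<le> real n" and e: "0 < e"
  shows "\<exists>N1. \<forall>N\<ge>N1. \<forall>n\<le>N. norm (B n) \<le> e * real N"
proof -
  from lim e obtain n0 where n0: "\<And>n. n \<ge> n0 \<Longrightarrow> norm (B n / of_nat n) < e"
    by (auto simp: LIMSEQ_iff)
  have "norm (B n) \<le> e * real N" if N: "nat \<lceil>real n0 / e\<rceil> \<le> N" and n: "n \<le> N" for N n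
  proof (cases "n0 \<le> n")
    case True
    show ?thesis
    proof (cases "n = 0")
      case False
      then have "norm (B n) \<le> e * real n" using n0[OF True] by (simp add: norm_divide divide_less_eq)
      also have "\<dots> \<le> e * real N" using n e by simp
      finally show ?thesis .
    qed (use le[of 0] e in simp)
  next
    case False
    have "real n0 / e \<le> real N" using N by linarith
    then have "real n0 \<le> e * real N" using e by (simp add: field_simps)
    then show ?thesis using le[of n] False by linarith
  qed
  then show ?thesis by blast
qed

text \<open>Summation by parts: the passage from \<open>w\<close> to a point at distance \<open>\<epsilon>\<close> costs a factor \<open>1 + N \<epsilon>\<close>.\<close>

lemma major_arc_bound:
  fixes u w :: complex
  assumes u: "norm u = 1" and B: "\<And>n. n \<le> N \<Longrightarrow> norm (\<Sum>m=1..n. of_int (moebius_mu m) * w ^ m) \<le> b"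
  shows "norm (\<Sum>n=1..N. of_int (moebius_mu n) * (w * u) ^ n) \<le> b * (1 + real N * norm (1 - u))"
proof -
  define x where "x n = of_int (moebius_mu (Suc n)) * w ^ Suc n" for n
  have xs: "(\<Sum>k<n. x k) = (\<Sum>m=1..n. of_int (moebius_mu m) * w ^ m)" for n
    by (simp add: x_def sum.atLeast1_atMost_eq)
  have b0: "0 \<le> b" using B[of 0] by simp
  have "(\<Sum>n=1..N. of_int (moebius_mu n) * (w * u) ^ n) = (\<Sum>n<N. x n * u ^ Suc n)"
    by (simp add: x_def sum.atLeast1_atMost_eq power_mult_distrib mult_ac)
  also have "\<dots> = (\<Sum>k<N. x k) * u ^ Suc N + (\<Sum>n<N. (\<Sum>k\<le>n. x k) * (u ^ Suc n - u ^ Suc (Suc n)))"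
    by (rule abel_partial_summation[of x "\<lambda>n. u ^ Suc n"])
  also have "norm \<dots> \<le> b + (\<Sum>n<N. b * norm (1 - u))"
  proof (intro order.trans[OF norm_triangle_ineq] add_mono)
    show "norm ((\<Sum>k<N. x k) * u ^ Suc N) \<le> b"
      unfolding norm_mult norm_power u xs using B[of N] by simp
    show "norm (\<Sum>n<N. (\<Sum>k\<le>n. x k) * (u ^ Suc n - u ^ Suc (Suc n))) \<le> (\<Sum>n<N. b * norm (1 - u))"
    proof (rule sum_norm_le)
      fix n assume n: "n \<in> {..<N}"
      have "norm (\<Sum>k\<le>n. x k) \<le> b" using B[of "Suc n"] n xs[of "Suc n"] by (simp add: lessThan_Suc_atMost)
      moreover have "norm (u ^ Suc n - u ^ Suc (Suc n)) = norm (1 - u)"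
      proof -
        have "u ^ Suc n - u ^ Suc (Suc n) = u ^ Suc n * (1 - u)" by (simp add: algebra_simps)
        then show ?thesis by (simp only: norm_mult norm_power u) simp
      qed
      ultimately show "norm ((\<Sum>k\<le>n. x k) * (u ^ Suc n - u ^ Suc (Suc n))) \<le> b * norm (1 - u)"
        unfolding norm_mult by (simp add: mult_right_mono)
    qed
  qed
  also have "\<dots> = b * (1 + real N * norm (1 - u))" by (simp add: algebra_simps)
  finally show ?thesis .
qed

text \<open>Fix the set of primes first, so that the diagonal term in the criterion of Katai is at most \<open>\<epsilon> N/2\<close>.  The other term is at most
\<open>\<epsilon> N/2\<close> if all correlations are at most \<open>\<eta> N\<close> for a constant \<open>\<eta>\<close>, which holds if \<open>\<bar>1 - z\<^sup>k\<bar> \<ge> t = 2/(\<eta> N)\<close>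
for all differences \<open>k\<close> of these primes.  Otherwise \<open>z\<close> lies within \<open>t\<close> of a root of unity from a finite set that does not
depend on \<open>N\<close>.\<close>

theorem moebius_exponential_sum_uniform:
  assumes e: "0 < e"
  shows "\<exists>N0. \<forall>N\<ge>N0. \<forall>z::complex. norm z = 1 \<longrightarrow> norm (\<Sum>n=1..N. of_int (moebius_mu n) * z ^ n) \<le> e * real N"
proof -
  obtain P where P: "finite P" "\<forall>p\<in>P. prime p" and PS: "max 1 ((8 / e)\<^sup>2) < (\<Sum>p\<in>P. 1 / real p)"
    using prime_reciprocals_unbounded by blast
  define S where "S = (\<Sum>p\<in>P. 1 / real p)"
  have S1: "1 \<le> S" using PS by (simp add: S_def)
  have "8 / e \<le> sqrt S" using PS by (intro real_le_rsqrt) (simp add: S_def)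
  then have sS: "4 / sqrt S \<le> e / 2" using e S1 by (simp add: field_simps)
  define c where "c = real (card P) + 1"
  define \<eta> where "\<eta> = (e / (2 * c))\<^sup>2"
  have c: "c > 0" "real (card P) \<le> c" by (simp_all add: c_def)
  have \<eta>: "\<eta> > 0" using e c by (simp add: \<eta>_def)
  define K where "K = Max (insert 1 P)"
  have K: "p \<le> K" if "p \<in> P" for p using that P by (auto simp: K_def)
  define W where "W = (\<Union>k\<in>{1..K}. {w::complex. w ^ k = 1})"
  have W: "finite W" unfolding W_def by (intro finite_UN_I finite_nth_roots) auto
  define e' where "e' = e / (1 + 2 / \<eta>)"
  have e': "e' > 0" using e \<eta> by (simp add: e'_def add_pos_pos)
  have "\<exists>N1. \<forall>N\<ge>N1. \<forall>n\<le>N. norm (\<Sum>m=1..n. of_int (moebius_mu m) * w ^ m) \<le> e' * real N" if w: "w \<in> W" for w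
  proof -
    from w obtain k where k: "0 < k" "w ^ k = 1" by (auto simp: W_def Suc_le_eq)
    then have nw: "norm w = 1" by (metis norm_one norm_power power_eq_imp_eq_base norm_ge_zero zero_le_one power_one)
    have "(\<lambda>N. (\<Sum>n=1..N. of_int (moebius_mu n) * w ^ n) / of_nat N) \<longlonglongrightarrow> 0"
      by (rule moebius_periodic_mean[of k]) (use k in \<open>simp_all add: power_add\<close>)
    moreover have "norm (\<Sum>m=1..n. of_int (moebius_mu m) * w ^ m) \<le> real n" for n
    proof -
      have "norm (\<Sum>m=1..n. of_int (moebius_mu m) * w ^ m) \<le> (\<Sum>m=1..n. 1)"
        using norm_moebius_mu_le[where 'a = complex] by (intro sum_norm_le) (simp add: norm_mult norm_power nw)
      then show ?thesis by simp
    qed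
    ultimately show ?thesis by (rule running_max_mean_tendsto_0[OF _ _ e'])
  qed
  then obtain N1 where N1: "\<And>w N n. w \<in> W \<Longrightarrow> N1 w \<le> N \<Longrightarrow> n \<le> N \<Longrightarrow> norm (\<Sum>m=1..n. of_int (moebius_mu m) * w ^ m) \<le> e' * real N"
    by metis
  define N0 where "N0 = Max (insert (2 * card P) (insert (nat \<lceil>2 / \<eta>\<rceil> + 1) (N1 ` W)))"
  have "norm (\<Sum>n=1..N. of_int (moebius_mu n) * z ^ n) \<le> e * real N" if N: "N0 \<le> N" and z: "norm z = 1" for N and z :: complex
  proof -
    have NN: "2 * card P \<le> N" "nat \<lceil>2 / \<eta>\<rceil> + 1 \<le> N" "\<And>w. w \<in> W \<Longrightarrow> N1 w \<le> N"
      using N W by (auto simp: N0_def)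
    have N\<eta>: "2 / \<eta> < real N" using NN(2) by linarith
    then have Npos: "0 < real N" using \<eta> by (smt (verit) divide_pos_pos)
    define t where "t = 2 / (\<eta> * real N)"
    have t: "0 < t" "t < 1" using \<eta> Npos N\<eta> by (simp_all add: t_def field_simps)
    show ?thesis
    proof (cases "\<exists>k\<in>{1..K}. norm (1 - z ^ k) < t")
      case True
      then obtain k where k: "k \<in> {1..K}" "norm (1 - z ^ k) < t" by blast
      have "0 < k" "norm (1 - z ^ k) < 1" using k t by auto
      then obtain w u where wu: "z = w * u" "w ^ k = 1" "norm u = 1" "norm (1 - u) \<le> norm (1 - z ^ k)"
        by (rule near_root_of_unity[OF z]) blast
      have w: "w \<in> W" using wu k by (auto simp: W_def)
      have "norm (\<Sum>n=1..N. of_int (moebius_mu n) * z ^ n) \<le> e' * real N * (1 + real N * norm (1 - u))"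
        unfolding wu(1) by (rule major_arc_bound[OF wu(3)]) (rule N1[OF w NN(3)[OF w]])
      also have "\<dots> \<le> e' * real N * (1 + real N * t)"
        using wu(4) k(2) e' by (intro mult_left_mono add_left_mono) auto
      also have "real N * t = 2 / \<eta>" using Npos by (simp add: t_def)
      also have "e' * real N * (1 + 2 / \<eta>) = e * real N"
      proof -
        have "1 + 2 / \<eta> > 0" using \<eta> by (simp add: add_pos_pos)
        then show ?thesis by (simp add: e'_def)
      qed
      finally show ?thesis .
    next
      case False
      have corr: "norm (\<Sum>m=1..M. z ^ (p * m) * cnj (z ^ (q * m))) \<le> \<eta> * real N"
        if pq: "p \<in> P" "q \<in> P" "p \<noteq> q" for p q M
      proof -
        have zz: "z * cnj z = 1" using z by (simp add: complex_norm_square[symmetric])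
        have far: "t \<le> norm (1 - z ^ (b - a))" if "a \<in> P" "b \<in> P" "a < b" for a b
        proof -
          have "b - a \<in> {1..K}" using K[OF that(2)] that(3) by auto
          then show ?thesis using False by (auto simp: not_less)
        qed
        define v where "v = z ^ p * cnj (z ^ q)"
        have "z ^ (p * m) * cnj (z ^ (q * m)) = v ^ m" for m
          by (simp add: v_def power_mult power_mult_distrib)
        moreover have "norm v = 1" by (simp add: v_def norm_mult norm_power z)
        moreover have "t \<le> norm (1 - v)"
        proof (cases "p < q")
          case True
          have "z ^ p * cnj (z ^ q) = (z * cnj z) ^ p * cnj (z ^ (q - p))"
            using True by (simp add: power_mult_distrib mult.assoc power_add[symmetric])
          then have "1 - v = cnj (1 - z ^ (q - p))" by (simp add: v_def zz)
          then show ?thesis using far[OF pq(1,2) True] by (simp only: complex_mod_cnj)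
        next
          case False
          then have qp: "q < p" using pq by simp
          have "z ^ p * cnj (z ^ q) = (z * cnj z) ^ q * z ^ (p - q)"
            using qp by (simp add: power_mult_distrib mult_ac power_add[symmetric])
          then have "v = z ^ (p - q)" by (simp add: v_def zz)
          then show ?thesis using far[OF pq(2,1) qp] by simp
        qed
        ultimately have "norm (\<Sum>m=1..M. z ^ (p * m) * cnj (z ^ (q * m))) \<le> 2 / t"
          using geometric_sum_bound[of v t M] t by simp
        also have "2 / t = \<eta> * real N" by (simp add: t_def)
        finally show ?thesis .
      qed
      have "norm (\<Sum>n=1..N. of_int (moebius_mu n) * z ^ n)
          \<le> 4 * real N / sqrt S + real (card P) * sqrt (real N * (\<eta> * real N))"
        unfolding S_def
        by (rule katai_bound) (use P z S1 NN \<eta> corr in \<open>auto simp: S_def\<close>)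
      also have "4 * real N / sqrt S = real N * (4 / sqrt S)" by simp
      also have "\<dots> \<le> real N * (e / 2)" by (intro mult_left_mono sS) simp
      also have "real (card P) * sqrt (real N * (\<eta> * real N)) \<le> real N * (e / 2)"
      proof -
        have "sqrt (real N * (\<eta> * real N)) = real N * (e / (2 * c))"
          using e c by (intro real_sqrt_unique) (auto simp: \<eta>_def power2_eq_square)
        moreover have "real (card P) * (real N * (e / (2 * c))) \<le> c * (real N * (e / (2 * c)))"
          using c e by (intro mult_right_mono) auto
        moreover have "c * (real N * (e / (2 * c))) = real N * (e / 2)" using c by simp
        ultimately show ?thesis by (simp only:)
      qed
      finally show ?thesis by (simp add: mult.commute)
    qed
  qed
  then show ?thesis by blast
qed

section \<open>Rank-one operators and automorphisms of the compact operators\<close>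

text \<open>The operator \<open>v \<otimes> w\<^sup>*\<close>.\<close>

definition rank1 :: "'a::chilbert_space \<Rightarrow> 'a \<Rightarrow> 'a bounded_op"
  where "rank1 v w = Bounded_op (\<lambda>x. cinner x w *\<^sub>C v)"

lemma op_apply_rank1 [simp]: "op_apply (rank1 v w) x = cinner x w *\<^sub>C v"
proof -
  have "bounded_linear (\<lambda>x. cinner x w *\<^sub>C v)"
  proof (rule bounded_linear_intro[where K = "norm w * norm v"])
    show "cinner (x + y) w *\<^sub>C v = cinner x w *\<^sub>C v + cinner y w *\<^sub>C v" for x y
      by (simp add: cinner_add_left scaleC_add_left)
    show "cinner (r *\<^sub>R x) w *\<^sub>C v = r *\<^sub>R (cinner x w *\<^sub>C v)" for r x
      by (simp add: scaleR_scaleC)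
    show "norm (cinner x w *\<^sub>C v) \<le> norm x * (norm w * norm v)" for x
      using mult_right_mono[OF norm_cinner_le[of x w], of "norm v"] by (simp add: mult.assoc)
  qed
  then have "op_apply (Bounded_op (\<lambda>x. cinner x w *\<^sub>C v)) = (\<lambda>x. cinner x w *\<^sub>C v)"
    by (intro Bounded_op_inverse) simp
  then show ?thesis by (simp add: rank1_def)
qed

lemma star_rank1: "star (rank1 v w) = rank1 w v"
proof (rule star_eqI)
  fix x y
  show "cinner (op_apply (rank1 v w) x) y = cinner x (op_apply (rank1 w v) y)"
    using cinner_commute[of v y] by simp
qed

lemma times_rank1: "A * rank1 v w = rank1 (op_apply A v) w"
  by (rule bounded_op_eqI) (simp add: op_apply_scaleC)

lemma rank1_times: "rank1 v w * A = rank1 v (op_apply (star A) w)"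
  by (rule bounded_op_eqI) (simp add: cinner_star_right)

lemma rank1_times_rank1: "rank1 v w * rank1 x y = cinner x w *\<^sub>C rank1 v y"
  by (rule bounded_op_eqI) (simp add: mult.commute)

lemma rank1_compact: "rank1 v w \<in> compact_ops"
  unfolding compact_ops_iff
proof (intro exI conjI)
  have "bounded_linear (\<lambda>c. c *\<^sub>C v)"
    by (rule bounded_linear_intro[where K = "norm v"]) (simp_all add: scaleC_add_left scaleR_scaleC scaleR_conv_of_real)
  then show "compact ((\<lambda>c. c *\<^sub>C v) ` cball 0 (norm w))"
    by (intro compact_continuous_image) (auto intro: linear_continuous_on)
  show "op_apply (rank1 v w) ` cball 0 1 \<subseteq> (\<lambda>c. c *\<^sub>C v) ` cball 0 (norm w)"
  proof
    fix y assume "y \<in> op_apply (rank1 v w) ` cball 0 1"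
    then obtain x where x: "norm x \<le> 1" "y = cinner x w *\<^sub>C v" by auto
    have "cmod (cinner x w) \<le> 1 * norm w"
      using x by (intro order.trans[OF norm_cinner_le] mult_right_mono) auto
    then show "y \<in> (\<lambda>c. c *\<^sub>C v) ` cball 0 (norm w)" using x by auto
  qed
qed

lemma rank1_scaleC: "rank1 (c *\<^sub>C v) w = c *\<^sub>C rank1 v w"
  by (rule bounded_op_eqI) (simp add: mult.commute)

lemma zero_compact: "0 \<in> (compact_ops :: 'a::chilbert_space bounded_op set)"
proof -
  have "(0::complex) *\<^sub>C rank1 0 0 \<in> (compact_ops :: 'a bounded_op set)" by (rule compact_ops_scaleC[OF rank1_compact])
  then show ?thesis by simp
qed

text \<open>For a unit vector \<open>x\<close>, the projection \<open>e = x \<otimes> x\<^sup>*\<close> is minimal: \<open>e A e\<close> is a multiple of \<open>e\<close>.  So \<open>\<alpha>(e)\<close> is a minimal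
projection, that is, \<open>\<alpha>(e) = y \<otimes> y\<^sup>*\<close> for a unit vector \<open>y\<close>.  The unitary is \<open>U v = \<alpha>(v \<otimes> x\<^sup>*) y\<close>, which satisfies
\<open>\<alpha>(A) U = U A\<close>.  It is surjective since \<open>w \<otimes> y\<^sup>* = \<alpha>(B)\<close> gives \<open>w = U (B x)\<close>.\<close>

lemma compact_automorphism_spatial:
  fixes \<alpha> :: "'h::chilbert_space bounded_op \<Rightarrow> 'h bounded_op" and x :: 'h
  assumes \<alpha>: "star_automorphism compact_ops \<alpha>" and x: "norm x = 1"
  shows "\<exists>U. (\<forall>v w. cinner (U v) (U w) = cinner v w) \<and> (\<forall>v w. \<alpha> (rank1 v w) = rank1 (U v) (U w)) \<and>
    (\<forall>A\<in>compact_ops. norm (\<alpha> A) \<le> norm A)"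
proof -
  have add: "\<alpha> (F + G) = \<alpha> F + \<alpha> G" if "F \<in> compact_ops" "G \<in> compact_ops" for F G
    using \<alpha> that by (simp add: star_automorphism_def)
  have scale: "\<alpha> (c *\<^sub>C F) = c *\<^sub>C \<alpha> F" if "F \<in> compact_ops" for c F
    using \<alpha> that by (simp add: star_automorphism_def)
  have mult: "\<alpha> (F * G) = \<alpha> F * \<alpha> G" if "F \<in> compact_ops" "G \<in> compact_ops" for F G
    using \<alpha> that by (simp add: star_automorphism_def)
  have star: "\<alpha> (star F) = star (\<alpha> F)" if "F \<in> compact_ops" for F
    using \<alpha> that by (simp add: star_automorphism_def)
  have inj: "F = G" if "\<alpha> F = \<alpha> G" "F \<in> compact_ops" "G \<in> compact_ops" for F G
    using \<alpha> that by (auto simp: star_automorphism_def bij_betw_def inj_on_def)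
  have surj: "\<exists>F\<in>compact_ops. \<alpha> F = G" if "G \<in> compact_ops" for G
  proof -
    have "\<alpha> ` compact_ops = compact_ops" using \<alpha> by (simp add: star_automorphism_def bij_betw_def)
    then show ?thesis using that by (metis imageE)
  qed
  have xx: "cinner x x = 1" using x by (simp add: cinner_self)
  then have x0: "x \<noteq> 0" by auto
  define e where "e = rank1 x x"
  define p where "p = \<alpha> e"
  have e: "e \<in> compact_ops" "e * e = e" "star e = e"
    by (simp_all add: e_def rank1_compact rank1_times_rank1 star_rank1 xx)
  have p: "p * p = p" "star p = p"
    using mult[OF e(1) e(1)] star[OF e(1)] by (simp_all add: p_def e)
  have a0: "\<alpha> 0 = 0" using scale[OF zero_compact, of 0] by simp
  have "p \<noteq> 0"
  proof
    assume "p = 0"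
    then have "e = 0" using inj[of e 0] e a0 zero_compact by (simp add: p_def)
    then have "op_apply e x = 0" by simp
    then show False using x0 xx by (simp add: e_def)
  qed
  then obtain y0 where y0: "op_apply p y0 \<noteq> 0" using bounded_op_eqI[of p 0] by auto
  define y where "y = (1 / of_real (norm (op_apply p y0))) *\<^sub>C op_apply p y0"
  have ny: "norm y = 1" using y0 by (simp add: y_def norm_divide)
  have yy: "cinner y y = 1" using ny by (simp add: cinner_self)
  have "op_apply p (op_apply p y0) = op_apply p y0" by (metis p(1) op_apply_times)
  then have py: "op_apply p y = y" by (simp add: y_def op_apply_scaleC)
  have p_eq: "p = rank1 y y"
  proof -
    obtain B where B: "B \<in> compact_ops" "\<alpha> B = rank1 y y" using surj[OF rank1_compact] by blast
    have eB: "e * B \<in> compact_ops"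
      unfolding e_def rank1_times by (rule rank1_compact)
    have eBe: "e * B * e = cinner x (op_apply (star B) x) *\<^sub>C e"
      unfolding e_def rank1_times[of _ _ B] rank1_times_rank1 ..
    have "p * rank1 y y * p = \<alpha> (e * B * e)"
      using mult[OF eB e(1)] mult[OF e(1) B(1)] B(2) by (simp add: p_def)
    also have "\<dots> = cinner x (op_apply (star B) x) *\<^sub>C p"
      unfolding eBe p_def by (rule scale[OF e(1)])
    also have "p * rank1 y y * p = rank1 y y"
      by (simp add: times_rank1 rank1_times p py)
    finally have *: "rank1 y y = cinner x (op_apply (star B) x) *\<^sub>C p" .
    then have "op_apply (rank1 y y) y = op_apply (cinner x (op_apply (star B) x) *\<^sub>C p) y" by simp
    then have "y = cinner x (op_apply (star B) x) *\<^sub>C y" by (simp add: yy py)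
    then have "cinner y y = cinner (cinner x (op_apply (star B) x) *\<^sub>C y) y" by simp
    then have "cinner x (op_apply (star B) x) = 1" by (simp add: yy)
    with * show ?thesis by simp
  qed
  define U where "U v = op_apply (\<alpha> (rank1 v x)) y" for v
  have U_scale: "U (c *\<^sub>C v) = c *\<^sub>C U v" for c v
    by (simp add: U_def rank1_scaleC scale[OF rank1_compact])
  have U_inner: "cinner (U v) (U w) = cinner v w" for v w
  proof -
    have "cinner (U v) (U w) = cinner (op_apply (star (\<alpha> (rank1 w x)) * \<alpha> (rank1 v x)) y) y"
      by (simp add: U_def cinner_star_left)
    also have "star (\<alpha> (rank1 w x)) * \<alpha> (rank1 v x) = \<alpha> (star (rank1 w x) * rank1 v x)"
      using star[OF rank1_compact[of w x]] by (simp add: mult rank1_compact star_rank1)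
    also have "star (rank1 w x) * rank1 v x = cinner v w *\<^sub>C e"
      by (simp add: star_rank1 rank1_times_rank1 e_def)
    also have "\<alpha> (cinner v w *\<^sub>C e) = cinner v w *\<^sub>C p" by (simp add: scale[OF e(1)] p_def)
    finally show ?thesis by (simp add: py yy)
  qed
  have U_norm: "norm (U v) = norm v" for v
  proof -
    have "complex_of_real ((norm (U v))\<^sup>2) = of_real ((norm v)\<^sup>2)" using U_inner[of v v] by (simp only: cinner_self)
    then have "(norm (U v))\<^sup>2 = (norm v)\<^sup>2" by (simp only: of_real_eq_iff)
    then show ?thesis by simp
  qed
  have inter: "op_apply (\<alpha> A) (U v) = U (op_apply A v)" if A: "A \<in> compact_ops" for A v
    using mult[OF A rank1_compact[of v x]] by (simp add: U_def times_rank1)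
  have U_surj: "\<exists>v. U v = w" for w
  proof -
    obtain B where B: "B \<in> compact_ops" "\<alpha> B = rank1 w y" using surj[OF rank1_compact] by blast
    have Be: "B * e = rank1 (op_apply B x) x" by (simp add: e_def times_rank1)
    have "\<alpha> (B * e) = rank1 w y * rank1 y y"
      using mult[OF B(1) e(1)] B(2) p_eq by (simp add: p_def)
    also have "\<dots> = \<alpha> B" by (simp add: rank1_times_rank1 yy B(2))
    finally have "U (op_apply B x) = op_apply (\<alpha> B) y" by (simp add: U_def Be)
    then show ?thesis using B(2) by (auto simp: yy)
  qed
  have "\<alpha> (rank1 v w) = rank1 (U v) (U w)" for v w
  proof (rule bounded_op_eqI)
    fix z
    obtain z' where "U z' = z" using U_surj[of z] by (elim exE)
    then have z: "z = U z'" by simp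
    show "op_apply (\<alpha> (rank1 v w)) z = op_apply (rank1 (U v) (U w)) z"
      unfolding z inter[OF rank1_compact] by (simp add: U_scale U_inner)
  qed
  moreover have "norm (\<alpha> A) \<le> norm A" if A: "A \<in> compact_ops" for A
  proof (rule norm_bounded_op_le)
    fix z
    obtain z' where "U z' = z" using U_surj[of z] by (elim exE)
    then have z: "z = U z'" by simp
    show "norm (op_apply (\<alpha> A) z) \<le> norm A * norm z"
      unfolding z inter[OF A] U_norm by (rule norm_op_apply)
  qed simp
  ultimately show ?thesis using U_inner by blast
qed

section \<open>Orthonormal systems and finite-rank approximation\<close>

lemma cinner_sum_left: "cinner (\<Sum>i\<in>I. f i) y = (\<Sum>i\<in>I. cinner (f i) y)"
  by (induction I rule: infinite_finite_induct) (simp_all add: cinner_add_left)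

lemma cinner_sum_right: "cinner x (\<Sum>i\<in>I. f i) = (\<Sum>i\<in>I. cinner x (f i))"
  by (induction I rule: infinite_finite_induct) (simp_all add: cinner_add_right)

lemma scaleC_sum_right: "c *\<^sub>C (\<Sum>i\<in>I. f i) = (\<Sum>i\<in>I. c *\<^sub>C f i)"
  for f :: "'b \<Rightarrow> 'a::complex_vector"
  by (induction I rule: infinite_finite_induct) (simp_all add: scaleC_add_right)

lemma scaleC_sum_left: "(\<Sum>i\<in>I. c i) *\<^sub>C (x :: 'a::complex_vector) = (\<Sum>i\<in>I. c i *\<^sub>C x)"
  by (induction I rule: infinite_finite_induct) (simp_all add: scaleC_add_left)

definition orthonormal :: "'a::chilbert_space set \<Rightarrow> bool"
  where "orthonormal F \<longleftrightarrow> finite F \<and> (\<forall>f\<in>F. \<forall>g\<in>F. cinner f g = (if f = g then 1 else 0))"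

lemma orthonormal_coeff:
  assumes F: "orthonormal F" and g: "g \<in> F"
  shows "cinner (\<Sum>f\<in>F. c f *\<^sub>C f) g = c g"
proof -
  have "cinner (\<Sum>f\<in>F. c f *\<^sub>C f) g = (\<Sum>f\<in>F. c f * (if f = g then 1 else 0))"
    unfolding cinner_sum_left using F g by (intro sum.cong) (auto simp: orthonormal_def)
  also have "\<dots> = (\<Sum>f\<in>F. if f = g then c f else 0)" by (intro sum.cong) auto
  also have "\<dots> = c g" using F g by (simp add: orthonormal_def sum.delta)
  finally show ?thesis .
qed

lemma orthonormal_norm_sum:
  assumes F: "orthonormal F"
  shows "(norm (\<Sum>f\<in>F. c f *\<^sub>C f))\<^sup>2 = (\<Sum>f\<in>F. (cmod (c f))\<^sup>2)"
proof -
  have "complex_of_real ((norm (\<Sum>f\<in>F. c f *\<^sub>C f))\<^sup>2) = cinner (\<Sum>f\<in>F. c f *\<^sub>C f) (\<Sum>g\<in>F. c g *\<^sub>C g)"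
    by (simp only: cinner_self)
  also have "\<dots> = (\<Sum>g\<in>F. cinner (\<Sum>f\<in>F. c f *\<^sub>C f) (c g *\<^sub>C g))" by (rule cinner_sum_right)
  also have "\<dots> = (\<Sum>g\<in>F. c g * cnj (c g))"
    by (intro sum.cong refl) (simp add: orthonormal_coeff[OF F] mult.commute)
  also have "\<dots> = complex_of_real (\<Sum>g\<in>F. (cmod (c g))\<^sup>2)" by (simp only: of_real_sum complex_norm_square)
  finally show ?thesis by (simp only: of_real_eq_iff)
qed

text \<open>Pythagoras' theorem for the orthogonal projection onto the span of an orthonormal system.\<close>

lemma orthonormal_residual:
  assumes F: "orthonormal F"
  defines "P \<equiv> \<lambda>u. \<Sum>f\<in>F. cinner u f *\<^sub>C f"
  shows "(norm (u - P u))\<^sup>2 + (\<Sum>f\<in>F. (cmod (cinner u f))\<^sup>2) = (norm u)\<^sup>2"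
proof -
  have "cinner (u - P u) (P u) = 0"
    unfolding P_def cinner_sum_right
    by (intro sum.neutral ballI) (simp add: cinner_diff_left orthonormal_coeff[OF F])
  then have "(norm (u - P u + P u))\<^sup>2 = (norm (u - P u))\<^sup>2 + (norm (P u))\<^sup>2"
    by (simp only: norm_sq_add) simp
  moreover have "(norm (P u))\<^sup>2 = (\<Sum>f\<in>F. (cmod (cinner u f))\<^sup>2)"
    unfolding P_def by (rule orthonormal_norm_sum[OF F])
  ultimately show ?thesis by simp
qed

lemma bessel: "orthonormal F \<Longrightarrow> (\<Sum>f\<in>F. (cmod (cinner u f))\<^sup>2) \<le> (norm u)\<^sup>2"
  using orthonormal_residual[of F u] zero_le_power2[of "norm (u - (\<Sum>f\<in>F. cinner u f *\<^sub>C f))"] by linarith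

lemma gram_schmidt:
  fixes v :: "nat \<Rightarrow> 'a::chilbert_space"
  shows "\<exists>F. orthonormal F \<and> (\<forall>n<N. (\<Sum>f\<in>F. cinner (v n) f *\<^sub>C f) = v n)"
proof (induction N)
  case 0
  show ?case by (intro exI[of _ "{}"]) (simp add: orthonormal_def)
next
  case (Suc N)
  then obtain F where F: "orthonormal F" and vF: "\<And>n. n < N \<Longrightarrow> (\<Sum>f\<in>F. cinner (v n) f *\<^sub>C f) = v n" by blast
  define r where "r = v N - (\<Sum>f\<in>F. cinner (v N) f *\<^sub>C f)"
  have rF: "cinner r f = 0" if "f \<in> F" for f
    using that by (simp add: r_def cinner_diff_left orthonormal_coeff[OF F])
  show ?case
  proof (cases "r = 0")
    case True
    then show ?thesis using F vF by (intro exI[of _ F]) (auto simp: less_Suc_eq r_def)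
  next
    case False
    define g where "g = (1 / of_real (norm r)) *\<^sub>C r"
    have "norm g = 1" using False by (simp add: g_def norm_divide)
    then have gg: "cinner g g = 1" by (simp add: cinner_self)
    have gF: "cinner g f = 0" "cinner f g = 0" if "f \<in> F" for f
      using rF[OF that] cinner_commute[of f g] by (simp_all add: g_def)
    have g: "g \<notin> F" using gF gg by force
    have F': "orthonormal (insert g F)"
      using F gg gF g by (auto simp: orthonormal_def)
    have fin: "finite F" using F by (simp add: orthonormal_def)
    have "(\<Sum>f\<in>insert g F. cinner (v n) f *\<^sub>C f) = v n" if "n < Suc N" for n
    proof (cases "n < N")
      case True
      have "cinner (v n) g = cinner (\<Sum>f\<in>F. cinner (v n) f *\<^sub>C f) g" by (simp only: vF[OF True])
      also have "\<dots> = 0" unfolding cinner_sum_left by (intro sum.neutral) (simp add: gF)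
      finally show ?thesis using fin g vF[OF True] by simp
    next
      case n: False
      then have n: "n = N" using that by simp
      have "cinner (v N) g = cinner (r + (\<Sum>f\<in>F. cinner (v N) f *\<^sub>C f)) g" by (simp add: r_def)
      also have "\<dots> = cinner r g"
        unfolding cinner_add_left cinner_sum_left by (simp add: gF)
      also have "\<dots> = of_real (norm r)"
        using False by (simp add: g_def cinner_self power2_eq_square)
      finally have "cinner (v N) g *\<^sub>C g = r" using False by (simp add: g_def)
      then show ?thesis using fin g by (simp add: n r_def)
    qed
    then show ?thesis using F' by blast
  qed
qed

text \<open>The image of the unit ball is covered by finitely many small balls.  The orthogonal projection onto the span of their centres moves
every point of the image by at most the radius of these balls.  For the projection \<open>\<Sum>f. f \<otimes> f\<^sup>*\<close>, the product with \<open>A\<close> is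
\<open>\<Sum>f. f \<otimes> (A\<^sup>* f)\<^sup>*\<close>.\<close>

lemma compact_op_finite_rank_approximation:
  fixes A :: "'a::chilbert_space bounded_op"
  assumes A: "A \<in> compact_ops" and e: "0 < e"
  shows "\<exists>F. finite F \<and> norm (A - (\<Sum>f\<in>F. rank1 f (op_apply (star A) f))) \<le> e"
proof -
  have K: "compact (closure (op_apply A ` cball 0 1))" using A by (simp add: compact_ops_def)
  have "\<exists>k. finite k \<and> k \<subseteq> closure (op_apply A ` cball 0 1) \<and> closure (op_apply A ` cball 0 1) \<subseteq> (\<Union>b\<in>k. ball b e)"
    by (rule mp[OF spec[OF seq_compact_imp_totally_bounded[OF compact_imp_seq_compact[OF K]]] e])
  then obtain k where k: "finite k" "closure (op_apply A ` cball 0 1) \<subseteq> (\<Union>b\<in>k. ball b e)"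
    by (elim exE conjE)
  obtain v :: "nat \<Rightarrow> 'a" and N where vN: "k = v ` {i. i < N}"
    using finite_imp_nat_seg_image_inj_on[OF k(1)] by (elim exE conjE)
  obtain F where F: "orthonormal F" and vF: "\<And>n. n < N \<Longrightarrow> (\<Sum>f\<in>F. cinner (v n) f *\<^sub>C f) = v n"
    using gram_schmidt[of N v] by blast
  define R where "R = (\<Sum>f\<in>F. rank1 f (op_apply (star A) f))"
  have op_sum: "op_apply (\<Sum>f\<in>F. h f) x = (\<Sum>f\<in>F. op_apply (h f) x)" for h :: "'a \<Rightarrow> 'a bounded_op" and x
    by (induction F rule: infinite_finite_induct) simp_all
  have R: "op_apply R x = (\<Sum>f\<in>F. cinner (op_apply A x) f *\<^sub>C f)" for x
    by (simp add: R_def op_sum cinner_star_right)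
  have unit: "norm (op_apply (A - R) x) \<le> e" if x: "norm x \<le> 1" for x
  proof -
    have "op_apply A x \<in> closure (op_apply A ` cball 0 1)"
      using x by (intro subsetD[OF closure_subset]) auto
    then obtain b where b: "b \<in> k" "dist b (op_apply A x) < e" using k(2) by auto
    then obtain n where n: "n < N" "b = v n" using vN by auto
    define u where "u = op_apply A x - b"
    have "(\<Sum>f\<in>F. cinner u f *\<^sub>C f) = op_apply R x - b"
      using vF[OF n(1)] by (simp add: u_def R n(2) cinner_diff_left scaleC_diff_left sum_subtractf)
    then have "op_apply (A - R) x = u - (\<Sum>f\<in>F. cinner u f *\<^sub>C f)" by (simp add: u_def)
    moreover have "(norm (u - (\<Sum>f\<in>F. cinner u f *\<^sub>C f)))\<^sup>2 \<le> (norm u)\<^sup>2"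
    proof -
      have "0 \<le> (\<Sum>f\<in>F. (cmod (cinner u f))\<^sup>2)" by (simp add: sum_nonneg)
      then show ?thesis using orthonormal_residual[OF F, of u] by linarith
    qed
    then have "norm (u - (\<Sum>f\<in>F. cinner u f *\<^sub>C f)) \<le> norm u" by (rule power2_le_imp_le) simp
    ultimately have "norm (op_apply (A - R) x) \<le> norm u" by (simp only:)
    moreover have "norm u < e" using b(2) by (simp add: u_def dist_norm norm_minus_commute)
    ultimately show ?thesis by linarith
  qed
  have "norm (A - R) \<le> e"
  proof (rule norm_bounded_op_le)
    fix x
    show "norm (op_apply (A - R) x) \<le> e * norm x"
    proof (cases "x = 0")
      case True
      then show ?thesis using linear_0[OF bounded_linear.linear[OF bounded_linear_op_apply[of "A - R"]]] by simp
    next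
      case False
      define c where "c = complex_of_real (norm x)"
      have c: "c \<noteq> 0" "cmod c = norm x" using False by (simp_all add: c_def)
      have "norm (op_apply (A - R) ((1 / c) *\<^sub>C x)) \<le> e"
        by (rule unit) (use c False in \<open>simp add: norm_divide\<close>)
      then have "norm (op_apply (A - R) x) / norm x \<le> e"
        unfolding op_apply_scaleC using c by (simp add: norm_divide)
      then show ?thesis using False by (simp add: divide_le_eq)
    qed
  qed (use e in simp)
  then show ?thesis using F by (auto simp: R_def orthonormal_def)
qed

section \<open>Transference from the circle to unitary orbits\<close>

lemma roots_of_unity_orthogonal:
  fixes M :: nat
  assumes "l < M" "l' < M"
  shows "(\<Sum>k<M. cis (2 * pi * real k * real l / real M) * cnj (cis (2 * pi * real k * real l' / real M))) = (if l = l' then of_nat M else 0)"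
proof -
  define r where "r = cis (2 * pi * (real l - real l') / real M)"
  have M: "0 < M" using assms by simp
  have "cis (2 * pi * real k * real l / real M) * cnj (cis (2 * pi * real k * real l' / real M)) = r ^ k" for k
    by (simp add: r_def Complex.DeMoivre cis_cnj cis_mult diff_divide_distrib[symmetric] right_diff_distrib mult_ac flip: diff_conv_add_uminus)
  then have sum: "(\<Sum>k<M. cis (2 * pi * real k * real l / real M) * cnj (cis (2 * pi * real k * real l' / real M))) = (\<Sum>k<M. r ^ k)" by simp
  show ?thesis
  proof (cases "l = l'")
    case True
    then show ?thesis unfolding sum by (simp add: r_def)
  next
    case False
    have "r \<noteq> 1"
    proof
      assume "r = 1"
      then have "cos (2 * pi * (real l - real l') / real M) = 1" by (simp add: r_def complex_eq_iff)
      then obtain j :: int where "2 * pi * (real l - real l') / real M = of_int j * 2 * pi"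
        by (auto simp: cos_one_2pi_int)
      then have "(2 * pi) * ((real l - real l') / real M) = (2 * pi) * of_int j" by (simp add: mult.commute)
      then have "(real l - real l') / real M = of_int j" by (simp only: mult_cancel_left) simp
      then have "real l - real l' = of_int j * real M" using M by (simp add: divide_eq_eq)
      then have "real_of_int (int l - int l') = real_of_int (j * int M)" by simp
      then have j: "int l - int l' = j * int M" by (simp only: of_int_eq_iff)
      have "j \<noteq> 0" using j False by auto
      then have "int M \<le> \<bar>j\<bar> * int M" using mult_right_mono[of 1 "\<bar>j\<bar>" "int M"] by linarith
      also have "\<dots> = \<bar>int l - int l'\<bar>" by (simp add: j abs_mult)
      finally show False using assms by linarith
    qed
    moreover have "r ^ M = 1"
    proof -
      have "r ^ M = cis (2 * pi * (real l - real l'))" using M by (simp add: r_def Complex.DeMoivre)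
      also have "\<dots> = 1" by (rule cis_multiple_2pi) simp
      finally show ?thesis .
    qed
    ultimately show ?thesis unfolding sum using geometric_sum[of r M] False by simp
  qed
qed

lemma discrete_parseval:
  fixes a :: "nat \<Rightarrow> complex"
  shows "(\<Sum>k<M. (norm (\<Sum>l<M. a l * cis (2 * pi * real k * real l / real M)))\<^sup>2) = real M * (\<Sum>l<M. (norm (a l))\<^sup>2)"
proof -
  let ?z = "\<lambda>k l. cis (2 * pi * real k * real l / real M)"
  have "complex_of_real (\<Sum>k<M. (norm (\<Sum>l<M. a l * ?z k l))\<^sup>2)
      = (\<Sum>k<M. (\<Sum>l<M. a l * ?z k l) * cnj (\<Sum>l<M. a l * ?z k l))"
    by (simp only: of_real_sum complex_norm_square)
  also have "\<dots> = (\<Sum>k<M. \<Sum>l<M. \<Sum>l'<M. (a l * cnj (a l')) * (?z k l * cnj (?z k l')))"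
    by (simp add: sum_product cnj_sum mult_ac)
  also have "\<dots> = (\<Sum>l<M. \<Sum>l'<M. \<Sum>k<M. (a l * cnj (a l')) * (?z k l * cnj (?z k l')))"
    by (subst sum.swap) (rule sum.cong[OF refl], rule sum.swap)
  also have "\<dots> = (\<Sum>l<M. \<Sum>l'<M. (a l * cnj (a l')) * (if l = l' then of_nat M else 0))"
    unfolding sum_distrib_left[symmetric]
    by (intro sum.cong refl arg_cong[where f = "\<lambda>x. _ * x"] roots_of_unity_orthogonal) auto
  also have "\<dots> = (\<Sum>l<M. \<Sum>l'<M. if l = l' then a l * cnj (a l') * of_nat M else 0)"
    by (intro sum.cong refl) simp
  also have "\<dots> = (\<Sum>l<M. a l * cnj (a l) * of_nat M)" by (simp add: sum.delta)
  also have "\<dots> = complex_of_real (real M * (\<Sum>l<M. (norm (a l))\<^sup>2))"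
    by (simp add: sum_distrib_left complex_norm_square mult.commute of_real_power[symmetric] del: of_real_power)
  finally show ?thesis by (simp only: of_real_eq_iff)
qed

lemma discrete_fourier_inversion:
  fixes h :: "nat \<Rightarrow> complex"
  assumes M: "0 < M"
  obtains a where "\<And>j. j < M \<Longrightarrow> h j = (\<Sum>l<M. a l * cis (2 * pi * real j * real l / real M))"
proof -
  let ?z = "\<lambda>k l. cis (2 * pi * real k * real l / real M)"
  have sym: "?z k l = ?z l k" for k l by (simp add: mult_ac)
  define a where "a l = (\<Sum>i<M. h i * cnj (?z i l)) / of_nat M" for l
  have "h j = (\<Sum>l<M. a l * ?z j l)" if j: "j < M" for j
  proof -
    have "(\<Sum>l<M. a l * ?z j l) = (\<Sum>l<M. \<Sum>i<M. h i * (?z l j * cnj (?z l i))) / of_nat M"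
      unfolding a_def sum_divide_distrib sum_distrib_right
      by (intro sum.cong refl) (simp add: mult_ac)
    also have "\<dots> = (\<Sum>i<M. \<Sum>l<M. h i * (?z l j * cnj (?z l i))) / of_nat M"
      by (subst sum.swap) simp
    also have "\<dots> = (\<Sum>i<M. h i * (if j = i then of_nat M else 0)) / of_nat M"
      unfolding sum_distrib_left[symmetric]
      by (intro arg_cong[where f = "\<lambda>x. x / _"] sum.cong refl arg_cong[where f = "\<lambda>x. _ * x"] roots_of_unity_orthogonal j) auto
    also have "(\<Sum>i<M. h i * (if j = i then of_nat M else 0)) = (\<Sum>i<M. if j = i then h i * of_nat M else 0)"
      by (intro sum.cong refl) simp
    also have "\<dots> = h j * of_nat M" using j by (simp add: sum.delta')
    finally show ?thesis using M by simp
  qed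
  then show ?thesis by (rule that)
qed

text \<open>Convolution with \<open>c\<close> on the cyclic group of order \<open>2N\<close> has norm at most \<open>C\<close>, as the discrete Fourier transform diagonalizes it
with eigenvalues \<open>\<Sum>n. c\<^sub>n z\<^sup>n\<close> at roots of unity \<open>z\<close>.  The indices \<open>n + k\<close> stay below \<open>2N\<close>, so nothing wraps around.\<close>

lemma transference:
  fixes c h :: "nat \<Rightarrow> complex"
  assumes C: "\<And>z. norm z = 1 \<Longrightarrow> norm (\<Sum>n<N. c n * z ^ n) \<le> C"
  shows "(\<Sum>k<N. (norm (\<Sum>n<N. c n * h (n + k)))\<^sup>2) \<le> C\<^sup>2 * (\<Sum>j<2 * N. (norm (h j))\<^sup>2)"
proof (cases "N = 0")
  case False
  define M where "M = 2 * N"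
  have M: "0 < M" using False by (simp add: M_def)
  let ?z = "\<lambda>k l. cis (2 * pi * real k * real l / real M)"
  obtain a where a: "\<And>j. j < M \<Longrightarrow> h j = (\<Sum>l<M. a l * ?z j l)"
    by (rule discrete_fourier_inversion[OF M, of h]) blast
  define b where "b l = a l * (\<Sum>n<N. c n * (cis (2 * pi * real l / real M)) ^ n)" for l
  have zadd: "?z (n + k) l = cis (2 * pi * real l / real M) ^ n * ?z k l" for n k l
    by (simp add: Complex.DeMoivre cis_mult add_divide_distrib[symmetric] distrib_left distrib_right mult_ac add_ac)
  have conv: "(\<Sum>n<N. c n * h (n + k)) = (\<Sum>l<M. b l * ?z k l)" if k: "k < N" for k
  proof -
    have "(\<Sum>n<N. c n * h (n + k)) = (\<Sum>n<N. \<Sum>l<M. c n * (a l * ?z (n + k) l))"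
      unfolding sum_distrib_left[symmetric] using k by (intro sum.cong refl arg_cong[where f = "\<lambda>x. _ * x"] a) (simp add: M_def)
    also have "\<dots> = (\<Sum>l<M. \<Sum>n<N. c n * (a l * ?z (n + k) l))" by (rule sum.swap)
    also have "\<dots> = (\<Sum>l<M. b l * ?z k l)"
      unfolding b_def sum_distrib_left sum_distrib_right zadd by (intro sum.cong refl) (simp only: mult_ac)
    finally show ?thesis .
  qed
  have "(\<Sum>k<N. (norm (\<Sum>n<N. c n * h (n + k)))\<^sup>2) = (\<Sum>k<N. (norm (\<Sum>l<M. b l * ?z k l))\<^sup>2)"
    by (simp add: conv)
  also have "\<dots> \<le> (\<Sum>k<M. (norm (\<Sum>l<M. b l * ?z k l))\<^sup>2)"
    by (intro sum_mono2) (auto simp: M_def)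
  also have "\<dots> = real M * (\<Sum>l<M. (norm (b l))\<^sup>2)" by (rule discrete_parseval)
  also have "\<dots> \<le> real M * (\<Sum>l<M. C\<^sup>2 * (norm (a l))\<^sup>2)"
  proof (intro mult_left_mono sum_mono)
    fix l
    have "(norm (\<Sum>n<N. c n * (cis (2 * pi * real l / real M)) ^ n))\<^sup>2 \<le> C\<^sup>2"
      by (intro power_mono C) simp_all
    from mult_left_mono[OF this, of "(norm (a l))\<^sup>2"]
    show "(norm (b l))\<^sup>2 \<le> C\<^sup>2 * (norm (a l))\<^sup>2" by (simp add: b_def norm_mult power_mult_distrib mult.commute)
  qed simp
  also have "\<dots> = C\<^sup>2 * (real M * (\<Sum>l<M. (norm (a l))\<^sup>2))" by (simp add: sum_distrib_left mult_ac)
  also have "real M * (\<Sum>l<M. (norm (a l))\<^sup>2) = (\<Sum>j<M. (norm (h j))\<^sup>2)"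
    unfolding discrete_parseval[symmetric] by (simp add: a)
  finally show ?thesis by (simp add: M_def)
qed simp

lemma orthonormal_parseval:
  assumes F: "orthonormal F" and a: "(\<Sum>f\<in>F. cinner a f *\<^sub>C f) = a"
  shows "cinner a b = (\<Sum>f\<in>F. cinner a f * cnj (cinner b f))"
proof -
  have "cinner a b = cinner (\<Sum>f\<in>F. cinner a f *\<^sub>C f) b" by (simp only: a)
  also have "\<dots> = (\<Sum>f\<in>F. cinner a f * cinner f b)" by (simp add: cinner_sum_left)
  also have "\<dots> = (\<Sum>f\<in>F. cinner a f * cnj (cinner b f))"
    by (intro sum.cong refl arg_cong[where f = "\<lambda>x. _ * x"] cinner_commute)
  finally show ?thesis .
qed

text \<open>The square of the Hilbert-Schmidt norm of the sum is \<open>\<Sum>n m. c\<^sub>n cnj(c\<^sub>m) \<langle>U\<^sup>n v, U\<^sup>m v\<rangle> cnj \<langle>U\<^sup>n w, U\<^sup>m w\<rangle>\<close>.  As \<open>U\<close> is unitary,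
this does not change if all vectors are shifted by \<open>U\<^sup>k\<close>, so it equals its average over \<open>k < N\<close>.  In coordinates with respect to
orthonormal systems that span the first \<open>2N\<close> vectors of both orbits, the average is a sum of scalar expressions to which transference
applies.  The factor \<open>\<surd>2\<close> is the price for a window of length \<open>2N\<close>.\<close>

lemma norm_unitary_orbit_sum:
  fixes U :: "'h::chilbert_space \<Rightarrow> 'h"
  assumes U: "\<And>v w. cinner (U v) (U w) = cinner v w"
    and C: "\<And>z::complex. norm z = 1 \<Longrightarrow> norm (\<Sum>n<N. c n * z ^ n) \<le> C" and C0: "0 \<le> C"
  shows "norm (\<Sum>n<N. c n *\<^sub>C rank1 ((U ^^ n) v) ((U ^^ n) w)) \<le> sqrt 2 * C * norm v * norm w"
proof (cases "N = 0")
  case False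
  have Un: "cinner ((U ^^ n) a) ((U ^^ n) b) = cinner a b" for n a b
    by (induction n) (simp_all add: U)
  have nUn: "norm ((U ^^ n) a) = norm a" for n a
  proof -
    have "complex_of_real ((norm ((U ^^ n) a))\<^sup>2) = of_real ((norm a)\<^sup>2)" using Un[of n a a] by (simp only: cinner_self)
    then have "(norm ((U ^^ n) a))\<^sup>2 = (norm a)\<^sup>2" by (simp only: of_real_eq_iff)
    then show ?thesis by simp
  qed
  obtain F where F: "orthonormal F" and vF: "\<And>n. n < 2 * N \<Longrightarrow> (\<Sum>f\<in>F. cinner ((U ^^ n) v) f *\<^sub>C f) = (U ^^ n) v"
    using gram_schmidt[of "2 * N" "\<lambda>n. (U ^^ n) v"] by blast
  obtain G where G: "orthonormal G" and wG: "\<And>n. n < 2 * N \<Longrightarrow> (\<Sum>g\<in>G. cinner ((U ^^ n) w) g *\<^sub>C g) = (U ^^ n) w"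
    using gram_schmidt[of "2 * N" "\<lambda>n. (U ^^ n) w"] by blast
  define h where "h f g n = cinner ((U ^^ n) v) f * cnj (cinner ((U ^^ n) w) g)" for f g n
  define Q where "Q k = (\<Sum>f\<in>F. \<Sum>g\<in>G. (norm (\<Sum>n<N. c n * h f g (n + k)))\<^sup>2)" for k
  \<comment> \<open>The \<open>h f g n\<close> are the coordinates of the \<open>n\<close>-th tensor, so this is the Gram matrix of these tensors.\<close>
  have gram: "(\<Sum>f\<in>F. \<Sum>g\<in>G. h f g n * cnj (h f g m)) = cinner ((U ^^ n) v) ((U ^^ m) v) * cnj (cinner ((U ^^ n) w) ((U ^^ m) w))"
    if "n < 2 * N" for n m
    unfolding orthonormal_parseval[OF F vF[OF that], of "(U ^^ m) v"] orthonormal_parseval[OF G wG[OF that], of "(U ^^ m) w"]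
      cnj_sum sum_product h_def
    by (intro sum.cong refl) (simp add: mult_ac)
  have shift: "Q k = Q 0" if k: "k < N" for k
  proof -
    have Qk: "complex_of_real (Q k) = (\<Sum>n<N. \<Sum>m<N. c n * cnj (c m) * (cinner ((U ^^ n) v) ((U ^^ m) v) * cnj (cinner ((U ^^ n) w) ((U ^^ m) w))))"
      if k: "k < N" for k
    proof -
      have "complex_of_real (Q k) = (\<Sum>f\<in>F. \<Sum>g\<in>G. (\<Sum>n<N. c n * h f g (n + k)) * cnj (\<Sum>n<N. c n * h f g (n + k)))"
        by (simp only: Q_def of_real_sum complex_norm_square)
      also have "\<dots> = (\<Sum>f\<in>F. \<Sum>g\<in>G. \<Sum>n<N. \<Sum>m<N. c n * cnj (c m) * (h f g (n + k) * cnj (h f g (m + k))))"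
        by (simp add: sum_product cnj_sum mult_ac)
      also have "\<dots> = (\<Sum>f\<in>F. \<Sum>n<N. \<Sum>g\<in>G. \<Sum>m<N. c n * cnj (c m) * (h f g (n + k) * cnj (h f g (m + k))))"
        by (rule sum.cong[OF refl], rule sum.swap)
      also have "\<dots> = (\<Sum>n<N. \<Sum>f\<in>F. \<Sum>g\<in>G. \<Sum>m<N. c n * cnj (c m) * (h f g (n + k) * cnj (h f g (m + k))))"
        by (rule sum.swap)
      also have "\<dots> = (\<Sum>n<N. \<Sum>f\<in>F. \<Sum>m<N. \<Sum>g\<in>G. c n * cnj (c m) * (h f g (n + k) * cnj (h f g (m + k))))"
        by (rule sum.cong[OF refl], rule sum.cong[OF refl], rule sum.swap)
      also have "\<dots> = (\<Sum>n<N. \<Sum>m<N. \<Sum>f\<in>F. \<Sum>g\<in>G. c n * cnj (c m) * (h f g (n + k) * cnj (h f g (m + k))))"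
        by (rule sum.cong[OF refl], rule sum.swap)
      also have "\<dots> = (\<Sum>n<N. \<Sum>m<N. c n * cnj (c m) * (\<Sum>f\<in>F. \<Sum>g\<in>G. h f g (n + k) * cnj (h f g (m + k))))"
        by (simp only: sum_distrib_left)
      also have "\<dots> = (\<Sum>n<N. \<Sum>m<N. c n * cnj (c m) * (cinner ((U ^^ n) v) ((U ^^ m) v) * cnj (cinner ((U ^^ n) w) ((U ^^ m) w))))"
      proof (rule sum.cong[OF refl], rule sum.cong[OF refl])
        fix n m assume "n \<in> {..<N}" "m \<in> {..<N}"
        then have "n + k < 2 * N" using k by simp
        from gram[OF this, of "m + k"] show "c n * cnj (c m) * (\<Sum>f\<in>F. \<Sum>g\<in>G. h f g (n + k) * cnj (h f g (m + k)))
          = c n * cnj (c m) * (cinner ((U ^^ n) v) ((U ^^ m) v) * cnj (cinner ((U ^^ n) w) ((U ^^ m) w)))"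
          using Un[of k "(U ^^ n) v" "(U ^^ m) v"] Un[of k "(U ^^ n) w" "(U ^^ m) w"]
          by (simp add: funpow_add add.commute[of _ k])
      qed
      finally show ?thesis .
    qed
    have "complex_of_real (Q k) = of_real (Q 0)" using Qk[OF k] Qk[of 0] False by simp
    then show ?thesis by (simp only: of_real_eq_iff)
  qed
  have "(\<Sum>k<N. Q k) = (\<Sum>k<N. Q 0)"
    by (rule sum.cong[OF refl], rule shift) simp
  then have "real N * Q 0 = (\<Sum>k<N. Q k)" by simp
  also have "\<dots> = (\<Sum>f\<in>F. \<Sum>g\<in>G. \<Sum>k<N. (norm (\<Sum>n<N. c n * h f g (n + k)))\<^sup>2)"
    unfolding Q_def by (subst sum.swap) (rule sum.cong[OF refl], rule sum.swap)
  also have "\<dots> \<le> (\<Sum>f\<in>F. \<Sum>g\<in>G. C\<^sup>2 * (\<Sum>j<2 * N. (norm (h f g j))\<^sup>2))"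
    by (intro sum_mono transference C)
  also have "\<dots> = C\<^sup>2 * (\<Sum>j<2 * N. \<Sum>f\<in>F. \<Sum>g\<in>G. (norm (h f g j))\<^sup>2)"
  proof -
    have "(\<Sum>f\<in>F. \<Sum>g\<in>G. \<Sum>j<2 * N. (norm (h f g j))\<^sup>2) = (\<Sum>f\<in>F. \<Sum>j<2 * N. \<Sum>g\<in>G. (norm (h f g j))\<^sup>2)"
      by (rule sum.cong[OF refl], rule sum.swap)
    also have "\<dots> = (\<Sum>j<2 * N. \<Sum>f\<in>F. \<Sum>g\<in>G. (norm (h f g j))\<^sup>2)" by (rule sum.swap)
    finally show ?thesis by (simp only: sum_distrib_left[symmetric])
  qed
  also have "\<dots> \<le> C\<^sup>2 * (\<Sum>j<2 * N. (norm v)\<^sup>2 * (norm w)\<^sup>2)"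
  proof (intro mult_left_mono sum_mono)
    fix j
    have "(\<Sum>f\<in>F. \<Sum>g\<in>G. (norm (h f g j))\<^sup>2) = (\<Sum>f\<in>F. (cmod (cinner ((U ^^ j) v) f))\<^sup>2) * (\<Sum>g\<in>G. (cmod (cinner ((U ^^ j) w) g))\<^sup>2)"
      by (simp add: h_def norm_mult power_mult_distrib sum_product)
    also have "\<dots> \<le> (norm v)\<^sup>2 * (norm w)\<^sup>2"
      using bessel[OF F, of "(U ^^ j) v"] bessel[OF G, of "(U ^^ j) w"] by (intro mult_mono) (auto simp: nUn sum_nonneg)
    finally show "(\<Sum>f\<in>F. \<Sum>g\<in>G. (norm (h f g j))\<^sup>2) \<le> (norm v)\<^sup>2 * (norm w)\<^sup>2" .
  qed simp
  also have "\<dots> = real N * (2 * C\<^sup>2 * (norm v)\<^sup>2 * (norm w)\<^sup>2)" by simp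
  finally have "Q 0 \<le> 2 * C\<^sup>2 * (norm v)\<^sup>2 * (norm w)\<^sup>2" using False by simp
  then have Q: "Q 0 \<le> (sqrt 2 * C * norm v * norm w)\<^sup>2" by (simp add: power_mult_distrib)
  have Q0: "0 \<le> Q 0" by (simp add: Q_def sum_nonneg)
  define H where "H f g = (\<Sum>n<N. c n * h f g n)" for f g
  have op_sum: "op_apply (\<Sum>n<N. B n) x = (\<Sum>n<N. op_apply (B n) x)" for B :: "nat \<Rightarrow> 'h bounded_op" and x
    by (induction N) simp_all
  show ?thesis
  proof (rule norm_bounded_op_le)
    fix x
    have wx: "cinner x ((U ^^ n) w) = (\<Sum>g\<in>G. cnj (cinner ((U ^^ n) w) g) * cinner x g)" if "n < N" for n
    proof -
      have "cinner ((U ^^ n) w) x = (\<Sum>g\<in>G. cinner ((U ^^ n) w) g * cnj (cinner x g))"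
        by (rule orthonormal_parseval[OF G wG]) (use that in simp)
      then show ?thesis by (subst cinner_commute) (simp add: cnj_sum)
    qed
    have "op_apply (\<Sum>n<N. c n *\<^sub>C rank1 ((U ^^ n) v) ((U ^^ n) w)) x = (\<Sum>n<N. (c n * cinner x ((U ^^ n) w)) *\<^sub>C (U ^^ n) v)"
      by (simp add: op_sum)
    also have "\<dots> = (\<Sum>n<N. \<Sum>f\<in>F. ((c n * cinner x ((U ^^ n) w)) * cinner ((U ^^ n) v) f) *\<^sub>C f)"
    proof (rule sum.cong[OF refl])
      fix n assume "n \<in> {..<N}"
      then have "(U ^^ n) v = (\<Sum>f\<in>F. cinner ((U ^^ n) v) f *\<^sub>C f)" by (intro vF[symmetric]) simp
      then have "(c n * cinner x ((U ^^ n) w)) *\<^sub>C (U ^^ n) v = (c n * cinner x ((U ^^ n) w)) *\<^sub>C (\<Sum>f\<in>F. cinner ((U ^^ n) v) f *\<^sub>C f)"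
        by (rule arg_cong)
      then show "(c n * cinner x ((U ^^ n) w)) *\<^sub>C (U ^^ n) v = (\<Sum>f\<in>F. ((c n * cinner x ((U ^^ n) w)) * cinner ((U ^^ n) v) f) *\<^sub>C f)"
        by (simp only: scaleC_sum_right scaleC_scaleC)
    qed
    also have "\<dots> = (\<Sum>f\<in>F. (\<Sum>n<N. (c n * cinner x ((U ^^ n) w)) * cinner ((U ^^ n) v) f) *\<^sub>C f)"
      unfolding scaleC_sum_left by (rule sum.swap)
    also have "\<dots> = (\<Sum>f\<in>F. (\<Sum>g\<in>G. cinner x g * H f g) *\<^sub>C f)"
    proof (rule sum.cong[OF refl], rule arg_cong[where f = "\<lambda>a. a *\<^sub>C _"])
      fix f
      have "(\<Sum>n<N. (c n * cinner x ((U ^^ n) w)) * cinner ((U ^^ n) v) f) = (\<Sum>n<N. \<Sum>g\<in>G. cinner x g * (c n * h f g n))"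
        by (intro sum.cong refl) (simp add: wx h_def sum_distrib_left sum_distrib_right mult_ac)
      also have "\<dots> = (\<Sum>g\<in>G. cinner x g * H f g)"
        unfolding H_def sum_distrib_left by (rule sum.swap)
      finally show "(\<Sum>n<N. (c n * cinner x ((U ^^ n) w)) * cinner ((U ^^ n) v) f) = (\<Sum>g\<in>G. cinner x g * H f g)" .
    qed
    finally have Sx: "op_apply (\<Sum>n<N. c n *\<^sub>C rank1 ((U ^^ n) v) ((U ^^ n) w)) x = (\<Sum>f\<in>F. (\<Sum>g\<in>G. cinner x g * H f g) *\<^sub>C f)" .
    have "(norm (op_apply (\<Sum>n<N. c n *\<^sub>C rank1 ((U ^^ n) v) ((U ^^ n) w)) x))\<^sup>2 = (\<Sum>f\<in>F. (cmod (\<Sum>g\<in>G. cinner x g * H f g))\<^sup>2)"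
      unfolding Sx by (rule orthonormal_norm_sum[OF F])
    also have "\<dots> \<le> (\<Sum>f\<in>F. (norm x)\<^sup>2 * (\<Sum>g\<in>G. (cmod (H f g))\<^sup>2))"
    proof (rule sum_mono)
      fix f
      have "cmod (\<Sum>g\<in>G. cinner x g * H f g) \<le> (\<Sum>g\<in>G. cmod (cinner x g) * cmod (H f g))"
        by (rule sum_norm_le) (simp add: norm_mult)
      then have "(cmod (\<Sum>g\<in>G. cinner x g * H f g))\<^sup>2 \<le> (\<Sum>g\<in>G. cmod (cinner x g) * cmod (H f g))\<^sup>2"
        by (intro power_mono) auto
      also have "\<dots> \<le> (\<Sum>g\<in>G. (cmod (cinner x g))\<^sup>2) * (\<Sum>g\<in>G. (cmod (H f g))\<^sup>2)"
        by (rule Cauchy_Schwarz_ineq_sum)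
      also have "\<dots> \<le> (norm x)\<^sup>2 * (\<Sum>g\<in>G. (cmod (H f g))\<^sup>2)"
        by (intro mult_right_mono bessel[OF G] sum_nonneg) simp
      finally show "(cmod (\<Sum>g\<in>G. cinner x g * H f g))\<^sup>2 \<le> (norm x)\<^sup>2 * (\<Sum>g\<in>G. (cmod (H f g))\<^sup>2)" .
    qed
    also have "\<dots> = (norm x)\<^sup>2 * Q 0" by (simp add: Q_def H_def sum_distrib_left)
    also have "\<dots> \<le> (norm x)\<^sup>2 * (sqrt 2 * C * norm v * norm w)\<^sup>2" by (intro mult_left_mono Q) simp
    also have "\<dots> = (sqrt 2 * C * norm v * norm w * norm x)\<^sup>2" by (simp add: power_mult_distrib)
    finally show "norm (op_apply (\<Sum>n<N. c n *\<^sub>C rank1 ((U ^^ n) v) ((U ^^ n) w)) x) \<le> sqrt 2 * C * norm v * norm w * norm x"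
      by (rule power2_le_imp_le) (use C0 in simp)
  qed (use C0 in simp)
qed (use C0 in simp)

section \<open>States and the disjointness theorem\<close>

lemma state_norm_le:
  assumes \<rho>: "state_on \<AA> \<rho>" and a: "a \<in> \<AA>" and scale: "\<And>c b. b \<in> \<AA> \<Longrightarrow> c *\<^sub>C b \<in> \<AA>"
  shows "cmod (\<rho> a) \<le> norm a"
proof -
  have lin: "\<rho> (c *\<^sub>C b) = c * \<rho> b" if "b \<in> \<AA>" for c b
    using \<rho> that by (simp add: state_on_def)
  show ?thesis
  proof (cases "a = 0")
    case True
    then show ?thesis using lin[OF a, of 0] by simp
  next
    case False
    define c where "c = complex_of_real (norm a)"
    have c: "c \<noteq> 0" "cmod c = norm a" using False by (simp_all add: c_def)
    have in_A: "(1 / c) *\<^sub>C a \<in> \<AA>" by (rule scale[OF a])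
    have "norm ((1 / c) *\<^sub>C a) \<le> 1" using c False by (simp add: norm_divide)
    then have "cmod (\<rho> ((1 / c) *\<^sub>C a)) \<le> Sup {cmod (\<rho> a) | a. a \<in> \<AA> \<and> norm a \<le> 1}"
      using \<rho> in_A by (intro cSup_upper) (auto simp: state_on_def)
    then have "cmod (\<rho> ((1 / c) *\<^sub>C a)) \<le> 1" using \<rho> by (simp add: state_on_def)
    then have "cmod (\<rho> a) / norm a \<le> 1" using c by (simp add: lin[OF a] norm_mult norm_divide)
    then show ?thesis using False by (simp add: divide_le_eq)
  qed
qed

lemma compact_ops_subset_plus_scalars: "A \<in> compact_ops \<Longrightarrow> A \<in> compact_ops_plus_scalars"
  unfolding compact_ops_plus_scalars_def mem_Collect_eq by (rule exI[of _ A], rule exI[of _ 0]) simp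

lemma one_in_plus_scalars: "1 \<in> (compact_ops_plus_scalars :: 'a::chilbert_space bounded_op set)"
  unfolding compact_ops_plus_scalars_def mem_Collect_eq
  by (rule exI[of _ 0], rule exI[of _ 1]) (simp add: zero_compact)

lemma plus_scalars_scaleC:
  assumes "T \<in> compact_ops_plus_scalars" shows "c *\<^sub>C T \<in> compact_ops_plus_scalars"
proof -
  obtain A d where A: "A \<in> compact_ops" "T = A + d *\<^sub>C 1" using assms by (auto simp: compact_ops_plus_scalars_def)
  then have "c *\<^sub>C T = c *\<^sub>C A + (c * d) *\<^sub>C 1" by (simp add: scaleC_add_right)
  then show ?thesis using compact_ops_scaleC[OF A(1), of c] by (auto simp: compact_ops_plus_scalars_def)
qed

lemma compact_ops_sum: "(\<And>i. i \<in> I \<Longrightarrow> B i \<in> compact_ops) \<Longrightarrow> (\<Sum>i\<in>I. B i) \<in> compact_ops"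
  by (induction I rule: infinite_finite_induct) (simp_all add: zero_compact compact_ops_add)

text \<open>By the spatial form of \<open>\<alpha>\<close>, by transference and by the uniform bound for exponential sums, the averages of a rank-one operator tend to 0.
The averages of an operator \<open>A\<close> are bounded by \<open>\<parallel>A\<parallel>\<close>, so finite-rank approximation extends this to compact operators; the scalar part is
the mean of \<open>\<mu>\<close>.\<close>

theorem proposition3p3:
  fixes \<alpha> :: "'h::chilbert_space bounded_op \<Rightarrow> 'h bounded_op"
  assumes "star_automorphism compact_ops \<alpha>"
  shows "linearly_disjoint moebius_mu compact_ops_plus_scalars (unital_extension \<alpha>)"
  unfolding linearly_disjoint_def
proof (intro allI impI)
  fix \<rho> :: "'h bounded_op \<Rightarrow> complex" and T :: "'h bounded_op"
  assume \<rho>: "state_on compact_ops_plus_scalars \<rho>" and T: "T \<in> compact_ops_plus_scalars"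
  note \<alpha> = assms
  have bound: "cmod (\<rho> a) \<le> norm a" if "a \<in> compact_ops_plus_scalars" for a
    by (rule state_norm_le[OF \<rho> that]) (rule plus_scalars_scaleC)
  note incl = compact_ops_subset_plus_scalars
  have \<rho>_add: "\<rho> (A + B) = \<rho> A + \<rho> B" if "A \<in> compact_ops_plus_scalars" "B \<in> compact_ops_plus_scalars" for A B
    using \<rho> that by (simp add: state_on_def)
  have \<rho>_scale: "\<rho> (c *\<^sub>C A) = c * \<rho> A" if "A \<in> compact_ops_plus_scalars" for c A
    using \<rho> that by (simp add: state_on_def)
  have \<rho>_0: "\<rho> 0 = 0" using \<rho>_scale[OF incl[OF zero_compact], of 0] by simp
  have \<rho>_sum: "\<rho> (\<Sum>i\<in>I. B i) = (\<Sum>i\<in>I. \<rho> (B i))" if "\<And>i. i \<in> I \<Longrightarrow> B i \<in> compact_ops" for I :: "nat set" and B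
    using that
    by (induction I rule: infinite_finite_induct) (simp_all add: \<rho>_0 \<rho>_add incl compact_ops_sum)
  have \<alpha>_in: "\<alpha> A \<in> compact_ops" if "A \<in> compact_ops" for A
    using \<alpha> that by (auto simp: star_automorphism_def bij_betw_def)
  have \<alpha>_add: "\<alpha> (A + B) = \<alpha> A + \<alpha> B" if "A \<in> compact_ops" "B \<in> compact_ops" for A B
    using \<alpha> that by (simp add: star_automorphism_def)
  have \<alpha>n_in: "(\<alpha> ^^ n) A \<in> compact_ops" if "A \<in> compact_ops" for n A
    using that by (induction n) (simp_all add: \<alpha>_in)
  have \<alpha>n_add: "(\<alpha> ^^ n) (A + B) = (\<alpha> ^^ n) A + (\<alpha> ^^ n) B" if "A \<in> compact_ops" "B \<in> compact_ops" for n A B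
    using that by (induction n) (simp_all add: \<alpha>_add \<alpha>n_in)
  \<comment> \<open>On the zero space every functional has norm 0, so there is no state.\<close>
  have "\<exists>x::'h. x \<noteq> 0"
  proof (rule ccontr)
    assume "\<not> ?thesis"
    then have "A = 0" for A :: "'h bounded_op" by (intro bounded_op_eqI) (metis)
    then have "{cmod (\<rho> a) | a. a \<in> compact_ops_plus_scalars \<and> norm a \<le> 1} = {0}"
      using \<rho>_0 incl[OF zero_compact] by (auto intro!: exI[of _ 0]) (metis norm_zero)+
    then show False using \<rho> by (simp add: state_on_def)
  qed
  then obtain x0 :: 'h where x0: "x0 \<noteq> 0" by blast
  define x where "x = (1 / of_real (norm x0)) *\<^sub>C x0"
  have "norm x = 1" using x0 by (simp add: x_def norm_divide)
  from compact_automorphism_spatial[OF \<alpha> this] obtain U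
    where U: "\<And>v w. cinner (U v) (U w) = cinner v w" and \<alpha>U: "\<And>v w. \<alpha> (rank1 v w) = rank1 (U v) (U w)"
      and \<alpha>_norm: "\<And>A. A \<in> compact_ops \<Longrightarrow> norm (\<alpha> A) \<le> norm A" by blast
  have \<alpha>n_norm: "norm ((\<alpha> ^^ n) A) \<le> norm A" if "A \<in> compact_ops" for n A
  proof (induction n)
    case (Suc n)
    then show ?case using \<alpha>_norm[OF \<alpha>n_in[OF that, of n]] by simp
  qed simp
  have \<alpha>n_rank1: "(\<alpha> ^^ n) (rank1 v w) = rank1 ((U ^^ n) v) ((U ^^ n) w)" for n v w
    by (induction n) (simp_all add: \<alpha>U)
  define M where "M A N = (\<Sum>n=1..N. of_int (moebius_mu n) * \<rho> ((\<alpha> ^^ n) A)) / of_nat N" for A N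
  have mu0: "moebius_mu 0 = 0" by (simp add: moebius_mu_def)
  have rank1_lim: "M (rank1 v w) \<longlonglongrightarrow> 0" for v w
  proof (rule LIMSEQ_I)
    fix r :: real assume r: "0 < r"
    define b where "b = sqrt 2 * norm v * norm w + 1"
    have b: "0 < b" by (simp add: b_def add_nonneg_pos)
    obtain N0 where N0: "\<And>N z. N0 \<le> N \<Longrightarrow> norm (z::complex) = 1 \<Longrightarrow> norm (\<Sum>n=1..N. of_int (moebius_mu n) * z ^ n) \<le> r / (2 * b) * real N"
      using moebius_exponential_sum_uniform[of "r / (2 * b)"] r b by auto
    have "norm (M (rank1 v w) N - 0) < r" if N: "max 1 N0 \<le> N" for N
    proof -
      define B where "B n = of_int (moebius_mu n) *\<^sub>C rank1 ((U ^^ n) v) ((U ^^ n) w)" for n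
      have shift: "(\<Sum>n<Suc N. f n) = (\<Sum>n=1..N. f n)" if "f 0 = 0" for f :: "nat \<Rightarrow> 'b::comm_monoid_add"
        using that by (simp add: lessThan_Suc_atMost atMost_atLeast0 sum.atLeast_Suc_atMost)
      have "norm (\<Sum>n<Suc N. B n) \<le> sqrt 2 * (r / (2 * b) * real N) * norm v * norm w"
        unfolding B_def
      proof (rule norm_unitary_orbit_sum[OF U])
        fix z :: complex assume "norm z = 1"
        then show "norm (\<Sum>n<Suc N. of_int (moebius_mu n) * z ^ n) \<le> r / (2 * b) * real N"
          using N0[of N z] N by (subst shift) (simp_all add: mu0)
      qed (use r b in simp)
      moreover have "(\<Sum>n=1..N. of_int (moebius_mu n) * \<rho> ((\<alpha> ^^ n) (rank1 v w))) = \<rho> (\<Sum>n<Suc N. B n)"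
      proof -
        have "\<rho> (\<Sum>n<Suc N. B n) = (\<Sum>n<Suc N. \<rho> (B n))"
          by (rule \<rho>_sum) (simp add: B_def compact_ops_scaleC rank1_compact)
        also have "\<dots> = (\<Sum>n=1..N. \<rho> (B n))" by (rule shift) (simp add: B_def mu0 \<rho>_0)
        finally show ?thesis by (simp add: B_def \<rho>_scale incl rank1_compact \<alpha>n_rank1)
      qed
      moreover have "cmod (\<rho> (\<Sum>n<Suc N. B n)) \<le> norm (\<Sum>n<Suc N. B n)"
        by (intro bound incl compact_ops_sum) (simp_all add: B_def compact_ops_scaleC rank1_compact)
      ultimately have "cmod (\<Sum>n=1..N. of_int (moebius_mu n) * \<rho> ((\<alpha> ^^ n) (rank1 v w))) \<le> sqrt 2 * (r / (2 * b) * real N) * norm v * norm w"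
        by simp
      also have "\<dots> = real N * (r / 2) * ((sqrt 2 * norm v * norm w) / b)" by simp
      also have "\<dots> \<le> real N * (r / 2) * 1"
        using b r by (intro mult_left_mono) (simp_all add: b_def divide_le_eq)
      finally have "cmod (\<Sum>n=1..N. of_int (moebius_mu n) * \<rho> ((\<alpha> ^^ n) (rank1 v w))) \<le> real N * (r / 2)" by simp
      then have "norm (M (rank1 v w) N) \<le> r / 2"
        using N by (simp add: M_def norm_divide divide_le_eq mult.commute)
      then show ?thesis using r by simp
    qed
    then show "\<exists>no. \<forall>n\<ge>no. norm (M (rank1 v w) n - 0) < r" by blast
  qed
  have M_add: "M (A + B) N = M A N + M B N" if "A \<in> compact_ops" "B \<in> compact_ops" for A B N
    using that by (simp add: M_def \<alpha>n_add \<rho>_add incl \<alpha>n_in distrib_left sum.distrib add_divide_distrib)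
  have M_norm: "norm (M A N) \<le> norm A" if A: "A \<in> compact_ops" for A N
  proof (cases "N = 0")
    case False
    have "cmod (\<Sum>n=1..N. of_int (moebius_mu n) * \<rho> ((\<alpha> ^^ n) A)) \<le> (\<Sum>n=1..N. norm A)"
    proof (rule sum_norm_le)
      fix n
      have "cmod (of_int (moebius_mu n)) * cmod (\<rho> ((\<alpha> ^^ n) A)) \<le> 1 * norm A"
        by (intro mult_mono norm_moebius_mu_le order.trans[OF bound \<alpha>n_norm] incl \<alpha>n_in A) auto
      then show "cmod (of_int (moebius_mu n) * \<rho> ((\<alpha> ^^ n) A)) \<le> norm A" by (simp add: norm_mult)
    qed
    then show ?thesis using False by (simp add: M_def norm_divide divide_le_eq mult.commute)
  qed (simp add: M_def)
  have compact_lim: "M A \<longlonglongrightarrow> 0" if A: "A \<in> compact_ops" for A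
  proof (rule LIMSEQ_I)
    fix r :: real assume r: "0 < r"
    obtain F where F: "finite F" "norm (A - (\<Sum>f\<in>F. rank1 f (op_apply (star A) f))) \<le> r / 2"
      using compact_op_finite_rank_approximation[OF A, of "r / 2"] r by auto
    define R where "R = (\<Sum>f\<in>F. rank1 f (op_apply (star A) f))"
    have Rc: "R \<in> compact_ops" unfolding R_def by (rule compact_ops_sum[OF rank1_compact])
    have Dc: "A - R \<in> compact_ops"
      using compact_ops_add[OF A compact_ops_scaleC[OF Rc, of "-1"]] by (simp add: scaleC_minus_left)
    have "M (\<Sum>f\<in>G. rank1 f (op_apply (star A) f)) \<longlonglongrightarrow> 0" if "finite G" for G
      using that
    proof (induction G rule: finite_induct)
      case empty
      have "(\<alpha> ^^ n) 0 = 0" for n using \<alpha>n_norm[OF zero_compact, of n] by simp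
      then show ?case by (simp add: M_def \<rho>_0)
    next
      case (insert g G)
      have "(\<lambda>N. M (rank1 g (op_apply (star A) g)) N + M (\<Sum>f\<in>G. rank1 f (op_apply (star A) f)) N) \<longlonglongrightarrow> 0 + 0"
        by (intro tendsto_add rank1_lim insert.IH)
      then show ?case
        using insert.hyps by (simp add: M_add[OF rank1_compact compact_ops_sum[OF rank1_compact], symmetric])
    qed
    then have "M R \<longlonglongrightarrow> 0" using F(1) by (simp add: R_def)
    then obtain N0 where N0: "\<And>N. N0 \<le> N \<Longrightarrow> norm (M R N) < r / 2"
      using LIMSEQ_D[of "M R" 0 "r / 2"] r by auto
    have "norm (M A N - 0) < r" if N: "N0 \<le> N" for N
    proof -
      have "M A N = M (A - R) N + M R N" using M_add[OF Dc Rc, of N] by simp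
      then have "norm (M A N) \<le> norm (M (A - R) N) + norm (M R N)" by (simp add: norm_triangle_ineq)
      also have "\<dots> < r / 2 + r / 2"
        using M_norm[OF Dc, of N] F(2) N0[OF N] by (intro add_le_less_mono) (simp_all add: R_def)
      finally show ?thesis by simp
    qed
    then show "\<exists>no. \<forall>n\<ge>no. norm (M A n - 0) < r" by blast
  qed
  obtain A c where A: "A \<in> compact_ops" and Tc: "T = A + c *\<^sub>C 1" using T by (auto simp: compact_ops_plus_scalars_def)
  have ext: "(unital_extension \<alpha> ^^ n) T = (\<alpha> ^^ n) A + c *\<^sub>C 1" for n
  proof (induction n)
    case (Suc n)
    then show ?case by (simp add: unital_extension_eq[OF \<alpha> \<alpha>n_in[OF A]])
  qed (simp add: Tc)
  have scalar: "c *\<^sub>C 1 \<in> compact_ops_plus_scalars" by (rule plus_scalars_scaleC[OF one_in_plus_scalars])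
  have "(\<lambda>N. (\<Sum>n=1..N. of_int (moebius_mu n) * (\<lambda>_. \<rho> (c *\<^sub>C 1)) n) / of_nat N) \<longlonglongrightarrow> 0"
    by (rule moebius_periodic_mean[of 1]) simp_all
  from tendsto_add[OF compact_lim[OF A] this]
  have "(\<lambda>N. M A N + (\<Sum>n=1..N. of_int (moebius_mu n) * \<rho> (c *\<^sub>C 1)) / of_nat N) \<longlonglongrightarrow> 0" by simp
  moreover have "M A N + (\<Sum>n=1..N. of_int (moebius_mu n) * \<rho> (c *\<^sub>C 1)) / of_nat N
      = 1 / of_nat N * (\<Sum>n=1..N. of_int (moebius_mu n) * \<rho> ((unital_extension \<alpha> ^^ n) T))" for N
    by (simp add: M_def ext \<rho>_add[OF incl[OF \<alpha>n_in[OF A]] scalar] distrib_left sum.distrib add_divide_distrib)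
  ultimately show "(\<lambda>N. 1 / of_nat N * (\<Sum>n=1..N. of_int (moebius_mu n) * \<rho> ((unital_extension \<alpha> ^^ n) T))) \<longlonglongrightarrow> 0"
    by simp
qed

end
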